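(* Let $V$ be a finite set and let $f:2^V\to\mathbb{Z}$ be a submodular function. For a constant positive integer $k$, a set attaining the $k$-th smallest value of $f$ can be obtained in polynomial time.
   Context: A set function $f:2^V\to\mathbb{Z}$ is submodular if $f(X)+f(Y)\ge f(X\cup Y)+f(X\cap Y)$ for all $X,Y\subseteq V$. It is accessed in the evaluation oracle model, i.e. through an oracle returning $f(X)$ for any given $X\subseteq V$. The $k$-th smallest value of $f$ is the $k$-th smallest element of the set of values $\{f(X)\mid X\subseteq V\}$ (distinct values are counted); the algorithm is required to output a set attaining it whenever $f$ has at least $k$ distinct values. Polynomial time means polynomial in $n=|V|$ for fixed $k$ (the polynomial may depend on $k$), counting oracle queries and elementary operations. *)

theory Defs
  imports Main "HOL-Computational_Algebra.Polynomial"
begin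

definition submodular_on :: "'a set \<Rightarrow> ('a set \<Rightarrow> int) \<Rightarrow> bool" where
  "submodular_on V f \<longleftrightarrow>
     (\<forall>X Y. X \<subseteq> V \<longrightarrow> Y \<subseteq> V \<longrightarrow> f X + f Y \<ge> f (X \<union> Y) + f (X \<inter> Y))"

text \<open>Distinct values are counted, and \<open>k\<close> starts at 1; meaningful for
  \<open>1 \<le> k \<le> card (f ` Pow V)\<close>.\<close>
definition kth_smallest_value :: "'a set \<Rightarrow> ('a set \<Rightarrow> int) \<Rightarrow> nat \<Rightarrow> int" where
  "kth_smallest_value V f k = sorted_list_of_set (f ` Pow V) ! (k - 1)"

text \<open>The model of computation is a structured random access machine with an evaluation oracle.
  Memory cells hold integers and are addressed by integers. The elementary operations, each of
  unit cost, are constants, memory accesses, addition, subtraction, multiplication, comparisons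
  and oracle calls. Rational arithmetic is available at constant overhead through pairs of
  integers; rounding division is deliberately not an elementary operation.\<close>

type_synonym mem = "int \<Rightarrow> int"

datatype aexp =
    Const int
  | Cell aexp
  | Add aexp aexp
  | Sub aexp aexp
  | Mul aexp aexp

datatype bexp = Less aexp aexp

datatype com =
    Skip
  | Store aexp aexp
  | Query aexp aexp
  | Seq com com
  | If bexp com com
  | While bexp com

fun aval :: "aexp \<Rightarrow> mem \<Rightarrow> int" where
  "aval (Const c) s = c"
| "aval (Cell a) s = s (aval a s)"
| "aval (Add a b) s = aval a s + aval b s"
| "aval (Sub a b) s = aval a s - aval b s"
| "aval (Mul a b) s = aval a s * aval b s"

fun acost :: "aexp \<Rightarrow> nat" where
  "acost (Const c) = 1"
| "acost (Cell a) = 1 + acost a"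
| "acost (Add a b) = 1 + acost a + acost b"
| "acost (Sub a b) = 1 + acost a + acost b"
| "acost (Mul a b) = 1 + acost a + acost b"

fun bval :: "bexp \<Rightarrow> mem \<Rightarrow> bool" where
  "bval (Less a b) s \<longleftrightarrow> aval a s < aval b s"

fun bcost :: "bexp \<Rightarrow> nat" where
  "bcost (Less a b) = 1 + acost a + acost b"

text \<open>A subset of \<open>{..<n}\<close> is represented by its characteristic vector, stored in the \<open>n\<close>
  consecutive cells starting at address \<open>a\<close>.\<close>
definition stored_set :: "nat \<Rightarrow> mem \<Rightarrow> int \<Rightarrow> nat set" where
  "stored_set n s a = {i. i < n \<and> s (a + int i) \<noteq> 0}"

text \<open>\<open>exec n F c s T t\<close>: with oracle \<open>F\<close> for a function on the subsets of \<open>{..<n}\<close>, program \<open>c\<close>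
  started in memory \<open>s\<close> halts in memory \<open>t\<close> after \<open>T\<close> elementary operations and oracle calls.
  \<open>Query a b\<close> writes the oracle's answer for the set stored at address \<open>b\<close> into cell \<open>a\<close>.\<close>
inductive exec :: "nat \<Rightarrow> (nat set \<Rightarrow> int) \<Rightarrow> com \<Rightarrow> mem \<Rightarrow> nat \<Rightarrow> mem \<Rightarrow> bool"
  for n :: nat and F :: "nat set \<Rightarrow> int" where
  Skip: "exec n F Skip s 1 s"
| Store: "exec n F (Store a b) s (1 + acost a + acost b) (s(aval a s := aval b s))"
| Query: "exec n F (Query a b) s (1 + acost a + acost b)
            (s(aval a s := F (stored_set n s (aval b s))))"
| Seq: "exec n F c s T1 s' \<Longrightarrow> exec n F d s' T2 t \<Longrightarrow> exec n F (Seq c d) s (T1 + T2) t"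
| IfTrue: "bval b s \<Longrightarrow> exec n F c s T t \<Longrightarrow> exec n F (If b c d) s (bcost b + T) t"
| IfFalse: "\<not> bval b s \<Longrightarrow> exec n F d s T t \<Longrightarrow> exec n F (If b c d) s (bcost b + T) t"
| WhileFalse: "\<not> bval b s \<Longrightarrow> exec n F (While b c) s (bcost b) s"
| WhileTrue: "bval b s \<Longrightarrow> exec n F c s T1 s' \<Longrightarrow> exec n F (While b c) s' T2 t \<Longrightarrow>
                exec n F (While b c) s (bcost b + T1 + T2) t"

text \<open>Executions are deterministic, so exhibiting one halting execution determines running time
  and result.\<close>
lemma exec_deterministic:
  assumes "exec n F c s T t" and "exec n F c s T' t'"
  shows "T = T' \<and> t = t'"
  using assms
proof (induction arbitrary: T' t' rule: exec.induct)
  case Skip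
  then show ?case by (auto elim: exec.cases)
next
  case Store
  then show ?case by (auto elim: exec.cases)
next
  case Query
  then show ?case by (auto elim: exec.cases)
next
  case Seq
  from Seq.prems Seq.IH show ?case by cases blast
next
  case IfTrue
  from IfTrue.prems IfTrue.IH IfTrue.hyps show ?case by cases blast+
next
  case IfFalse
  from IfFalse.prems IfFalse.IH IfFalse.hyps show ?case by cases blast+
next
  case WhileFalse
  from WhileFalse.prems WhileFalse.hyps show ?case by cases blast+
next
  case WhileTrue
  from WhileTrue.prems WhileTrue.IH WhileTrue.hyps show ?case by cases blast+
qed

text \<open>A program sees the ground set only through an enumeration \<open>e\<close> of it by \<open>{..<n}\<close>. The input
  is \<open>n\<close>, in cell 0, all other cells being 0; the output is the set stored in cells 1 to \<open>n\<close>.\<close>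
definition input_mem :: "nat \<Rightarrow> mem" where
  "input_mem n = (\<lambda>_. 0)(0 := int n)"

definition computes_set :: "com \<Rightarrow> 'a set \<Rightarrow> (nat \<Rightarrow> 'a) \<Rightarrow> ('a set \<Rightarrow> int) \<Rightarrow> nat \<Rightarrow> 'a set \<Rightarrow> bool"
  where
  "computes_set c V e f T X \<longleftrightarrow>
     (\<exists>t. exec (card V) (\<lambda>A. f (e ` A)) c (input_mem (card V)) T t \<and>
          X = e ` stored_set (card V) t 1)"

end

theory Submission imports Defs begin

text \<open>
  Let \<open>X\<^sub>0\<close> attain the \<open>k\<close>-th smallest value. The sets of minimum value within an interval
  \<open>{X. S \<subseteq> X \<subseteq> V - T}\<close> form a lattice, so if \<open>X\<^sub>0\<close> is not among them, then some pair of an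
  element of \<open>X\<^sub>0\<close> and an element outside separates it from all of them; adding the pair to \<open>S\<close> and \<open>T\<close>
  removes a value below \<open>f X\<^sub>0\<close>. Hence \<open>X\<^sub>0\<close> is a minimiser over an interval with
  \<open>|S|, |T| \<le> k - 1\<close>. The algorithm minimises \<open>X \<mapsto> f ((X \<union> S) - T)\<close>, which is again
  submodular, for each of the polynomially many such pairs, and picks the \<open>k\<close>-th smallest of the
  values found.

  Submodular functions are minimised by the push-relabel variant, due to Fleischer and Iwata, of
  Schrijver's algorithm: a point \<open>x = \<Sum>\<^sub>j \<lambda>\<^sub>j b\<^sup>j\<close> of the cone over the base polyhedron is
  kept as a combination of greedy vectors, \<open>x\<close> is pushed between elements by exchanges in the
  underlying orders, and the labels bound distances in the graph of these orders. All conditions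
  are homogeneous in \<open>\<lambda>\<close>, so the weights are kept integral and are never normalised; the number of
  orders is kept at most \<open>n + 1\<close> by division-free Gaussian elimination. The number of pushes and relabellings is
  bounded by a lexicographic potential that does not depend on the values of \<open>f\<close>.

  The algorithm is written in a small language of array comprehensions with bounded loops, whose
  programs run in polynomial time on the machine by construction.
\<close>

text \<open>The number of operations may depend on \<open>n\<close> only, so no measure of progress
  may involve the size of the values of \<open>f\<close>; the potential is purely combinatorial.
  Integers of any size cost one unit, which is why multiplying all weights by a common factor can
  replace every division. All loops run the same fixed number of rounds, so each loop body must be
  harmless once its goal has been reached, and correctness means that the goal is reached in time.

  A separating pair exists because otherwise, for all \<open>a\<close> in \<open>X0\<close> and
  \<open>b\<close> outside, some minimiser contains \<open>a\<close> and avoids \<open>b\<close>;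
  intersecting over \<open>b\<close> and uniting over \<open>a\<close> would make \<open>X0\<close>
  itself a minimiser. Each separation adds at most one element to \<open>S\<close> and one to
  \<open>T\<close> and removes at least one of the \<open>k - 1\<close> smaller values, whence the
  bound \<open>k - 1\<close>. The values found need not be all values of \<open>f\<close>, but
  everything up to the sought value is a minimum over one of the intervals tried, so its rank among
  the values found is its true rank.\<close>

section \<open>A language of array programs and its compilation\<close>

text \<open>The value is \<open>N\<close> if no number below \<open>N\<close> satisfies \<open>P\<close>.\<close>

definition first :: "nat \<Rightarrow> (nat \<Rightarrow> bool) \<Rightarrow> nat" where
  "first N P = (LEAST i. i < N \<longrightarrow> P i)"

lemma first_le: "first N P \<le> N"
  unfolding first_def by (rule Least_le) simp

lemma first_holds: "first N P < N \<Longrightarrow> P (first N P)"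
  using LeastI[of "\<lambda>i. i < N \<longrightarrow> P i" N] unfolding first_def by simp

lemma first_least: "i < N \<Longrightarrow> P i \<Longrightarrow> first N P \<le> i"
  unfolding first_def by (rule Least_le) simp

lemma first_less_iff: "first N P < N \<longleftrightarrow> (\<exists>i<N. P i)"
  using first_holds[of N P] first_least[of _ N P] le_less_trans by blast

lemma first_eqI: "P i \<Longrightarrow> i < N \<Longrightarrow> (\<And>j. j < i \<Longrightarrow> \<not> P j) \<Longrightarrow> first N P = i"
  using first_holds[of N P] first_least[of i N P]
  by (metis le_less_trans le_neq_implies_less)

type_synonym store = "nat \<Rightarrow> nat \<Rightarrow> nat \<Rightarrow> int"

text \<open>Only bounded constructs: \<open>Summ\<close>, \<open>Mu\<close> and \<open>Orc\<close>
  bind a variable that runs over an initial segment. This is what makes every program polynomial,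
  whatever it computes.\<close>

datatype ex =
    Lit int | Dim | Var nat | Arr nat ex ex
  | Pls ex ex | Mns ex ex | Tms ex ex | Ite ex ex ex ex
  | Summ nat ex | Mu nat ex | Orc nat ex

text \<open>\<open>Rep\<close> has no exit test, so its body has to tolerate surplus rounds.
  \<open>Asg\<close> fills a whole matrix at once; there is no assignment to a single entry.\<close>

datatype pr = Asg nat nat nat ex | Then pr pr | Cond ex ex pr pr | Rep pr

context
  fixes n N :: nat and F :: "nat set \<Rightarrow> int"
begin

text \<open>\<open>Summ\<close> and \<open>Mu\<close> run up to \<open>N\<close>, since they also
  range over array rows, while \<open>Orc\<close> collects elements below \<open>n\<close>. A
  negative index reads entry 0, and a failed search returns \<open>N\<close>.\<close>

primrec ev :: "store \<Rightarrow> (nat \<Rightarrow> nat) \<Rightarrow> ex \<Rightarrow> int" where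
  "ev \<sigma> \<rho> (Lit c) = c"
| "ev \<sigma> \<rho> Dim = int n"
| "ev \<sigma> \<rho> (Var v) = int (\<rho> v)"
| "ev \<sigma> \<rho> (Arr a e1 e2) = \<sigma> a (nat (ev \<sigma> \<rho> e1)) (nat (ev \<sigma> \<rho> e2))"
| "ev \<sigma> \<rho> (Pls e1 e2) = ev \<sigma> \<rho> e1 + ev \<sigma> \<rho> e2"
| "ev \<sigma> \<rho> (Mns e1 e2) = ev \<sigma> \<rho> e1 - ev \<sigma> \<rho> e2"
| "ev \<sigma> \<rho> (Tms e1 e2) = ev \<sigma> \<rho> e1 * ev \<sigma> \<rho> e2"
| "ev \<sigma> \<rho> (Ite e1 e2 e3 e4) = (if ev \<sigma> \<rho> e1 < ev \<sigma> \<rho> e2 then ev \<sigma> \<rho> e3 else ev \<sigma> \<rho> e4)"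
| "ev \<sigma> \<rho> (Summ v e) = (\<Sum>i<N. ev \<sigma> (\<rho>(v := i)) e)"
| "ev \<sigma> \<rho> (Mu v e) = int (first N (\<lambda>i. ev \<sigma> (\<rho>(v := i)) e \<noteq> 0))"
| "ev \<sigma> \<rho> (Orc v e) = F {i. i < n \<and> ev \<sigma> (\<rho>(v := i)) e \<noteq> 0}"

primrec run :: "pr \<Rightarrow> store \<Rightarrow> store" where
  "run (Asg a i j e) \<sigma> = \<sigma>(a := \<lambda>p q. if p < N \<and> q < N then ev \<sigma> ((\<lambda>_. 0)(i := p, j := q)) e else \<sigma> a p q)"
| "run (Then c d) \<sigma> = run d (run c \<sigma>)"
| "run (Cond a b c d) \<sigma> = (if ev \<sigma> (\<lambda>_. 0) a < ev \<sigma> (\<lambda>_. 0) b then run c \<sigma> else run d \<sigma>)"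
| "run (Rep c) \<sigma> = (run c ^^ N) \<sigma>"

end

text \<open>The common length of all loops, sums, searches and comprehensions; it has to exceed the number
  of steps and of array rows that a program needs.\<close>

definition psize :: "nat \<Rightarrow> nat \<Rightarrow> nat" where "psize m n = (n + 2) ^ m"

text \<open>The exponent is fixed with the program, so the power unrolls into an expression of
  constant cost.\<close>

primrec sizex :: "nat \<Rightarrow> aexp" where
  "sizex 0 = Const 1"
| "sizex (Suc m) = Mul (Add (Cell (Const 0)) (Const 2)) (sizex m)"

lemma aval_sizex: "s 0 = int n \<Longrightarrow> aval (sizex m) s = int (psize m n)"
  by (induction m) (auto simp: psize_def algebra_simps)

text \<open>Twice the Cantor pairing function, so that no division is needed to evaluate it.\<close>

definition pair_code :: "int \<Rightarrow> int \<Rightarrow> int" where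
  "pair_code x y = (x + y) * (x + y + 1) + 2 * y"

lemma pair_code_nonneg: "0 \<le> x \<Longrightarrow> 0 \<le> y \<Longrightarrow> 0 \<le> pair_code x y"
  unfolding pair_code_def by simp

text \<open>On the diagonal with sum \<open>a\<close> the code lies between
  \<open>a * (a + 1)\<close> and \<open>a * (a + 1) + 2 * a\<close>, which is less than
  \<open>(a + 1) * (a + 2)\<close>, the start of the next diagonal.\<close>

lemma pair_code_less:
  assumes "0 \<le> x" "0 \<le> y" "0 \<le> x'" "0 \<le> y'" "x + y < x' + y'"
  shows "pair_code x y < pair_code x' y'"
proof -
  let ?a = "x + y" and ?b = "x' + y'"
  have "pair_code x y \<le> ?a * (?a + 1) + 2 * ?a" unfolding pair_code_def using assms by simp
  also have "\<dots> < (?a + 1) * (?a + 2)" by (simp add: algebra_simps)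
  also have "\<dots> \<le> ?b * (?b + 1)" using assms by (intro mult_mono) auto
  also have "\<dots> \<le> pair_code x' y'" unfolding pair_code_def using assms by simp
  finally show ?thesis .
qed

lemma pair_code_inj:
  assumes "0 \<le> x" "0 \<le> y" "0 \<le> x'" "0 \<le> y'" "pair_code x y = pair_code x' y'"
  shows "x = x' \<and> y = y'"
proof -
  have "x + y = x' + y'"
    using pair_code_less[of x y x' y'] pair_code_less[of x' y' x y] assms by force
  then show ?thesis using assms(5) unfolding pair_code_def by auto
qed

text \<open>Addresses are negative to stay clear of cell 0, which keeps \<open>n\<close>, and of
  cells 1 to \<open>n\<close>, where oracle arguments and the output are placed.\<close>

definition loc :: "nat \<Rightarrow> nat \<Rightarrow> nat \<Rightarrow> int" where
  "loc x p q = - 1 - pair_code (pair_code (int x) (int p)) (int q)"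

lemma loc_eq [simp]: "loc x p q = loc x' p' q' \<longleftrightarrow> x = x' \<and> p = p' \<and> q = q'"
  unfolding loc_def
  using pair_code_inj[of "int x" "int p" "int x'" "int p'"]
    pair_code_inj[of "pair_code (int x) (int p)" "int q" "pair_code (int x') (int p')" "int q'"]
  by (auto simp: pair_code_nonneg)

lemma loc_neg: "loc x p q < 0"
  unfolding loc_def using pair_code_nonneg[of "pair_code (int x) (int p)" "int q"]
    pair_code_nonneg[of "int x" "int p"] by simp

definition pairx :: "aexp \<Rightarrow> aexp \<Rightarrow> aexp" where
  "pairx a b = Add (Mul (Add a b) (Add (Add a b) (Const 1))) (Mul (Const 2) b)"

definition locx :: "nat \<Rightarrow> aexp \<Rightarrow> aexp \<Rightarrow> aexp" where
  "locx x a b = Sub (Const (-1)) (pairx (pairx (Const (int x)) a) b)"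

lemma aval_locx: "aval a s = int p \<Longrightarrow> aval b s = int q \<Longrightarrow> aval (locx x a b) s = loc x p q"
  unfolding locx_def pairx_def loc_def pair_code_def by simp

text \<open>The cells \<open>tmp d k\<close> belong to nesting depth \<open>d\<close>: \<open>k = 0\<close> holds the result of an expression,
  2 an accumulator, 3 a loop counter, 4 the saved value of the loop variable, and the cells from 5 on
  collect the argument of an oracle call, since evaluating it may itself call the oracle and overwrite
  cells 1 to \<open>n\<close>. A comprehension is first evaluated into \<open>buf\<close>, as its expression may read the
  array that is assigned.\<close>

definition arr :: "nat \<Rightarrow> nat \<Rightarrow> nat \<Rightarrow> int" where "arr a = loc (4 * a)"
definition var :: "nat \<Rightarrow> int" where "var v = loc (4 * v + 1) 0 0"
definition tmp :: "nat \<Rightarrow> nat \<Rightarrow> int" where "tmp d k = loc (4 * d + 2) 0 k"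
definition buf :: "nat \<Rightarrow> nat \<Rightarrow> int" where "buf = loc 3"

lemma cell_eq [simp]:
  "arr a p q = arr a' p' q' \<longleftrightarrow> a = a' \<and> p = p' \<and> q = q'"
  "var v = var v' \<longleftrightarrow> v = v'"
  "tmp d k = tmp d' k' \<longleftrightarrow> d = d' \<and> k = k'"
  "buf p q = buf p' q' \<longleftrightarrow> p = p' \<and> q = q'"
  unfolding arr_def var_def tmp_def buf_def by auto

text \<open>The tags \<open>4 * a\<close>, \<open>4 * v + 1\<close>, \<open>4 * d + 2\<close> and 3
  lie in different residue classes modulo 4.\<close>

lemma cell_neq [simp]:
  "arr a p q \<noteq> var v" "var v \<noteq> arr a p q" "arr a p q \<noteq> tmp d k" "tmp d k \<noteq> arr a p q"
  "arr a p q \<noteq> buf p' q'" "buf p' q' \<noteq> arr a p q" "var v \<noteq> tmp d k" "tmp d k \<noteq> var v"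
  "var v \<noteq> buf p q" "buf p q \<noteq> var v" "tmp d k \<noteq> buf p q" "buf p q \<noteq> tmp d k"
  unfolding arr_def var_def tmp_def buf_def loc_eq by presburger+

lemma io_cell_neq [simp]:
  "arr a p q \<noteq> 0" "0 \<noteq> arr a p q" "arr a p q \<noteq> 1 + int i" "1 + int i \<noteq> arr a p q"
  "var v \<noteq> 0" "0 \<noteq> var v" "var v \<noteq> 1 + int i" "1 + int i \<noteq> var v"
  "tmp d k \<noteq> 0" "0 \<noteq> tmp d k" "tmp d k \<noteq> 1 + int i" "1 + int i \<noteq> tmp d k"
  "buf p q \<noteq> 0" "0 \<noteq> buf p q" "buf p q \<noteq> 1 + int i" "1 + int i \<noteq> buf p q"
  unfolding arr_def var_def tmp_def buf_def
  using loc_neg[of "4 * a" p q] loc_neg[of "4 * v + 1" 0 0] loc_neg[of "4 * d + 2" 0 k] loc_neg[of 3 p q]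
  by linarith+

section \<open>Representation of stores in memory, and frame conditions\<close>

definition repr :: "nat \<Rightarrow> store \<Rightarrow> (nat \<Rightarrow> nat) \<Rightarrow> mem \<Rightarrow> bool" where
  "repr n \<sigma> \<rho> s \<longleftrightarrow> s 0 = int n \<and> (\<forall>a p q. s (arr a p q) = \<sigma> a p q) \<and> (\<forall>v. s (var v) = int (\<rho> v))"

text \<open>Code compiled for depth \<open>d\<close> may destroy scratch cells of depth
  \<open>d\<close> and more; the intermediate results of the enclosing constructs sit at smaller
  depths.\<close>

definition temps_eq :: "nat \<Rightarrow> mem \<Rightarrow> mem \<Rightarrow> bool" where
  "temps_eq d s t \<longleftrightarrow> (\<forall>d'<d. \<forall>k. t (tmp d' k) = s (tmp d' k))"

text \<open>Evaluating an expression must not disturb the entries of a comprehension that are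
  already buffered; only assignments write to \<open>buf\<close>.\<close>

definition buf_eq :: "mem \<Rightarrow> mem \<Rightarrow> bool" where
  "buf_eq s t \<longleftrightarrow> (\<forall>p q. t (buf p q) = s (buf p q))"

lemma repr_upd [simp]:
  "repr n \<sigma> \<rho> (s(tmp d k := x)) = repr n \<sigma> \<rho> s"
  "repr n \<sigma> \<rho> (s(buf p q := x)) = repr n \<sigma> \<rho> s"
  "repr n \<sigma> \<rho> (s(1 + int k := x)) = repr n \<sigma> \<rho> s"
  unfolding repr_def by auto

lemma repr_var: "repr n \<sigma> \<rho> s \<Longrightarrow> repr n \<sigma> (\<rho>(v := i)) (s(var v := int i))"
  unfolding repr_def by auto

lemma temps_eq_upd [simp]:
  "d \<le> d' \<Longrightarrow> temps_eq d s (t(tmp d' k := x)) = temps_eq d s t"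
  "temps_eq d s (t(var v := x)) = temps_eq d s t"
  "temps_eq d s (t(arr a p q := x)) = temps_eq d s t"
  "temps_eq d s (t(buf p q := x)) = temps_eq d s t"
  "temps_eq d s (t(1 + int k := x)) = temps_eq d s t"
  unfolding temps_eq_def by auto

lemma buf_eq_upd [simp]:
  "buf_eq s (t(tmp d' k := x)) = buf_eq s t"
  "buf_eq s (t(var v := x)) = buf_eq s t"
  "buf_eq s (t(arr a p q := x)) = buf_eq s t"
  "buf_eq s (t(1 + int k := x)) = buf_eq s t"
  unfolding buf_eq_def by auto

lemma temps_eq_refl [simp]: "temps_eq d s s" unfolding temps_eq_def by auto
lemma buf_eq_refl [simp]: "buf_eq s s" unfolding buf_eq_def by auto

lemma temps_eq_trans: "temps_eq d s t \<Longrightarrow> temps_eq d' t u \<Longrightarrow> d \<le> d' \<Longrightarrow> temps_eq d s u"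
  unfolding temps_eq_def by auto

lemma buf_eq_trans: "buf_eq s t \<Longrightarrow> buf_eq t u \<Longrightarrow> buf_eq s u"
  unfolding buf_eq_def by auto

lemma temps_eqD: "temps_eq d s t \<Longrightarrow> d' < d \<Longrightarrow> t (tmp d' k) = s (tmp d' k)"
  unfolding temps_eq_def by auto

text \<open>Total correctness with a time bound. By determinism one halting execution settles the
  behaviour, so the triple can be existential.\<close>

definition wpt :: "nat \<Rightarrow> (nat set \<Rightarrow> int) \<Rightarrow> com \<Rightarrow> mem \<Rightarrow> nat \<Rightarrow> (mem \<Rightarrow> bool) \<Rightarrow> bool" where
  "wpt n F c s B Q \<longleftrightarrow> (\<exists>T t. exec n F c s T t \<and> T \<le> B \<and> Q t)"

lemma wpt_mono: "wpt n F c s B Q \<Longrightarrow> B \<le> B' \<Longrightarrow> (\<And>t. Q t \<Longrightarrow> Q' t) \<Longrightarrow> wpt n F c s B' Q'"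
  unfolding wpt_def by (meson le_trans)

lemma wpt_Skip: "Q s \<Longrightarrow> wpt n F Skip s 1 Q"
  unfolding wpt_def by (blast intro: exec.Skip)

lemma wpt_Store: "Q (s(aval a s := aval b s)) \<Longrightarrow> wpt n F (Store a b) s (1 + acost a + acost b) Q"
  unfolding wpt_def by (blast intro: exec.Store)

lemma wpt_Query:
  "Q (s(aval a s := F (stored_set n s (aval b s)))) \<Longrightarrow> wpt n F (Query a b) s (1 + acost a + acost b) Q"
  unfolding wpt_def by (blast intro: exec.Query)

lemma wpt_Seq:
  assumes "wpt n F c s B1 Q" "\<And>t. Q t \<Longrightarrow> wpt n F d t B2 Q'"
  shows "wpt n F (Seq c d) s (B1 + B2) Q'"
  using assms unfolding wpt_def by (meson exec.Seq add_mono)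

text \<open>The bounds of the branches are added instead of maximised, which stays within the
  operations that are shown to preserve \<open>poly_bounded\<close>.\<close>

lemma wpt_If:
  assumes "bval b s \<Longrightarrow> wpt n F c s B1 Q" "\<not> bval b s \<Longrightarrow> wpt n F d s B2 Q"
  shows "wpt n F (If b c d) s (bcost b + (B1 + B2)) Q"
proof (cases "bval b s")
  case True
  then obtain T t where "exec n F c s T t" "T \<le> B1" "Q t" using assms unfolding wpt_def by blast
  then show ?thesis unfolding wpt_def using exec.IfTrue[OF True] by (meson add_left_mono trans_le_add1)
next
  case False
  then obtain T t where "exec n F d s T t" "T \<le> B2" "Q t" using assms unfolding wpt_def by blast
  then show ?thesis unfolding wpt_def using exec.IfFalse[OF False] by (meson add_left_mono trans_le_add2)
qed

text \<open>The invariant is indexed by the number of rounds done, and the induction is on the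
  number left. The extra \<open>1\<close> pays for the last, failing test.\<close>

lemma wpt_While:
  assumes "\<And>i s. i < m \<Longrightarrow> I i s \<Longrightarrow> bval b s \<and> wpt n F c s B (I (Suc i))"
    and "\<And>s. I m s \<Longrightarrow> \<not> bval b s" and "I 0 s"
  shows "wpt n F (While b c) s ((m + 1) * (bcost b + B)) (I m)"
proof -
  have "wpt n F (While b c) s ((k + 1) * (bcost b + B)) (I m)" if "I (m - k) s" "k \<le> m" for k s
    using that
  proof (induction k arbitrary: s)
    case 0
    then have "exec n F (While b c) s (bcost b) s" "I m s"
      using assms(2)[of s] exec.WhileFalse[of b s n F c] by auto
    then show ?case unfolding wpt_def by (intro exI[of _ "bcost b"] exI[of _ s]) simp
  next
    case (Suc k)
    then have "m - Suc k < m" "Suc (m - Suc k) = m - k" by auto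
    then have "bval b s" and "wpt n F c s B (I (m - k))"
      using assms(1)[of "m - Suc k" s] Suc.prems by auto
    then obtain T t where 1: "exec n F c s T t" "T \<le> B" "I (m - k) t" unfolding wpt_def by blast
    then obtain T' t' where 2: "exec n F (While b c) t T' t'" "T' \<le> (k + 1) * (bcost b + B)" "I m t'"
      using Suc unfolding wpt_def by force
    have "exec n F (While b c) s (bcost b + T + T') t'"
      by (rule exec.WhileTrue) fact+
    moreover have "bcost b + T + T' \<le> (Suc k + 1) * (bcost b + B)" using 1 2 by simp
    ultimately show ?case using 2 unfolding wpt_def by blast
  qed
  from this[of m s] show ?thesis using assms(3) by simp
qed

definition poly_bounded :: "(nat \<Rightarrow> nat) \<Rightarrow> bool" where
  "poly_bounded f \<longleftrightarrow> (\<exists>p. \<forall>n. f n \<le> poly p n)"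

lemma poly_bounded_const [intro, simp]: "poly_bounded (\<lambda>n. c)"
  unfolding poly_bounded_def by (rule exI[of _ "[:c:]"]) simp

lemma poly_bounded_id [intro, simp]: "poly_bounded (\<lambda>n. n)"
  unfolding poly_bounded_def by (rule exI[of _ "[:0, 1:]"]) simp

lemma poly_bounded_add [intro]: "poly_bounded f \<Longrightarrow> poly_bounded g \<Longrightarrow> poly_bounded (\<lambda>n. f n + g n)"
  unfolding poly_bounded_def by (metis poly_add add_mono)

lemma poly_bounded_mult [intro]: "poly_bounded f \<Longrightarrow> poly_bounded g \<Longrightarrow> poly_bounded (\<lambda>n. f n * g n)"
  unfolding poly_bounded_def by (metis poly_mult mult_mono zero_le)

lemma poly_bounded_psize [intro, simp]: "poly_bounded (psize m)"
proof -
  have "psize m = (\<lambda>n. poly ([:2, 1:] ^ m) n)" by (rule ext) (simp add: psize_def poly_power)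
  then show ?thesis unfolding poly_bounded_def by (metis order_refl)
qed

text \<open>The counter is a scratch cell that is copied into \<open>v\<close> at the start of each
  round. The old value of \<open>v\<close> is put back at the end, because an enclosing construct
  may bind the same variable.\<close>

definition forc :: "nat \<Rightarrow> nat \<Rightarrow> aexp \<Rightarrow> com \<Rightarrow> com" where
  "forc d v bx body =
     Seq (Store (Const (tmp d 4)) (Cell (Const (var v))))
    (Seq (Store (Const (tmp d 3)) (Const 0))
    (Seq (While (Less (Cell (Const (tmp d 3))) bx)
           (Seq (Store (Const (var v)) (Cell (Const (tmp d 3))))
           (Seq body
                (Store (Const (tmp d 3)) (Add (Cell (Const (tmp d 3))) (Const 1))))))
         (Store (Const (var v)) (Cell (Const (tmp d 4))))))"

lemma temps_eq_Suc: "temps_eq (Suc d) s t \<Longrightarrow> temps_eq d s t"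
  unfolding temps_eq_def by auto

text \<open>The store \<open>\<sigma> i\<close> may change from round to round, as assignments need.
  \<open>J\<close> must ignore the cells that the loop itself manages, hence the stability
  hypotheses.\<close>

lemma wpt_forc:
  assumes body: "\<And>i s. i < m \<Longrightarrow> repr n (\<sigma> i) (\<rho>(v := i)) s \<Longrightarrow> s (tmp d 3) = int i \<Longrightarrow>
      temps_eq d s0 s \<Longrightarrow> J i s \<Longrightarrow>
      wpt n F body s B (\<lambda>t. repr n (\<sigma> (Suc i)) (\<rho>(v := i)) t \<and> t (tmp d 3) = int i \<and>
        t (tmp d 4) = s (tmp d 4) \<and> temps_eq d s0 t \<and> J (Suc i) t)"
    and bound: "\<And>s. s 0 = int n \<Longrightarrow> aval bx s = int m"
    and stable: "\<And>i s x. J i (s(var v := x)) = J i s" "\<And>i s x. J i (s(tmp d 3 := x)) = J i s"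
      "\<And>i s x. J i (s(tmp d 4 := x)) = J i s"
    and start: "repr n (\<sigma> 0) \<rho> s0" "J 0 s0"
  shows "wpt n F (forc d v bx body) s0 (11 + (m + 1) * (acost bx + B + 13))
      (\<lambda>t. repr n (\<sigma> m) \<rho> t \<and> temps_eq d s0 t \<and> J m t)"
proof -
  define W where "W = While (Less (Cell (Const (tmp d 3))) bx)
           (Seq (Store (Const (var v)) (Cell (Const (tmp d 3))))
           (Seq body (Store (Const (tmp d 3)) (Add (Cell (Const (tmp d 3))) (Const 1)))))"
  \<comment> \<open>Between rounds \<open>v\<close> still holds a value of no interest, hence the
    existential.\<close>
  define I where "I i s \<longleftrightarrow> (\<exists>x. repr n (\<sigma> i) (\<rho>(v := x)) s) \<and> s (tmp d 3) = int i \<and>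
     s (tmp d 4) = int (\<rho> v) \<and> temps_eq d s0 s \<and> J i s" for i s
  have step: "bval (Less (Cell (Const (tmp d 3))) bx) s \<and>
      wpt n F (Seq (Store (Const (var v)) (Cell (Const (tmp d 3))))
           (Seq body (Store (Const (tmp d 3)) (Add (Cell (Const (tmp d 3))) (Const 1))))) s
           (4 + (B + 6)) (I (Suc i))" if im: "i < m" and Ii: "I i s" for i s
  proof -
    obtain x where x: "repr n (\<sigma> i) (\<rho>(v := x)) s" and s: "s (tmp d 3) = int i"
      "s (tmp d 4) = int (\<rho> v)" "temps_eq d s0 s" "J i s"
      using Ii unfolding I_def by auto
    have "aval bx s = int m" using x bound unfolding repr_def by auto
    let ?s = "s(var v := int i)"
    have r: "repr n (\<sigma> i) (\<rho>(v := i)) ?s" using repr_var[OF x, of v i] by simp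
    have w: "wpt n F body ?s B (\<lambda>t. repr n (\<sigma> (Suc i)) (\<rho>(v := i)) t \<and> t (tmp d 3) = int i \<and>
        t (tmp d 4) = ?s (tmp d 4) \<and> temps_eq d s0 t \<and> J (Suc i) t)"
      by (rule body) (use im r s stable in auto)
    have "wpt n F (Store (Const (var v)) (Cell (Const (tmp d 3)))) s 4 (\<lambda>t. t = ?s)"
      by (rule wpt_mono[OF wpt_Store]) (use s in auto)
    moreover have "wpt n F (Seq body (Store (Const (tmp d 3)) (Add (Cell (Const (tmp d 3))) (Const 1)))) ?s
      (B + 6) (I (Suc i))"
    proof (rule wpt_Seq[OF w])
      fix t assume t: "repr n (\<sigma> (Suc i)) (\<rho>(v := i)) t \<and> t (tmp d 3) = int i \<and>
        t (tmp d 4) = ?s (tmp d 4) \<and> temps_eq d s0 t \<and> J (Suc i) t"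
      show "wpt n F (Store (Const (tmp d 3)) (Add (Cell (Const (tmp d 3))) (Const 1))) t 6 (I (Suc i))"
        by (rule wpt_mono[OF wpt_Store[where Q = "I (Suc i)"]]) (use t s stable in \<open>auto simp: I_def\<close>)
    qed
    ultimately have "wpt n F (Seq (Store (Const (var v)) (Cell (Const (tmp d 3))))
           (Seq body (Store (Const (tmp d 3)) (Add (Cell (Const (tmp d 3))) (Const 1))))) s
           (4 + (B + 6)) (I (Suc i))"
      using wpt_Seq[where Q = "\<lambda>t. t = ?s"] by blast
    then show ?thesis using s \<open>aval bx s = int m\<close> im by simp
  qed
  let ?s1 = "s0(tmp d 4 := int (\<rho> v))" let ?s2 = "?s1(tmp d 3 := 0)"
  have I0: "I 0 ?s2" unfolding I_def using start stable
    by (auto intro!: exI[of _ "\<rho> v"])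
  have W: "wpt n F W ?s2 ((m + 1) * (bcost (Less (Cell (Const (tmp d 3))) bx) + (4 + (B + 6)))) (I m)"
    unfolding W_def
  proof (rule wpt_While[where I = I, OF step])
    fix s assume "I m s"
    then have "aval bx s = int m" "s (tmp d 3) = int m" using bound unfolding I_def repr_def by auto
    then show "\<not> bval (Less (Cell (Const (tmp d 3))) bx) s" by simp
  qed (simp_all add: I0 del: fun_upd_apply)
  have 1: "wpt n F (Store (Const (tmp d 4)) (Cell (Const (var v)))) s0 4 (\<lambda>t. t = ?s1)"
    by (rule wpt_mono[OF wpt_Store]) (use start in \<open>auto simp: repr_def\<close>)
  have 2: "wpt n F (Store (Const (tmp d 3)) (Const 0)) ?s1 3 (\<lambda>t. t = ?s2)"
    by (rule wpt_mono[OF wpt_Store]) auto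
  have 3: "wpt n F (Store (Const (var v)) (Cell (Const (tmp d 4)))) t 4
     (\<lambda>t. repr n (\<sigma> m) \<rho> t \<and> temps_eq d s0 t \<and> J m t)" if Im: "I m t" for t
  proof -
    obtain x where x: "repr n (\<sigma> m) (\<rho>(v := x)) t" and t: "t (tmp d 4) = int (\<rho> v)" "temps_eq d s0 t" "J m t"
      using Im unfolding I_def by auto
    have "repr n (\<sigma> m) \<rho> (t(var v := int (\<rho> v)))" using repr_var[OF x, of v "\<rho> v"] by simp
    then show ?thesis
      by (intro wpt_mono[OF wpt_Store[where Q = "\<lambda>u. u = t(var v := int (\<rho> v))"]])
        (use t stable in auto)
  qed
  have "wpt n F (forc d v bx body) s0
     (4 + (3 + ((m + 1) * (bcost (Less (Cell (Const (tmp d 3))) bx) + (4 + (B + 6))) + 4)))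
      (\<lambda>t. repr n (\<sigma> m) \<rho> t \<and> temps_eq d s0 t \<and> J m t)"
    unfolding forc_def W_def[symmetric]
    by (rule wpt_Seq[OF 1], hypsubst, rule wpt_Seq[OF 2], hypsubst, rule wpt_Seq[OF W 3])
  then show ?thesis by (rule wpt_mono) (simp_all add: algebra_simps)
qed

text \<open>Code and bound are fixed before \<open>n\<close>, the oracle and the store: one program
  serves all inputs.\<close>

definition computes_ex :: "nat \<Rightarrow> nat \<Rightarrow> ex \<Rightarrow> com \<Rightarrow> (nat \<Rightarrow> nat) \<Rightarrow> bool" where
  "computes_ex m d e c B \<longleftrightarrow> poly_bounded B \<and>
     (\<forall>n F \<sigma> \<rho> s. repr n \<sigma> \<rho> s \<longrightarrow>
       wpt n F c s (B n) (\<lambda>t. repr n \<sigma> \<rho> t \<and> t (tmp d 0) = ev n (psize m n) F \<sigma> \<rho> e \<and>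
         temps_eq d s t \<and> buf_eq s t))"

lemma computes_ex_bounded: "computes_ex m d e c B \<Longrightarrow> poly_bounded B"
  unfolding computes_ex_def by blast

lemmas poly_bounded_intros = poly_bounded_add poly_bounded_mult poly_bounded_const poly_bounded_id poly_bounded_psize

lemma computes_exD:
  "computes_ex m d e c B \<Longrightarrow> repr n \<sigma> \<rho> s \<Longrightarrow>
    wpt n F c s (B n) (\<lambda>t. repr n \<sigma> \<rho> t \<and> t (tmp d 0) = ev n (psize m n) F \<sigma> \<rho> e \<and>
         temps_eq d s t \<and> buf_eq s t)"
  unfolding computes_ex_def by blast

section \<open>Compilation of expressions\<close>

lemma computes_simple:
  assumes "\<And>n F \<sigma> \<rho> s. repr n \<sigma> \<rho> s \<Longrightarrow> aval a s = ev n (psize m n) F \<sigma> \<rho> e"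
  shows "computes_ex m d e (Store (Const (tmp d 0)) a) (\<lambda>_. 2 + acost a)"
  unfolding computes_ex_def
proof (intro conjI allI impI poly_bounded_const)
  fix n F \<sigma> \<rho> s assume "repr n \<sigma> \<rho> s"
  then show "wpt n F (Store (Const (tmp d 0)) a) s (2 + acost a)
     (\<lambda>t. repr n \<sigma> \<rho> t \<and> t (tmp d 0) = ev n (psize m n) F \<sigma> \<rho> e \<and> temps_eq d s t \<and> buf_eq s t)"
    by (intro wpt_mono[OF wpt_Store[where
      Q = "\<lambda>t. repr n \<sigma> \<rho> t \<and> t (tmp d 0) = ev n (psize m n) F \<sigma> \<rho> e \<and> temps_eq d s t \<and> buf_eq s t"]])
      (auto simp: assms)
qed

text \<open>The second operand is evaluated one level deeper, so the first result survives in
  \<open>tmp d 0\<close>.\<close>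

lemma computes_binary:
  assumes a: "computes_ex m d e1 c1 B1" and b: "computes_ex m (Suc d) e2 c2 B2"
    and "\<And>n F \<sigma> \<rho> s. repr n \<sigma> \<rho> s \<Longrightarrow> s (tmp d 0) = ev n (psize m n) F \<sigma> \<rho> e1 \<Longrightarrow>
      s (tmp (Suc d) 0) = ev n (psize m n) F \<sigma> \<rho> e2 \<Longrightarrow>
      wpt n F c3 s (B3 n) (\<lambda>t. repr n \<sigma> \<rho> t \<and> t (tmp d 0) = ev n (psize m n) F \<sigma> \<rho> e \<and>
         temps_eq d s t \<and> buf_eq s t)"
    and "poly_bounded B3"
  shows "computes_ex m d e (Seq c1 (Seq c2 c3)) (\<lambda>n. B1 n + (B2 n + B3 n))"
  unfolding computes_ex_def
proof (intro conjI allI impI)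
  show "poly_bounded (\<lambda>n. B1 n + (B2 n + B3 n))"
    using assms unfolding computes_ex_def by auto
  fix n F \<sigma> \<rho> s assume r: "repr n \<sigma> \<rho> s"
  show "wpt n F (Seq c1 (Seq c2 c3)) s (B1 n + (B2 n + B3 n))
     (\<lambda>t. repr n \<sigma> \<rho> t \<and> t (tmp d 0) = ev n (psize m n) F \<sigma> \<rho> e \<and> temps_eq d s t \<and> buf_eq s t)"
  proof (rule wpt_Seq[OF computes_exD[OF a r]], rule wpt_Seq[OF computes_exD[OF b]], blast)
    fix t u
    assume t: "repr n \<sigma> \<rho> t \<and> t (tmp d 0) = ev n (psize m n) F \<sigma> \<rho> e1 \<and> temps_eq d s t \<and> buf_eq s t"
      and u: "repr n \<sigma> \<rho> u \<and> u (tmp (Suc d) 0) = ev n (psize m n) F \<sigma> \<rho> e2 \<and>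
         temps_eq (Suc d) t u \<and> buf_eq t u"
    then have "u (tmp d 0) = ev n (psize m n) F \<sigma> \<rho> e1" by (simp add: temps_eqD[of "Suc d" t u d])
    then have "wpt n F c3 u (B3 n) (\<lambda>t. repr n \<sigma> \<rho> t \<and> t (tmp d 0) = ev n (psize m n) F \<sigma> \<rho> e \<and>
         temps_eq d u t \<and> buf_eq u t)" using assms(3) u by blast
    then show "wpt n F c3 u (B3 n) (\<lambda>t. repr n \<sigma> \<rho> t \<and> t (tmp d 0) = ev n (psize m n) F \<sigma> \<rho> e \<and>
         temps_eq d s t \<and> buf_eq s t)"
      by (rule wpt_mono) (use t u temps_eq_trans buf_eq_trans temps_eq_Suc in blast)+
  qed
qed

abbreviation tx :: "nat \<Rightarrow> nat \<Rightarrow> aexp" where "tx d k \<equiv> Cell (Const (tmp d k))"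

lemma computes_arith:
  assumes "computes_ex m d e1 c1 B1" "computes_ex m (Suc d) e2 c2 B2"
    and "\<And>n F \<sigma> \<rho> s. s (tmp d 0) = ev n (psize m n) F \<sigma> \<rho> e1 \<Longrightarrow>
      s (tmp (Suc d) 0) = ev n (psize m n) F \<sigma> \<rho> e2 \<Longrightarrow> aval a s = ev n (psize m n) F \<sigma> \<rho> e"
  shows "\<exists>c B. computes_ex m d e c B"
proof -
  have "computes_ex m d e (Seq c1 (Seq c2 (Store (Const (tmp d 0)) a))) (\<lambda>n. B1 n + (B2 n + (2 + acost a)))"
  proof (rule computes_binary[OF assms(1,2)])
    fix n F \<sigma> \<rho> s assume "repr n \<sigma> \<rho> s" "s (tmp d 0) = ev n (psize m n) F \<sigma> \<rho> e1"
      "s (tmp (Suc d) 0) = ev n (psize m n) F \<sigma> \<rho> e2"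
    then show "wpt n F (Store (Const (tmp d 0)) a) s (2 + acost a)
       (\<lambda>t. repr n \<sigma> \<rho> t \<and> t (tmp d 0) = ev n (psize m n) F \<sigma> \<rho> e \<and> temps_eq d s t \<and> buf_eq s t)"
      by (intro wpt_mono[OF wpt_Store[where
        Q = "\<lambda>t. repr n \<sigma> \<rho> t \<and> t (tmp d 0) = ev n (psize m n) F \<sigma> \<rho> e \<and> temps_eq d s t \<and> buf_eq s t"]])
        (auto simp: assms(3))
  qed simp
  then show ?thesis by blast
qed

text \<open>Realises the truncation \<open>nat\<close> that \<open>ev\<close> applies to array
  indices.\<close>

definition clampc :: "nat \<Rightarrow> com" where
  "clampc d = If (Less (tx d 0) (Const 0)) (Store (Const (tmp d 0)) (Const 0)) Skip"

lemma wpt_clampc: "Q (s(tmp d 0 := int (nat (s (tmp d 0))))) \<Longrightarrow> wpt n F (clampc d) s 8 Q"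
  unfolding clampc_def
  by (rule wpt_mono[OF wpt_If[OF wpt_Store wpt_Skip]])
    (auto simp: fun_upd_idem max_def split: if_splits)

lemma computes_Arr:
  assumes "computes_ex m d e1 c1 B1" "computes_ex m (Suc d) e2 c2 B2"
  shows "\<exists>c B. computes_ex m d (Arr a e1 e2) c B"
proof -
  let ?a = "Cell (locx (4 * a) (tx d 0) (tx (Suc d) 0))"
  have "computes_ex m d (Arr a e1 e2) (Seq c1 (Seq c2 (Seq (clampc d) (Seq (clampc (Suc d))
      (Store (Const (tmp d 0)) ?a))))) (\<lambda>n. B1 n + (B2 n + (8 + (8 + (2 + acost ?a)))))"
  proof (rule computes_binary[OF assms])
    fix n F \<sigma> \<rho> s assume r: "repr n \<sigma> \<rho> s" and v: "s (tmp d 0) = ev n (psize m n) F \<sigma> \<rho> e1"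
      "s (tmp (Suc d) 0) = ev n (psize m n) F \<sigma> \<rho> e2"
    let ?Q = "\<lambda>t. repr n \<sigma> \<rho> t \<and> t (tmp d 0) = ev n (psize m n) F \<sigma> \<rho> (Arr a e1 e2) \<and>
      temps_eq d s t \<and> buf_eq s t"
    let ?s1 = "s(tmp d 0 := int (nat (s (tmp d 0))))"
    let ?s2 = "?s1(tmp (Suc d) 0 := int (nat (s (tmp (Suc d) 0))))"
    have "aval ?a ?s2 = ?s2 (loc (4 * a) (nat (s (tmp d 0))) (nat (s (tmp (Suc d) 0))))"
      by (subst aval.simps(2), subst aval_locx[where p = "nat (s (tmp d 0))" and q = "nat (s (tmp (Suc d) 0))"]) simp_all
    also have "\<dots> = \<sigma> a (nat (s (tmp d 0))) (nat (s (tmp (Suc d) 0)))"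
      using r unfolding repr_def arr_def[symmetric] by simp
    finally have a: "aval ?a ?s2 = ev n (psize m n) F \<sigma> \<rho> (Arr a e1 e2)" using v by simp
    have 3: "wpt n F (Store (Const (tmp d 0)) ?a) ?s2 (2 + acost ?a) ?Q"
    proof (rule wpt_mono[OF wpt_Store[where Q = ?Q]])
      show "?Q (?s2(aval (Const (tmp d 0)) ?s2 := aval ?a ?s2))"
        unfolding a using r by (simp del: ev.simps)
    qed auto
    have 1: "wpt n F (clampc d) s 8 (\<lambda>t. t = ?s1)" by (rule wpt_clampc) simp
    have 2: "wpt n F (clampc (Suc d)) ?s1 8 (\<lambda>t. t = ?s2)" by (rule wpt_clampc) simp
    show "wpt n F (Seq (clampc d) (Seq (clampc (Suc d)) (Store (Const (tmp d 0)) ?a))) s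
      (8 + (8 + (2 + acost ?a))) ?Q"
      by (rule wpt_Seq[OF 1], hypsubst, rule wpt_Seq[OF 2], hypsubst, rule 3)
  qed simp
  then show ?thesis by blast
qed

lemma computes_Ite:
  assumes "computes_ex m d e1 c1 B1" "computes_ex m (Suc d) e2 c2 B2"
    "computes_ex m d e3 c3 B3" "computes_ex m d e4 c4 B4"
  shows "\<exists>c B. computes_ex m d (Ite e1 e2 e3 e4) c B"
proof -
  let ?b = "Less (tx d 0) (tx (Suc d) 0)"
  have "computes_ex m d (Ite e1 e2 e3 e4) (Seq c1 (Seq c2 (If ?b c3 c4)))
     (\<lambda>n. B1 n + (B2 n + (bcost ?b + (B3 n + B4 n))))"
  proof (rule computes_binary[OF assms(1,2)])
    fix n F \<sigma> \<rho> s assume "repr n \<sigma> \<rho> s" "s (tmp d 0) = ev n (psize m n) F \<sigma> \<rho> e1"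
      "s (tmp (Suc d) 0) = ev n (psize m n) F \<sigma> \<rho> e2"
    then show "wpt n F (If ?b c3 c4) s (bcost ?b + (B3 n + B4 n))
       (\<lambda>t. repr n \<sigma> \<rho> t \<and> t (tmp d 0) = ev n (psize m n) F \<sigma> \<rho> (Ite e1 e2 e3 e4) \<and>
          temps_eq d s t \<and> buf_eq s t)"
      using computes_exD[OF assms(3), of n \<sigma> \<rho> s F] computes_exD[OF assms(4), of n \<sigma> \<rho> s F]
      by (intro wpt_If) auto
  qed (use assms(3,4) in \<open>auto simp: computes_ex_def simp del: bcost.simps\<close>)
  then show ?thesis by blast
qed

text \<open>Cells 3 and 4, which \<open>forc\<close> changes itself, are blanked out, so every
  invariant phrased through \<open>view\<close> is stable under the bookkeeping of the loop.\<close>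

definition view :: "nat \<Rightarrow> mem \<Rightarrow> nat \<Rightarrow> int" where
  "view d s = (\<lambda>k. if k = 4 \<or> k = 3 then 0 else s (tmp d k))"

lemma view_upd [simp]:
  "view d (s(var v := x)) = view d s" "view d (s(tmp d 4 := x)) = view d s"
  "view d (s(tmp d 3 := x)) = view d s"
  "k \<noteq> 4 \<Longrightarrow> k \<noteq> 3 \<Longrightarrow> view d (s(tmp d k := x)) = (view d s)(k := x)"
  unfolding view_def by auto

lemma view_frame: "temps_eq (Suc d) s t \<Longrightarrow> view d t = view d s"
  unfolding view_def by (auto simp: temps_eqD[of "Suc d" s t d])

text \<open>The common shape of \<open>Summ\<close>, \<open>Mu\<close> and \<open>Orc\<close>: a
  round evaluates the body one level deeper and then changes one scratch cell of depth
  \<open>d\<close> other than the loop's own.\<close>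

lemma wpt_acc_loop:
  assumes e: "computes_ex m (Suc d) e c B"
    and bound: "\<And>s. s 0 = int n \<Longrightarrow> aval bx s = int k"
    and step: "\<And>i s. i < k \<Longrightarrow> A i (view d s) \<Longrightarrow> s (tmp d 3) = int i \<Longrightarrow>
       s (tmp (Suc d) 0) = ev n (psize m n) F \<sigma> (\<rho>(v := i)) e \<Longrightarrow>
       wpt n F upd s U (\<lambda>t. \<exists>j x. t = s(tmp d j := x) \<and> j \<noteq> 4 \<and> j \<noteq> 3 \<and> A (Suc i) ((view d s)(j := x)))"
    and r: "repr n \<sigma> \<rho> s" and A0: "A 0 (view d s)"
  shows "wpt n F (forc d v bx (Seq c upd)) s (11 + (k + 1) * (acost bx + (B n + U) + 13))
      (\<lambda>t. repr n \<sigma> \<rho> t \<and> temps_eq d s t \<and> buf_eq s t \<and> A k (view d t))"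
proof -
  have "wpt n F (forc d v bx (Seq c upd)) s (11 + (k + 1) * (acost bx + (B n + U) + 13))
      (\<lambda>t. repr n \<sigma> \<rho> t \<and> temps_eq d s t \<and> (buf_eq s t \<and> A k (view d t)))"
  proof (rule wpt_forc[where \<sigma> = "\<lambda>_. \<sigma>" and J = "\<lambda>i t. buf_eq s t \<and> A i (view d t)"])
    fix i t assume i: "i < k" and t: "repr n \<sigma> (\<rho>(v := i)) t" "t (tmp d 3) = int i" "temps_eq d s t"
      "buf_eq s t \<and> A i (view d t)"
    show "wpt n F (Seq c upd) t (B n + U) (\<lambda>u. repr n \<sigma> (\<rho>(v := i)) u \<and> u (tmp d 3) = int i \<and>
        u (tmp d 4) = t (tmp d 4) \<and> temps_eq d s u \<and> buf_eq s u \<and> A (Suc i) (view d u))"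
    proof (rule wpt_Seq[OF computes_exD[OF e t(1)]])
      fix u assume u: "repr n \<sigma> (\<rho>(v := i)) u \<and> u (tmp (Suc d) 0) = ev n (psize m n) F \<sigma> (\<rho>(v := i)) e \<and>
         temps_eq (Suc d) t u \<and> buf_eq t u"
      then have f: "view d u = view d t" "u (tmp d 3) = int i" "u (tmp d 4) = t (tmp d 4)"
        using view_frame[of d t u] t by (auto simp: temps_eqD[of "Suc d" t u d])
      have "temps_eq d s u" "buf_eq s u"
        using u t temps_eq_trans[of d s t "Suc d" u] buf_eq_trans by auto
      then show "wpt n F upd u U (\<lambda>u. repr n \<sigma> (\<rho>(v := i)) u \<and> u (tmp d 3) = int i \<and>
          u (tmp d 4) = t (tmp d 4) \<and> temps_eq d s u \<and> buf_eq s u \<and> A (Suc i) (view d u))"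
        by (intro wpt_mono[OF step[OF i, of u]]) (use u f t in auto)
    qed
  qed (use bound r A0 in auto)
  then show ?thesis by simp
qed

lemma computes_Summ:
  assumes "computes_ex m (Suc d) e c B"
  shows "\<exists>c B. computes_ex m d (Summ v e) c B"
proof -
  let ?C = "Seq (Store (Const (tmp d 2)) (Const 0))
    (Seq (forc d v (sizex m) (Seq c (Store (Const (tmp d 2)) (Add (tx d 2) (tx (Suc d) 0)))))
         (Store (Const (tmp d 0)) (tx d 2)))"
  let ?B = "\<lambda>n. 3 + ((11 + (psize m n + 1) * (acost (sizex m) + (B n + 7) + 13)) + 4)"
  have "computes_ex m d (Summ v e) ?C ?B"
    unfolding computes_ex_def
  proof (intro conjI allI impI)
    show "poly_bounded ?B"
      using computes_ex_bounded[OF assms] by (intro poly_bounded_intros)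
    fix n F \<sigma> \<rho> s assume r: "repr n \<sigma> \<rho> s"
    let ?N = "psize m n"
    let ?f = "\<lambda>i. ev n ?N F \<sigma> (\<rho>(v := i)) e"
    have 1: "wpt n F (Store (Const (tmp d 2)) (Const 0)) s 3 (\<lambda>t. t = s(tmp d 2 := 0))"
      by (rule wpt_mono[OF wpt_Store]) auto
    have 2: "wpt n F (forc d v (sizex m) (Seq c (Store (Const (tmp d 2)) (Add (tx d 2) (tx (Suc d) 0)))))
      (s(tmp d 2 := 0)) (11 + (?N + 1) * (acost (sizex m) + (B n + 7) + 13))
      (\<lambda>t. repr n \<sigma> \<rho> t \<and> temps_eq d (s(tmp d 2 := 0)) t \<and> buf_eq (s(tmp d 2 := 0)) t \<and>
        view d t 2 = (\<Sum>i<?N. ?f i))"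
    proof (rule wpt_acc_loop[OF assms, where A = "\<lambda>i w. w 2 = (\<Sum>j<i. ?f j)"])
      fix i s assume "view d s 2 = (\<Sum>j<i. ?f j)" "s (tmp (Suc d) 0) = ?f i"
      then show "wpt n F (Store (Const (tmp d 2)) (Add (tx d 2) (tx (Suc d) 0))) s 7
        (\<lambda>t. \<exists>j x. t = s(tmp d j := x) \<and> j \<noteq> 4 \<and> j \<noteq> 3 \<and> ((view d s)(j := x)) 2 = (\<Sum>j<Suc i. ?f j))"
        by (intro wpt_mono[OF wpt_Store[where Q = "\<lambda>t. t = s(tmp d 2 := (\<Sum>j<Suc i. ?f j))"]])
          (auto intro!: exI[where x = "2::nat"] exI[where x = "\<Sum>j<Suc i. ?f j"] simp: view_def)
    qed (use r in \<open>auto simp: aval_sizex view_def\<close>)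
    show "wpt n F ?C s (?B n) (\<lambda>t. repr n \<sigma> \<rho> t \<and> t (tmp d 0) = ev n ?N F \<sigma> \<rho> (Summ v e) \<and>
        temps_eq d s t \<and> buf_eq s t)"
    proof (rule wpt_Seq[OF 1], hypsubst, rule wpt_Seq[OF 2])
      fix t assume t: "repr n \<sigma> \<rho> t \<and> temps_eq d (s(tmp d 2 := 0)) t \<and> buf_eq (s(tmp d 2 := 0)) t \<and>
        view d t 2 = (\<Sum>i<?N. ?f i)"
      moreover have "temps_eq d s t" "buf_eq s t"
        using t temps_eq_trans[of d s "s(tmp d 2 := 0)" d t] buf_eq_trans[of s "s(tmp d 2 := 0)" t] by auto
      ultimately show "wpt n F (Store (Const (tmp d 0)) (tx d 2)) t 4 (\<lambda>t. repr n \<sigma> \<rho> t \<and>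
         t (tmp d 0) = ev n ?N F \<sigma> \<rho> (Summ v e) \<and> temps_eq d s t \<and> buf_eq s t)"
        by (intro wpt_mono[OF wpt_Store[where Q = "\<lambda>u. u = t(tmp d 0 := (\<Sum>i<?N. ?f i))"]])
          (auto simp: view_def)
    qed
  qed
  then show ?thesis by blast
qed

text \<open>Being nonzero takes two tests, as only \<open><\<close> is available. The accumulator
  starts at \<open>N\<close>; after a hit it is below every later counter, so only the first hit is
  recorded.\<close>

definition muc :: "nat \<Rightarrow> com" where
  "muc d = If (Less (tx d 3) (tx d 2)) (If (Less (tx (Suc d) 0) (Const 0)) (Store (Const (tmp d 2)) (tx d 3))
     (If (Less (Const 0) (tx (Suc d) 0)) (Store (Const (tmp d 2)) (tx d 3)) Skip)) Skip"

lemma wpt_muc: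
  "wpt n F (muc d) s 40 (\<lambda>t. t = s(tmp d 2 :=
     if s (tmp d 3) < s (tmp d 2) \<and> s (tmp (Suc d) 0) \<noteq> 0 then s (tmp d 3) else s (tmp d 2)))"
proof -
  let ?Q = "\<lambda>t. t = s(tmp d 2 :=
     if s (tmp d 3) < s (tmp d 2) \<and> s (tmp (Suc d) 0) \<noteq> 0 then s (tmp d 3) else s (tmp d 2))"
  let ?S = "Store (Const (tmp d 2)) (tx d 3)" and ?b = "Less (Const 0) (tx (Suc d) 0)"
    and ?b' = "Less (tx (Suc d) 0) (Const 0)"
  have S: "wpt n F ?S s 4 ?Q" if "s (tmp d 3) < s (tmp d 2)" "s (tmp (Suc d) 0) \<noteq> 0"
    by (rule wpt_mono[OF wpt_Store]) (use that in auto)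
  have K: "wpt n F Skip s 1 ?Q" if "s (tmp d 3) < s (tmp d 2) \<longrightarrow> s (tmp (Suc d) 0) = 0"
    by (rule wpt_mono[OF wpt_Skip]) (use that in auto)
  have 1: "wpt n F (If ?b ?S Skip) s (bcost ?b + (4 + 1)) ?Q"
    if "s (tmp d 3) < s (tmp d 2)" "\<not> s (tmp (Suc d) 0) < 0"
    by (rule wpt_If) (use that S K in auto)
  have 2: "wpt n F (If ?b' ?S (If ?b ?S Skip)) s (bcost ?b' + (4 + (bcost ?b + (4 + 1)))) ?Q"
    if "s (tmp d 3) < s (tmp d 2)"
    by (rule wpt_If) (use that S 1 in \<open>auto simp del: bcost.simps\<close>)
  have "wpt n F (muc d) s (bcost (Less (tx d 3) (tx d 2)) + ((bcost ?b' + (4 + (bcost ?b + (4 + 1)))) + 1)) ?Q"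
    unfolding muc_def by (rule wpt_If) (use 2 K in \<open>auto simp del: bcost.simps\<close>)
  then show ?thesis by (rule wpt_mono) auto
qed

text \<open>The recurrence obeyed by the accumulator of \<open>muc\<close>, which stays
  \<open>N\<close> until the first hit.\<close>

lemma first_Suc:
  assumes "i < N"
  shows "(if \<exists>j<Suc i. P j then first (Suc i) P else N) =
    (if i < (if \<exists>j<i. P j then first i P else N) \<and> P i then i else if \<exists>j<i. P j then first i P else N)"
proof (cases "\<exists>j<i. P j")
  case True
  then have l: "first i P < i" by (simp add: first_less_iff)
  have "first (Suc i) P = first i P"
  proof (rule first_eqI)
    show "P (first i P)" using first_holds[OF l] .
    show "\<not> P j" if "j < first i P" for j using first_least[of j i P] that l by fastforce
  qed (use l in simp)
  then show ?thesis using True l by (auto simp: less_Suc_eq)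
next
  case False
  then have "P i \<Longrightarrow> first (Suc i) P = i"
    by (intro first_eqI) auto
  then show ?thesis using False assms by (auto simp: less_Suc_eq)
qed

lemma computes_Mu:
  assumes "computes_ex m (Suc d) e c B"
  shows "\<exists>c B. computes_ex m d (Mu v e) c B"
proof -
  let ?upd = "muc d"
  let ?C = "Seq (Store (Const (tmp d 2)) (sizex m))
    (Seq (forc d v (sizex m) (Seq c ?upd)) (Store (Const (tmp d 0)) (tx d 2)))"
  let ?B = "\<lambda>n. (2 + acost (sizex m)) + ((11 + (psize m n + 1) * (acost (sizex m) + (B n + 40) + 13)) + 4)"
  have "computes_ex m d (Mu v e) ?C ?B"
    unfolding computes_ex_def
  proof (intro conjI allI impI)
    show "poly_bounded ?B"
      using computes_ex_bounded[OF assms] by (intro poly_bounded_intros)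
    fix n F \<sigma> \<rho> s assume r: "repr n \<sigma> \<rho> s"
    let ?N = "psize m n"
    let ?f = "\<lambda>i. ev n ?N F \<sigma> (\<rho>(v := i)) e"
    let ?a = "\<lambda>i. int (if \<exists>j<i. ?f j \<noteq> 0 then first i (\<lambda>j. ?f j \<noteq> 0) else ?N)"
    have 1: "wpt n F (Store (Const (tmp d 2)) (sizex m)) s (2 + acost (sizex m)) (\<lambda>t. t = s(tmp d 2 := int ?N))"
      by (rule wpt_mono[OF wpt_Store]) (use r in \<open>auto simp: repr_def aval_sizex\<close>)
    have a_Suc: "?a (Suc i) = (if int i < ?a i \<and> ?f i \<noteq> 0 then int i else ?a i)" if "i < ?N" for i
      using first_Suc[OF that, of "\<lambda>j. ?f j \<noteq> 0"] by simp
    have a_N: "?a ?N = ev n ?N F \<sigma> \<rho> (Mu v e)"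
      using first_less_iff[of ?N "\<lambda>i. ?f i \<noteq> 0"] first_le[of ?N "\<lambda>i. ?f i \<noteq> 0"] by auto
    have 2: "wpt n F (forc d v (sizex m) (Seq c ?upd))
      (s(tmp d 2 := int ?N)) (11 + (?N + 1) * (acost (sizex m) + (B n + 40) + 13))
      (\<lambda>t. repr n \<sigma> \<rho> t \<and> temps_eq d (s(tmp d 2 := int ?N)) t \<and> buf_eq (s(tmp d 2 := int ?N)) t \<and>
        view d t 2 = ?a ?N)"
    proof (rule wpt_acc_loop[OF assms, where A = "\<lambda>i w. w 2 = ?a i"])
      fix i s assume i: "i < ?N" "view d s 2 = ?a i" "s (tmp (Suc d) 0) = ?f i" "s (tmp d 3) = int i"
      have 2: "s (tmp d 2) = ?a i" using i(2) by (simp add: view_def)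
      have "(if s (tmp d 3) < s (tmp d 2) \<and> s (tmp (Suc d) 0) \<noteq> 0 then s (tmp d 3) else s (tmp d 2)) = ?a (Suc i)"
        unfolding a_Suc[OF i(1)] unfolding 2 i(3,4) by (rule refl)
      then have "wpt n F ?upd s 40 (\<lambda>t. t = s(tmp d 2 := ?a (Suc i)))"
        using wpt_muc[of n F d s] by (rule subst)
      then show "wpt n F ?upd s 40
        (\<lambda>t. \<exists>j x. t = s(tmp d j := x) \<and> j \<noteq> 4 \<and> j \<noteq> 3 \<and> ((view d s)(j := x)) 2 = ?a (Suc i))"
        by (rule wpt_mono) (rule order_refl, intro exI[of _ 2] exI[of _ "?a (Suc i)"], simp del: of_nat_Suc)
    qed (use r in \<open>auto simp: aval_sizex view_def\<close>)
    show "wpt n F ?C s (?B n) (\<lambda>t. repr n \<sigma> \<rho> t \<and> t (tmp d 0) = ev n ?N F \<sigma> \<rho> (Mu v e) \<and>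
        temps_eq d s t \<and> buf_eq s t)"
    proof (rule wpt_Seq[OF 1], hypsubst, rule wpt_Seq[OF 2])
      fix t assume t: "repr n \<sigma> \<rho> t \<and> temps_eq d (s(tmp d 2 := int ?N)) t \<and> buf_eq (s(tmp d 2 := int ?N)) t \<and>
        view d t 2 = ?a ?N"
      moreover have "temps_eq d s t" "buf_eq s t"
        using t temps_eq_trans[of d s "s(tmp d 2 := int ?N)" d t] buf_eq_trans[of s "s(tmp d 2 := int ?N)" t] by auto
      ultimately show "wpt n F (Store (Const (tmp d 0)) (tx d 2)) t 4 (\<lambda>t. repr n \<sigma> \<rho> t \<and>
         t (tmp d 0) = ev n ?N F \<sigma> \<rho> (Mu v e) \<and> temps_eq d s t \<and> buf_eq s t)"
        unfolding a_N
        by (intro wpt_mono[OF wpt_Store[where Q = "\<lambda>u. u = t(tmp d 0 := ev n ?N F \<sigma> \<rho> (Mu v e))"]])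
          (auto simp: view_def simp del: ev.simps)
    qed
  qed
  then show ?thesis by blast
qed

text \<open>The address expression may depend on the counter \<open>tmp d 3\<close>. The same code
  prepares oracle calls and delivers the output, both of which use cells 1 to
  \<open>n\<close>.\<close>

definition copy_row :: "nat \<Rightarrow> aexp \<Rightarrow> com" where
  "copy_row d a = forc d 0 (Cell (Const 0)) (Store (Add (Const 1) (tx d 3)) (Cell a))"

lemma wpt_copy_row:
  assumes a: "\<And>i s'. i < n \<Longrightarrow> repr n \<sigma> (\<rho>(0 := i)) s' \<Longrightarrow> temps_eq d s s' \<Longrightarrow> (\<forall>k. k \<noteq> 4 \<longrightarrow> k \<noteq> 3 \<longrightarrow> s' (tmp d k) = s (tmp d k)) \<Longrightarrow>
      s' (tmp d 3) = int i \<Longrightarrow> s' (aval a s') = f i"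
    and r: "repr n \<sigma> \<rho> s"
  shows "wpt n F (copy_row d a) s (11 + (n + 1) * (21 + acost a))
     (\<lambda>t. repr n \<sigma> \<rho> t \<and> temps_eq d s t \<and> buf_eq s t \<and> stored_set n t 1 = {i. i < n \<and> f i \<noteq> 0})"
proof -
  have "wpt n F (copy_row d a) s (11 + (n + 1) * (acost (Cell (Const 0)) + (acost a + 6) + 13))
     (\<lambda>t. repr n \<sigma> \<rho> t \<and> temps_eq d s t \<and> (buf_eq s t \<and> (\<forall>k. k \<noteq> 4 \<longrightarrow> k \<noteq> 3 \<longrightarrow> t (tmp d k) = s (tmp d k)) \<and>
       (\<forall>j<n. t (1 + int j) = f j)))"
    unfolding copy_row_def
  proof (rule wpt_forc[where \<sigma> = "\<lambda>_. \<sigma>" and J = "\<lambda>i t. buf_eq s t \<and>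
      (\<forall>k. k \<noteq> 4 \<longrightarrow> k \<noteq> 3 \<longrightarrow> t (tmp d k) = s (tmp d k)) \<and> (\<forall>j<i. t (1 + int j) = f j)"])
    fix i t assume i: "i < n" and t: "repr n \<sigma> (\<rho>(0 := i)) t" "t (tmp d 3) = int i" "temps_eq d s t"
      "buf_eq s t \<and> (\<forall>k. k \<noteq> 4 \<longrightarrow> k \<noteq> 3 \<longrightarrow> t (tmp d k) = s (tmp d k)) \<and> (\<forall>j<i. t (1 + int j) = f j)"
    have v: "t (aval a t) = f i" using a i t by blast
    have c: "t(1 + int i := x) = t(1 + int i := y)" if "x = y" for x y using that by simp
    show "wpt n F (Store (Add (Const 1) (tx d 3)) (Cell a)) t (acost a + 6)
      (\<lambda>u. repr n \<sigma> (\<rho>(0 := i)) u \<and> u (tmp d 3) = int i \<and> u (tmp d 4) = t (tmp d 4) \<and> temps_eq d s u \<and>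
        buf_eq s u \<and> (\<forall>k. k \<noteq> 4 \<longrightarrow> k \<noteq> 3 \<longrightarrow> u (tmp d k) = s (tmp d k)) \<and> (\<forall>j<Suc i. u (1 + int j) = f j))"
      by (rule wpt_mono[OF wpt_Store[where Q = "\<lambda>u. u = t(1 + int i := f i)"]])
        (use t v in \<open>auto simp: less_Suc_eq\<close>)
  qed (use r in auto)
  then show ?thesis
  proof (rule wpt_mono)
    fix t assume t: "repr n \<sigma> \<rho> t \<and> temps_eq d s t \<and> (buf_eq s t \<and> (\<forall>k. k \<noteq> 4 \<longrightarrow> k \<noteq> 3 \<longrightarrow> t (tmp d k) = s (tmp d k)) \<and>
       (\<forall>j<n. t (1 + int j) = f j))"
    then have "stored_set n t 1 = {i. i < n \<and> f i \<noteq> 0}" unfolding stored_set_def by auto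
    then show "repr n \<sigma> \<rho> t \<and> temps_eq d s t \<and> buf_eq s t \<and> stored_set n t 1 = {i. i < n \<and> f i \<noteq> 0}"
      using t by blast
  qed (simp add: algebra_simps)
qed

lemma computes_Orc:
  assumes "computes_ex m (Suc d) e c B"
  shows "\<exists>c B. computes_ex m d (Orc v e) c B"
proof -
  let ?a = "locx (4 * d + 2) (Const 0) (Add (Const 5) (tx d 3))"
  let ?upd = "Store ?a (tx (Suc d) 0)"
  let ?C = "Seq (forc d v (Cell (Const 0)) (Seq c ?upd))
    (Seq (copy_row d ?a) (Query (Const (tmp d 0)) (Const 1)))"
  let ?B = "\<lambda>n. (11 + (n + 1) * (2 + (B n + (3 + acost ?a)) + 13)) + ((11 + (n + 1) * (21 + acost ?a)) + 3)"
  have "computes_ex m d (Orc v e) ?C ?B"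
    unfolding computes_ex_def
  proof (intro conjI allI impI)
    show "poly_bounded ?B"
      using computes_ex_bounded[OF assms] by (intro poly_bounded_intros)
    fix n F \<sigma> \<rho> s assume r: "repr n \<sigma> \<rho> s"
    let ?N = "psize m n"
    let ?f = "\<lambda>i. ev n ?N F \<sigma> (\<rho>(v := i)) e"
    have a: "aval ?a t = tmp d (5 + i)" if "t (tmp d 3) = int i" for t i
      unfolding tmp_def by (rule aval_locx) (use that in \<open>auto simp: tmp_def\<close>)
    have 1: "wpt n F (forc d v (Cell (Const 0)) (Seq c ?upd)) s
       (11 + (n + 1) * (acost (Cell (Const 0)) + (B n + (3 + acost ?a)) + 13))
      (\<lambda>t. repr n \<sigma> \<rho> t \<and> temps_eq d s t \<and> buf_eq s t \<and> (\<forall>j<n. view d t (5 + j) = ?f j))"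
    proof (rule wpt_acc_loop[OF assms, where A = "\<lambda>i w. \<forall>j<i. w (5 + j) = ?f j"])
      fix i s assume i: "\<forall>j<i. view d s (5 + j) = ?f j" "s (tmp (Suc d) 0) = ?f i" "s (tmp d 3) = int i"
      show "wpt n F ?upd s (3 + acost ?a)
        (\<lambda>t. \<exists>j x. t = s(tmp d j := x) \<and> j \<noteq> 4 \<and> j \<noteq> 3 \<and> (\<forall>j'<Suc i. ((view d s)(j := x)) (5 + j') = ?f j'))"
        by (rule wpt_mono[OF wpt_Store[where Q = "\<lambda>t. t = s(tmp d (5 + i) := ?f i)"]])
          (use i a in \<open>auto intro!: exI[of _ "5 + i"] exI[of _ "?f i"] simp: less_Suc_eq\<close>)
    qed (use r in auto)
    show "wpt n F ?C s (?B n) (\<lambda>t. repr n \<sigma> \<rho> t \<and> t (tmp d 0) = ev n ?N F \<sigma> \<rho> (Orc v e) \<and>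
        temps_eq d s t \<and> buf_eq s t)"
    proof (rule wpt_Seq[OF wpt_mono[OF 1]])
      fix t assume t: "repr n \<sigma> \<rho> t \<and> temps_eq d s t \<and> buf_eq s t \<and> (\<forall>j<n. view d t (5 + j) = ?f j)"
      show "wpt n F (Seq (copy_row d ?a) (Query (Const (tmp d 0)) (Const 1))) t ((11 + (n + 1) * (21 + acost ?a)) + 3)
        (\<lambda>t. repr n \<sigma> \<rho> t \<and> t (tmp d 0) = ev n ?N F \<sigma> \<rho> (Orc v e) \<and> temps_eq d s t \<and> buf_eq s t)"
      proof (rule wpt_Seq[OF wpt_copy_row[where f = ?f]])
        fix i s' assume "i < n" "\<forall>k. k \<noteq> 4 \<longrightarrow> k \<noteq> 3 \<longrightarrow> s' (tmp d k) = t (tmp d k)" "s' (tmp d 3) = int i"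
        then show "s' (aval ?a s') = ?f i" using a[of s' i] t by (simp add: view_def)
      next
        fix u assume u: "repr n \<sigma> \<rho> u \<and> temps_eq d t u \<and> buf_eq t u \<and> stored_set n u 1 = {i. i < n \<and> ?f i \<noteq> 0}"
        then have "temps_eq d s u" "buf_eq s u" using t temps_eq_trans[of d s t d u] buf_eq_trans by auto
        then show "wpt n F (Query (Const (tmp d 0)) (Const 1)) u 3
          (\<lambda>t. repr n \<sigma> \<rho> t \<and> t (tmp d 0) = ev n ?N F \<sigma> \<rho> (Orc v e) \<and> temps_eq d s t \<and> buf_eq s t)"
          by (rule_tac wpt_mono[OF wpt_Query]) (use u in auto)
      qed (use t in blast)
    qed simp
  qed
  then show ?thesis by blast
qed

lemma computes_ex_exists: "\<exists>c B. computes_ex m d e c B"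
proof (induction e arbitrary: d)
  case (Lit x)
  then show ?case using computes_simple[of "Const x" m "Lit x" d] by auto
next
  case Dim
  then show ?case using computes_simple[of "Cell (Const 0)" m Dim d] by (auto simp: repr_def)
next
  case (Var v)
  then show ?case using computes_simple[of "Cell (Const (var v))" m "Var v" d] by (auto simp: repr_def)
next
  case (Arr a e1 e2)
  then show ?case using computes_Arr by meson
next
  case (Pls e1 e2)
  then obtain c1 B1 c2 B2 where "computes_ex m d e1 c1 B1" "computes_ex m (Suc d) e2 c2 B2" by meson
  then show ?case by (rule computes_arith[where a = "Add (tx d 0) (tx (Suc d) 0)"]) simp
next
  case (Mns e1 e2)
  then obtain c1 B1 c2 B2 where "computes_ex m d e1 c1 B1" "computes_ex m (Suc d) e2 c2 B2" by meson
  then show ?case by (rule computes_arith[where a = "Sub (tx d 0) (tx (Suc d) 0)"]) simp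
next
  case (Tms e1 e2)
  then obtain c1 B1 c2 B2 where "computes_ex m d e1 c1 B1" "computes_ex m (Suc d) e2 c2 B2" by meson
  then show ?case by (rule computes_arith[where a = "Mul (tx d 0) (tx (Suc d) 0)"]) simp
next
  case (Ite e1 e2 e3 e4)
  then show ?case using computes_Ite by meson
next
  case (Summ v e)
  then show ?case using computes_Summ by meson
next
  case (Mu v e)
  then show ?case using computes_Mu by meson
next
  case (Orc v e)
  then show ?case using computes_Orc by meson
qed

section \<open>Compilation of programs\<close>

definition computes_pr :: "nat \<Rightarrow> nat \<Rightarrow> pr \<Rightarrow> com \<Rightarrow> (nat \<Rightarrow> nat) \<Rightarrow> bool" where
  "computes_pr m d c code B \<longleftrightarrow> poly_bounded B \<and>
     (\<forall>n F \<sigma> s. repr n \<sigma> (\<lambda>_. 0) s \<longrightarrow>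
       wpt n F code s (B n) (\<lambda>t. repr n (run n (psize m n) F c \<sigma>) (\<lambda>_. 0) t \<and> temps_eq d s t))"

lemma computes_pr_bounded: "computes_pr m d c code B \<Longrightarrow> poly_bounded B"
  unfolding computes_pr_def by blast

lemma computes_prD:
  "computes_pr m d c code B \<Longrightarrow> repr n \<sigma> (\<lambda>_. 0) s \<Longrightarrow>
    wpt n F code s (B n) (\<lambda>t. repr n (run n (psize m n) F c \<sigma>) (\<lambda>_. 0) t \<and> temps_eq d s t)"
  unfolding computes_pr_def by blast

lemma repr_arr:
  "repr n \<sigma> \<rho> s \<Longrightarrow> repr n (\<sigma>(a := (\<sigma> a)(p := (\<sigma> a p)(q := x)))) \<rho> (s(arr a p q := x))"
  unfolding repr_def by auto

lemma computes_Asg: "\<exists>code B. computes_pr m d (Asg a i j e) code B"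
proof -
  obtain c B where c: "computes_ex m (Suc (Suc d)) e c B" using computes_ex_exists by blast
  let ?bx = "locx 3 (tx d 3) (tx (Suc d) 3)" and ?ax = "locx (4 * a) (tx d 3) (tx (Suc d) 3)"
  let ?S1 = "Store ?bx (tx (Suc (Suc d)) 0)" and ?S2 = "Store ?ax (Cell ?bx)"
  let ?Z = "sizex m"
  let ?in1 = "forc (Suc d) j ?Z (Seq c ?S1)" and ?in2 = "forc (Suc d) j ?Z ?S2"
  let ?C = "Seq (forc d i ?Z ?in1) (forc d i ?Z ?in2)"
  let ?U = "3 + acost ?bx + acost ?ax"
  let ?B1 = "\<lambda>n. 11 + (psize m n + 1) * (acost ?Z + (B n + ?U) + 13)"
  let ?B2 = "\<lambda>n. 11 + (psize m n + 1) * (acost ?Z + ?U + 13)"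
  let ?B = "\<lambda>n. (11 + (psize m n + 1) * (acost ?Z + ?B1 n + 13)) + (11 + (psize m n + 1) * (acost ?Z + ?B2 n + 13))"
  have "computes_pr m d (Asg a i j e) ?C ?B"
    unfolding computes_pr_def
  proof (intro conjI allI impI)
    show "poly_bounded ?B" using computes_ex_bounded[OF c] by (intro poly_bounded_intros)
    fix n F \<sigma> s assume r: "repr n \<sigma> (\<lambda>_. 0) s"
    let ?N = "psize m n" and ?\<rho> = "\<lambda>_::nat. 0::nat"
    define val where "val p q = ev n ?N F \<sigma> (?\<rho>(i := p, j := q)) e" for p q
    have bx: "aval ?bx t = buf p q" if "t (tmp d 3) = int p" "t (tmp (Suc d) 3) = int q" for t p q
      unfolding buf_def by (rule aval_locx) (use that in auto)
    have ax: "aval ?ax t = arr a p q" if "t (tmp d 3) = int p" "t (tmp (Suc d) 3) = int q" for t p q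
      unfolding arr_def by (rule aval_locx) (use that in auto)
    have fill: "wpt n F (forc d i ?Z ?in1) s (11 + (?N + 1) * (acost ?Z + ?B1 n + 13))
      (\<lambda>t. repr n \<sigma> ?\<rho> t \<and> temps_eq d s t \<and> (\<forall>p<?N. \<forall>q<?N. t (buf p q) = val p q))"
    proof (rule wpt_forc[where \<sigma> = "\<lambda>_. \<sigma>" and J = "\<lambda>k t. \<forall>p<k. \<forall>q<?N. t (buf p q) = val p q"])
      fix p t assume t: "repr n \<sigma> (?\<rho>(i := p)) t" "t (tmp d 3) = int p" "temps_eq d s t"
        "\<forall>p'<p. \<forall>q<?N. t (buf p' q) = val p' q"
      have "wpt n F ?in1 t (?B1 n)
        (\<lambda>u. repr n \<sigma> (?\<rho>(i := p)) u \<and> temps_eq (Suc d) t u \<and>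
          ((\<forall>p'<p. \<forall>q<?N. u (buf p' q) = val p' q) \<and> (\<forall>q<?N. u (buf p q) = val p q)))"
      proof (rule wpt_forc[where \<sigma> = "\<lambda>_. \<sigma>" and J = "\<lambda>k u. (\<forall>p'<p. \<forall>q<?N. u (buf p' q) = val p' q) \<and>
          (\<forall>q<k. u (buf p q) = val p q)"])
        fix q u assume u: "repr n \<sigma> (?\<rho>(i := p, j := q)) u" "u (tmp (Suc d) 3) = int q" "temps_eq (Suc d) t u"
          "(\<forall>p'<p. \<forall>q<?N. u (buf p' q) = val p' q) \<and> (\<forall>q'<q. u (buf p q') = val p q')"
        show "wpt n F (Seq c ?S1) u (B n + ?U) (\<lambda>w. repr n \<sigma> (?\<rho>(i := p, j := q)) w \<and>
            w (tmp (Suc d) 3) = int q \<and> w (tmp (Suc d) 4) = u (tmp (Suc d) 4) \<and> temps_eq (Suc d) t w \<and>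
            (\<forall>p'<p. \<forall>q<?N. w (buf p' q) = val p' q) \<and> (\<forall>q'<Suc q. w (buf p q') = val p q'))"
        proof (rule wpt_Seq[OF computes_exD[OF c u(1)]])
          fix w assume w: "repr n \<sigma> (?\<rho>(i := p, j := q)) w \<and>
             w (tmp (Suc (Suc d)) 0) = ev n ?N F \<sigma> (?\<rho>(i := p, j := q)) e \<and>
             temps_eq (Suc (Suc d)) u w \<and> buf_eq u w"
          then have 1: "w (tmp (Suc d) k) = u (tmp (Suc d) k)" "w (tmp d 3) = u (tmp d 3)" for k
            by (auto simp: temps_eqD[of "Suc (Suc d)" u w])
          have 2: "w (tmp d 3) = int p" using 1 t(2) temps_eqD[OF u(3), of d 3] by simp
          have 3: "temps_eq (Suc d) t w" using temps_eq_trans[OF u(3), of "Suc (Suc d)" w] w by simp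
          show "wpt n F ?S1 w ?U (\<lambda>w. repr n \<sigma> (?\<rho>(i := p, j := q)) w \<and>
            w (tmp (Suc d) 3) = int q \<and> w (tmp (Suc d) 4) = u (tmp (Suc d) 4) \<and> temps_eq (Suc d) t w \<and>
            (\<forall>p'<p. \<forall>q<?N. w (buf p' q) = val p' q) \<and> (\<forall>q'<Suc q. w (buf p q') = val p q'))"
            by (intro wpt_mono[OF wpt_Store[where Q = "\<lambda>v. v = w(buf p q := val p q)"]])
              (use w 1(1)[of 3] 1(1)[of 4] 3 u(2,4) bx[where t = w and p = p and q = q] 2 in \<open>auto simp: val_def buf_eq_def less_Suc_eq\<close>)
        qed
      qed (use t in \<open>auto simp: aval_sizex\<close>)
      then show "wpt n F ?in1 t (?B1 n) (\<lambda>u. repr n \<sigma> (?\<rho>(i := p)) u \<and> u (tmp d 3) = int p \<and>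
        u (tmp d 4) = t (tmp d 4) \<and> temps_eq d s u \<and> (\<forall>p'<Suc p. \<forall>q<?N. u (buf p' q) = val p' q))"
      proof (rule wpt_mono)
        fix u assume u: "repr n \<sigma> (?\<rho>(i := p)) u \<and> temps_eq (Suc d) t u \<and>
          ((\<forall>p'<p. \<forall>q<?N. u (buf p' q) = val p' q) \<and> (\<forall>q<?N. u (buf p q) = val p q))"
        then have "u (tmp d 3) = int p" "u (tmp d 4) = t (tmp d 4)" "temps_eq d s u"
          using t(2,3) by (auto simp: temps_eqD[of "Suc d" t u d] temps_eq_trans[of d s t "Suc d" u])
        then show "repr n \<sigma> (?\<rho>(i := p)) u \<and> u (tmp d 3) = int p \<and>
          u (tmp d 4) = t (tmp d 4) \<and> temps_eq d s u \<and> (\<forall>p'<Suc p. \<forall>q<?N. u (buf p' q) = val p' q)"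
          using u by (simp add: less_Suc_eq)
      qed simp
    qed (use r in \<open>auto simp: aval_sizex\<close>)
    \<comment> \<open>The store during copying: rows below \<open>k\<close> are new, and so are the
      first \<open>l\<close> entries of row \<open>k\<close>.\<close>
    let ?\<sigma> = "\<lambda>k l. \<sigma>(a := \<lambda>p q. if p < k \<and> q < ?N \<or> p = k \<and> q < l then val p q else \<sigma> a p q)"
    have copy: "wpt n F (forc d i ?Z ?in2) s' (11 + (?N + 1) * (acost ?Z + ?B2 n + 13))
      (\<lambda>t. repr n (?\<sigma> ?N 0) ?\<rho> t \<and> temps_eq d s' t \<and> (\<forall>p<?N. \<forall>q<?N. t (buf p q) = val p q))"
      if r': "repr n \<sigma> ?\<rho> s'" and b': "\<forall>p<?N. \<forall>q<?N. s' (buf p q) = val p q" for s'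
    proof (rule wpt_forc[where \<sigma> = "\<lambda>k. ?\<sigma> k 0" and J = "\<lambda>k t. \<forall>p<?N. \<forall>q<?N. t (buf p q) = val p q"])
      fix p t assume t: "p < ?N" "repr n (?\<sigma> p 0) (?\<rho>(i := p)) t" "t (tmp d 3) = int p" "temps_eq d s' t"
        "\<forall>p<?N. \<forall>q<?N. t (buf p q) = val p q"
      have "wpt n F ?in2 t (?B2 n)
        (\<lambda>u. repr n (?\<sigma> p ?N) (?\<rho>(i := p)) u \<and> temps_eq (Suc d) t u \<and> (\<forall>p<?N. \<forall>q<?N. u (buf p q) = val p q))"
      proof (rule wpt_forc[where \<sigma> = "\<lambda>l. ?\<sigma> p l" and J = "\<lambda>k u. \<forall>p<?N. \<forall>q<?N. u (buf p q) = val p q"])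
        fix q u assume u: "q < ?N" "repr n (?\<sigma> p q) (?\<rho>(i := p, j := q)) u" "u (tmp (Suc d) 3) = int q"
          "temps_eq (Suc d) t u" "\<forall>p<?N. \<forall>q<?N. u (buf p q) = val p q"
        have 2: "u (tmp d 3) = int p" using t(3) temps_eqD[OF u(4), of d 3] by simp
        have "(?\<sigma> p q)(a := (?\<sigma> p q a)(p := (?\<sigma> p q a p)(q := val p q))) = ?\<sigma> p (Suc q)"
          by (auto simp: fun_eq_iff less_Suc_eq)
        then have 3: "repr n (?\<sigma> p (Suc q)) (?\<rho>(i := p, j := q)) (u(arr a p q := val p q))"
          using repr_arr[OF u(2), of a p q "val p q"] by simp
        show "wpt n F ?S2 u ?U (\<lambda>w. repr n (?\<sigma> p (Suc q)) (?\<rho>(i := p, j := q)) w \<and>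
            w (tmp (Suc d) 3) = int q \<and> w (tmp (Suc d) 4) = u (tmp (Suc d) 4) \<and> temps_eq (Suc d) t w \<and>
            (\<forall>p<?N. \<forall>q<?N. w (buf p q) = val p q))"
          by (intro wpt_mono[OF wpt_Store[where Q = "\<lambda>v. v = u(arr a p q := val p q)"]])
            (use 3 u t(1) 2 bx[where t = u and p = p and q = q] ax[where t = u and p = p and q = q] in auto)
      qed (use t in \<open>auto simp: aval_sizex\<close>)
      moreover have "?\<sigma> p ?N = ?\<sigma> (Suc p) 0" by (auto simp: fun_eq_iff less_Suc_eq)
      ultimately show "wpt n F ?in2 t (?B2 n) (\<lambda>u. repr n (?\<sigma> (Suc p) 0) (?\<rho>(i := p)) u \<and> u (tmp d 3) = int p \<and>
        u (tmp d 4) = t (tmp d 4) \<and> temps_eq d s' u \<and> (\<forall>p<?N. \<forall>q<?N. u (buf p q) = val p q))"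
      proof (rule_tac wpt_mono)
        fix u assume u: "repr n (?\<sigma> p ?N) (?\<rho>(i := p)) u \<and> temps_eq (Suc d) t u \<and>
          (\<forall>p<?N. \<forall>q<?N. u (buf p q) = val p q)"
        then have "u (tmp d 3) = int p" "u (tmp d 4) = t (tmp d 4)" "temps_eq d s' u"
          using t(3,4) by (auto simp: temps_eqD[of "Suc d" t u d] temps_eq_trans[of d s' t "Suc d" u])
        then show "repr n (?\<sigma> (Suc p) 0) (?\<rho>(i := p)) u \<and> u (tmp d 3) = int p \<and>
          u (tmp d 4) = t (tmp d 4) \<and> temps_eq d s' u \<and> (\<forall>p<?N. \<forall>q<?N. u (buf p q) = val p q)"
          using u \<open>?\<sigma> p ?N = ?\<sigma> (Suc p) 0\<close> by simp
      qed (assumption | simp)+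
    qed (use r' b' in \<open>auto simp: aval_sizex\<close>)
    have "?\<sigma> ?N 0 = run n ?N F (Asg a i j e) \<sigma>" by (simp add: val_def fun_eq_iff)
    then show "wpt n F ?C s (?B n) (\<lambda>t. repr n (run n ?N F (Asg a i j e) \<sigma>) ?\<rho> t \<and> temps_eq d s t)"
      by (intro wpt_Seq[OF fill] wpt_mono[OF copy]) (auto intro: temps_eq_trans simp del: run.simps)
  qed
  then show ?thesis by blast
qed

lemma computes_Then:
  assumes "computes_pr m d c1 code1 B1" "computes_pr m d c2 code2 B2"
  shows "computes_pr m d (Then c1 c2) (Seq code1 code2) (\<lambda>n. B1 n + B2 n)"
  unfolding computes_pr_def
proof (intro conjI allI impI)
  show "poly_bounded (\<lambda>n. B1 n + B2 n)" using assms[THEN computes_pr_bounded] by (intro poly_bounded_intros)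
  fix n F \<sigma> s assume "repr n \<sigma> (\<lambda>_. 0) s"
  then show "wpt n F (Seq code1 code2) s (B1 n + B2 n)
     (\<lambda>t. repr n (run n (psize m n) F (Then c1 c2) \<sigma>) (\<lambda>_. 0) t \<and> temps_eq d s t)"
    by (intro wpt_Seq[OF computes_prD[OF assms(1)]] wpt_mono[OF computes_prD[OF assms(2)]])
      (auto intro: temps_eq_trans)
qed

lemma computes_Cond:
  assumes "computes_pr m d c1 code1 B1" "computes_pr m d c2 code2 B2"
  shows "\<exists>code B. computes_pr m d (Cond a b c1 c2) code B"
proof -
  obtain ca Ba where a: "computes_ex m d a ca Ba" using computes_ex_exists by blast
  obtain cb Bb where b: "computes_ex m (Suc d) b cb Bb" using computes_ex_exists by blast
  let ?b = "Less (tx d 0) (tx (Suc d) 0)"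
  have "computes_pr m d (Cond a b c1 c2) (Seq ca (Seq cb (If ?b code1 code2)))
     (\<lambda>n. Ba n + (Bb n + (bcost ?b + (B1 n + B2 n))))"
    unfolding computes_pr_def
  proof (intro conjI allI impI)
    show "poly_bounded (\<lambda>n. Ba n + (Bb n + (bcost ?b + (B1 n + B2 n))))"
      using assms[THEN computes_pr_bounded] a[THEN computes_ex_bounded] b[THEN computes_ex_bounded]
      by (intro poly_bounded_intros)
    fix n F \<sigma> s assume r: "repr n \<sigma> (\<lambda>_. 0) s"
    let ?N = "psize m n"
    let ?Q = "\<lambda>s t. repr n (run n ?N F (Cond a b c1 c2) \<sigma>) (\<lambda>_. 0) t \<and> temps_eq d s t"
    show "wpt n F (Seq ca (Seq cb (If ?b code1 code2))) s (Ba n + (Bb n + (bcost ?b + (B1 n + B2 n)))) (?Q s)"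
    proof (rule wpt_Seq[OF computes_exD[OF a r]], rule wpt_Seq[OF computes_exD[OF b]], blast)
      fix t u
      assume t: "repr n \<sigma> (\<lambda>_. 0) t \<and> t (tmp d 0) = ev n ?N F \<sigma> (\<lambda>_. 0) a \<and> temps_eq d s t \<and> buf_eq s t"
        and u: "repr n \<sigma> (\<lambda>_. 0) u \<and> u (tmp (Suc d) 0) = ev n ?N F \<sigma> (\<lambda>_. 0) b \<and>
           temps_eq (Suc d) t u \<and> buf_eq t u"
      then have v: "u (tmp d 0) = ev n ?N F \<sigma> (\<lambda>_. 0) a" by (simp add: temps_eqD[of "Suc d" t u d])
      have f: "temps_eq d s u" using t u temps_eq_trans[of d s t "Suc d" u] by simp
      have "wpt n F (If ?b code1 code2) u (bcost ?b + (B1 n + B2 n)) (?Q u)"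
        by (rule wpt_If; rule wpt_mono[OF computes_prD[OF assms(1)]] wpt_mono[OF computes_prD[OF assms(2)]])
          (use u v in auto)
      then show "wpt n F (If ?b code1 code2) u (bcost ?b + (B1 n + B2 n)) (?Q s)"
        by (rule wpt_mono) (use f in \<open>auto intro: temps_eq_trans\<close>)
    qed
  qed
  then show ?thesis by blast
qed

text \<open>The body is compiled one level deeper, which protects the counter
  \<open>tmp d 3\<close>.\<close>

lemma computes_Rep:
  assumes "computes_pr m (Suc d) c code B"
  shows "\<exists>code B. computes_pr m d (Rep c) code B"
proof -
  let ?b = "Less (tx d 3) (sizex m)"
  let ?inc = "Store (Const (tmp d 3)) (Add (tx d 3) (Const 1))"
  let ?C = "Seq (Store (Const (tmp d 3)) (Const 0)) (While ?b (Seq code ?inc))"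
  let ?B = "\<lambda>n. 3 + (psize m n + 1) * (bcost ?b + (B n + 6))"
  have "computes_pr m d (Rep c) ?C ?B"
    unfolding computes_pr_def
  proof (intro conjI allI impI)
    show "poly_bounded ?B"
      using assms[THEN computes_pr_bounded] by (intro poly_bounded_intros)
    fix n F \<sigma> s assume r: "repr n \<sigma> (\<lambda>_. 0) s"
    let ?N = "psize m n"
    let ?f = "run n ?N F c"
    define I where "I i t \<longleftrightarrow> repr n ((?f ^^ i) \<sigma>) (\<lambda>_. 0) t \<and> t (tmp d 3) = int i \<and> temps_eq d s t" for i t
    have w: "wpt n F (While ?b (Seq code ?inc)) t ((?N + 1) * (bcost ?b + (B n + 6))) (I ?N)" if "I 0 t" for t
    proof (rule wpt_While[where I = I])
      show "I 0 t" by (rule that)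
      show "\<not> bval ?b t" if "I ?N t" for t
        using that unfolding I_def repr_def by (simp add: aval_sizex)
      fix i t assume i: "i < ?N" "I i t"
      then have "bval ?b t" unfolding I_def repr_def by (simp add: aval_sizex)
      moreover have "wpt n F (Seq code ?inc) t (B n + 6) (I (Suc i))"
      proof (rule wpt_Seq[OF computes_prD[OF assms]])
        show "repr n ((?f ^^ i) \<sigma>) (\<lambda>_. 0) t" using i unfolding I_def by simp
        fix u assume u: "repr n (?f ((?f ^^ i) \<sigma>)) (\<lambda>_. 0) u \<and> temps_eq (Suc d) t u"
        then have "u (tmp d 3) = int i" using i temps_eqD[of "Suc d" t u d 3] unfolding I_def by simp
        moreover have "temps_eq d s u" using u i temps_eq_trans[of d s t "Suc d" u] unfolding I_def by simp
        ultimately show "wpt n F ?inc u 6 (I (Suc i))"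
          using u by (intro wpt_mono[OF wpt_Store[where Q = "\<lambda>w. w = u(tmp d 3 := int i + 1)"]]) (auto simp: I_def)
      qed
      ultimately show "bval ?b t \<and> wpt n F (Seq code ?inc) t (B n + 6) (I (Suc i))" ..
    qed
    have 1: "wpt n F (Store (Const (tmp d 3)) (Const 0)) s 3 (I 0)"
      by (rule wpt_mono[OF wpt_Store[where Q = "\<lambda>t. t = s(tmp d 3 := 0)"]]) (use r in \<open>auto simp: I_def\<close>)
    show "wpt n F ?C s (?B n) (\<lambda>t. repr n (run n ?N F (Rep c) \<sigma>) (\<lambda>_. 0) t \<and> temps_eq d s t)"
      by (rule wpt_mono[OF wpt_Seq[OF 1 w]]) (auto simp: I_def)
  qed
  then show ?thesis by blast
qed

lemma computes_pr_exists: "\<exists>code B. computes_pr m d c code B"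
proof (induction c arbitrary: d)
  case Asg then show ?case by (rule computes_Asg)
next
  case Then then show ?case using computes_Then by meson
next
  case Cond then show ?case using computes_Cond by meson
next
  case Rep then show ?case using computes_Rep by meson
qed

text \<open>Row 0 of array \<open>a\<close> serves as the output. The initial memory represents the
  zero store, since all arrays live at negative addresses.\<close>

theorem program_exists:
  "\<exists>code p. \<forall>n F. \<exists>T t. exec n F code (input_mem n) T t \<and> T \<le> poly p n \<and>
     stored_set n t 1 = {i. i < n \<and> run n (psize m n) F c (\<lambda>_ _ _. 0) a 0 i \<noteq> 0}"
proof -
  obtain c1 B where c1: "computes_pr m 0 c c1 B" using computes_pr_exists by blast
  let ?a = "locx (4 * a) (Const 0) (tx 0 3)"
  let ?B = "\<lambda>n. B n + (11 + (n + 1) * (21 + acost ?a))"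
  have "poly_bounded ?B" using c1[THEN computes_pr_bounded] by (intro poly_bounded_intros)
  then obtain p where p: "\<And>n. ?B n \<le> poly p n" unfolding poly_bounded_def by blast
  have "wpt n F (Seq c1 (copy_row 0 ?a)) (input_mem n) (?B n)
     (\<lambda>t. stored_set n t 1 = {i. i < n \<and> run n (psize m n) F c (\<lambda>_ _ _. 0) a 0 i \<noteq> 0})" for n F
  proof -
    let ?\<sigma> = "run n (psize m n) F c (\<lambda>_ _ _. 0)"
    have "repr n (\<lambda>_ _ _. 0) (\<lambda>_. 0) (input_mem n)" unfolding repr_def input_mem_def by auto
    then show ?thesis
    proof (rule wpt_Seq[OF computes_prD[OF c1]])
      fix t assume t: "repr n ?\<sigma> (\<lambda>_. 0) t \<and> temps_eq 0 (input_mem n) t"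
      show "wpt n F (copy_row 0 ?a) t (11 + (n + 1) * (21 + acost ?a))
        (\<lambda>t. stored_set n t 1 = {i. i < n \<and> ?\<sigma> a 0 i \<noteq> 0})"
      proof (rule wpt_mono[OF wpt_copy_row[where f = "\<lambda>i. ?\<sigma> a 0 i"]])
        fix i s' assume s': "repr n ?\<sigma> ((\<lambda>_. 0)(0 := i)) s'" "s' (tmp 0 3) = int i"
        have "aval ?a s' = arr a 0 i" unfolding arr_def by (rule aval_locx) (use s' in auto)
        then show "s' (aval ?a s') = ?\<sigma> a 0 i" using s' unfolding repr_def by simp
      qed (use t in auto)
    qed
  qed
  then show ?thesis using p unfolding wpt_def by (meson le_trans)
qed

section \<open>Submodular function minimisation by pushing and relabelling\<close>

lemma first_satisfies: "P i \<Longrightarrow> i < N \<Longrightarrow> P (first N P)"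
  using first_less_iff[of N P] first_holds[of N P] by blast

section \<open>Greedy vectors of linear orders\<close>

locale submodular_fun =
  fixes n N :: nat and G :: "nat set \<Rightarrow> int"
  assumes n_le_N: "n \<le> N" and submod: "X \<subseteq> {..<n} \<Longrightarrow> Y \<subseteq> {..<n} \<Longrightarrow> G (X \<union> Y) + G (X \<inter> Y) \<le> G X + G Y"
begin

text \<open>The greedy vector of the order \<open>p\<close>, a vertex of the base polyhedron.
  \<open>G {}\<close> is not assumed to be 0, so sums are compared with
  \<open>G X - G {}\<close>.\<close>

definition bvec :: "(nat \<Rightarrow> int) \<Rightarrow> nat \<Rightarrow> int" where
  "bvec p v = G {w. w < n \<and> p w \<le> p v} - G {w. w < n \<and> p w < p v}"

definition order :: "(nat \<Rightarrow> int) \<Rightarrow> bool" where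
  "order p \<longleftrightarrow> inj_on p {..<n} \<and> (\<forall>v<n. 0 \<le> p v \<and> p v < int n)"

lemma orderD: "order p \<Longrightarrow> v < n \<Longrightarrow> w < n \<Longrightarrow> p v = p w \<Longrightarrow> v = w"
  unfolding order_def inj_on_def by auto

lemma order_range: "order p \<Longrightarrow> v < n \<Longrightarrow> 0 \<le> p v \<and> p v < int n"
  unfolding order_def by auto

lemma order_surj: assumes "order p" "0 \<le> k" "k < int n" shows "\<exists>u<n. p u = k"
proof -
  have "p ` {..<n} \<subseteq> {0..<int n}" "card (p ` {..<n}) = card {0..<int n}"
    using assms by (auto simp: order_def card_image)
  then have "p ` {..<n} = {0..<int n}" by (intro card_subset_eq) auto
  then have "k \<in> p ` {..<n}" using assms by simp
  then show ?thesis by auto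
qed

text \<open>Submodularity for \<open>B\<close> and \<open>insert u A\<close>, whose intersection is
  \<open>A\<close>.\<close>

lemma diminishing:
  assumes "A \<subseteq> B" "B \<subseteq> {..<n}" "u < n" "u \<notin> B"
  shows "G (insert u B) - G (insert u A) \<le> G B - G A"
proof -
  have "G (B \<union> insert u A) + G (B \<inter> insert u A) \<le> G B + G (insert u A)"
    using assms by (intro submod) auto
  moreover have "B \<union> insert u A = insert u B" "B \<inter> insert u A = A" using assms by auto
  ultimately show ?thesis by simp
qed

text \<open>Remove the last element \<open>v\<close> of \<open>X\<close>. Its predecessors include
  \<open>X - {v}\<close>, so diminishing returns bound its marginal value by
  \<open>G X - G (X - {v})\<close>; if \<open>X\<close> is an initial segment, the two sets agree
  and so do the values.\<close>

lemma sum_bvec: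
  assumes p: "order p" and "X \<subseteq> {..<n}"
  shows "sum (bvec p) X \<le> G X - G {} \<and>
    ((\<forall>v\<in>X. \<forall>w<n. p w < p v \<longrightarrow> w \<in> X) \<longrightarrow> sum (bvec p) X = G X - G {})"
  using assms(2)
proof (induction "card X" arbitrary: X rule: less_induct)
  case less
  have fin: "finite X" using less.prems finite_subset by blast
  show ?case
  proof (cases "X = {}")
    case False
    then have "Max (p ` X) \<in> p ` X" using fin by (intro Max_in) auto
    then obtain v where v: "v \<in> X" "Max (p ` X) = p v" by auto
    then have mx: "p w \<le> p v" if "w \<in> X" for w using fin that Max_ge[of "p ` X" "p w"] by simp
    note v = v(1)
    let ?L = "{w. w < n \<and> p w < p v}" and ?Y = "X - {v}"
    have lt: "p w < p v" if "w \<in> ?Y" for w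
      using that mx[of w] orderD[OF p, of w v] v less.prems by (force simp: order.strict_iff_order)
    have "card ?Y < card X" "?Y \<subseteq> {..<n}" using card_Diff1_less[OF fin v] less.prems by auto
    note IH = less.hyps[OF this, THEN conjunct1] less.hyps[OF this, THEN conjunct2, rule_format]
    have le: "{w. w < n \<and> p w \<le> p v} = insert v ?L"
      using orderD[OF p, of _ v] v less.prems by force
    have s: "sum (bvec p) X = bvec p v + sum (bvec p) ?Y" using fin v by (simp add: sum.remove)
    have "G (insert v ?L) - G (insert v ?Y) \<le> G ?L - G ?Y"
      using lt less.prems v by (intro diminishing) auto
    moreover have "insert v ?Y = X" using v by auto
    ultimately have 1: "bvec p v \<le> G X - G ?Y" unfolding bvec_def le by simp
    have 2: "sum (bvec p) X = G X - G {}" if ideal: "\<forall>v\<in>X. \<forall>w<n. p w < p v \<longrightarrow> w \<in> X"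
    proof -
      have "?L = ?Y" using ideal v lt less.prems by auto
      then have "bvec p v = G X - G ?Y" unfolding bvec_def le using \<open>insert v ?Y = X\<close> by simp
      moreover have "sum (bvec p) ?Y = G ?Y - G {}"
      proof (rule IH(2))
        fix w x assume "w \<in> ?Y" "x < n" "p x < p w"
        then show "x \<in> ?Y" using ideal lt[of w] by auto
      qed
      ultimately show ?thesis using s by simp
    qed
    show ?thesis using 1 2 IH(1) s by auto
  qed simp
qed

lemma sum_bvec_all: "order p \<Longrightarrow> sum (bvec p) {..<n} = G {..<n} - G {}"
  using sum_bvec[of p "{..<n}"] by auto

section \<open>Exchanges within an order\<close>

definition mv :: "(nat \<Rightarrow> int) \<Rightarrow> nat \<Rightarrow> nat \<Rightarrow> nat \<Rightarrow> int" where
  "mv p s u = (\<lambda>w. if w = u then p s else if w < n \<and> p s \<le> p w \<and> p w < p u then p w + 1 else p w)"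

context
  fixes p :: "nat \<Rightarrow> int" and s u :: nat
  assumes p: "order p" and s: "s < n" and u: "u < n" and su: "p s < p u"
begin

lemma order_mv: "order (mv p s u)"
proof -
  have "mv p s u v = mv p s u w \<Longrightarrow> v = w" if "v < n" "w < n" for v w
    using that orderD[OF p that] orderD[OF p that(1) u] orderD[OF p that(2) u] su unfolding mv_def
    by (auto split: if_splits)
  moreover have "0 \<le> mv p s u v \<and> mv p s u v < int n" if "v < n" for v
    using order_range[OF p that] order_range[OF p s] order_range[OF p u] unfolding mv_def by auto
  ultimately show ?thesis unfolding order_def inj_on_def by auto
qed

lemma bvec_mv_out:
  assumes "v < n" "p v < p s \<or> p u < p v"
  shows "bvec (mv p s u) v = bvec p v"
proof -
  have "v \<noteq> u" "v \<noteq> s" using assms su by auto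
  then have "mv p s u w \<le> mv p s u v \<longleftrightarrow> p w \<le> p v" "mv p s u w < mv p s u v \<longleftrightarrow> p w < p v" if "w < n" for w
    using assms su that unfolding mv_def by auto
  then show ?thesis unfolding bvec_def by (simp cong: conj_cong)
qed

text \<open>An element of the shifted segment gains the predecessor \<open>u\<close>, which can only
  lower its marginal value; outside the segment nothing changes.\<close>

lemma bvec_mv_le:
  assumes "v < n" "v \<noteq> u"
  shows "bvec (mv p s u) v \<le> bvec p v"
proof (cases "p v < p s \<or> p u < p v")
  case True
  then show ?thesis using bvec_mv_out assms by simp
next
  case False
  then have v: "p s \<le> p v" "p v < p u" using orderD[OF p assms(1) u] assms by force+
  then have "mv p s u w \<le> mv p s u v \<longleftrightarrow> w = u \<or> p w \<le> p v" "mv p s u w < mv p s u v \<longleftrightarrow> w = u \<or> p w < p v"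
    if "w < n" for w
    using assms that orderD[OF p that u] unfolding mv_def by auto
  then have "{w. w < n \<and> mv p s u w \<le> mv p s u v} = insert u {w. w < n \<and> p w \<le> p v}"
    "{w. w < n \<and> mv p s u w < mv p s u v} = insert u {w. w < n \<and> p w < p v}" using u by auto
  moreover have "G (insert u {w. w < n \<and> p w \<le> p v}) - G (insert u {w. w < n \<and> p w < p v})
     \<le> G {w. w < n \<and> p w \<le> p v} - G {w. w < n \<and> p w < p v}"
    using u v by (intro diminishing) auto
  ultimately show ?thesis unfolding bvec_def by simp
qed

lemma sum_bvec_mv: "(\<Sum>v<n. bvec (mv p s u) v - bvec p v) = 0"
  using sum_bvec_all[OF p] sum_bvec_all[OF order_mv] by (simp add: sum_subtractf)

text \<open>The total is the same for all orders, and every other coordinate goes down or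
  stays.\<close>

lemma bvec_mv_ge: "bvec p u \<le> bvec (mv p s u) u"
proof -
  have "(\<Sum>v\<in>{..<n} - {u}. bvec (mv p s u) v - bvec p v) \<le> 0"
    using bvec_mv_le by (intro sum_nonpos) auto
  then show ?thesis using sum_bvec_mv u by (simp add: sum.remove)
qed

text \<open>If \<open>u\<close> gains nothing, the remaining changes are nonpositive with sum 0, so
  each vanishes. This settles the degenerate case of the back substitution.\<close>

lemma bvec_mv_eq:
  assumes "bvec (mv p s u) u = bvec p u" "v < n"
  shows "bvec (mv p s u) v = bvec p v"
proof (rule ccontr)
  assume ne: "bvec (mv p s u) v \<noteq> bvec p v"
  then have "bvec (mv p s u) v - bvec p v < 0" using bvec_mv_le[of v] assms by (cases "v = u") auto
  then have "(\<Sum>v<n. bvec (mv p s u) v - bvec p v) < (\<Sum>v<n. 0)"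
    using bvec_mv_le assms by (intro sum_strict_mono_ex1) (auto, metis order_refl)
  then show False using sum_bvec_mv by simp
qed

end

text \<open>Moving \<open>u\<close> to the front of the segment from \<open>s\<close> changes \<open>bvec p\<close> by \<open>gap p s u\<close>, which is nonpositive
  off \<open>u\<close>, vanishes beyond \<open>u\<close> and sums up to 0. A combination \<open>\<kappa>\<close> of these vectors that is
  supported on \<open>s\<close> and \<open>t\<close> only is therefore found by back substitution, from \<open>t\<close> down to \<open>s\<close>;
  where the diagonal entry vanishes, so does the whole vector, and \<open>u\<close> alone will do.\<close>

definition gap :: "(nat \<Rightarrow> int) \<Rightarrow> nat \<Rightarrow> nat \<Rightarrow> nat \<Rightarrow> int" where
  "gap p s u v = bvec (mv p s u) v - bvec p v"

text \<open>\<open>k\<close> is the position reached by the back substitution: every coordinate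
  placed beyond it, except \<open>t\<close>, is already cancelled. A positive total weight keeps the
  combination from being trivial.\<close>

definition exch_inv :: "(nat \<Rightarrow> int) \<Rightarrow> nat \<Rightarrow> nat \<Rightarrow> (nat \<Rightarrow> int) \<Rightarrow> int \<Rightarrow> bool" where
  "exch_inv p s t \<kappa> k \<longleftrightarrow>
    (\<forall>w<n. 0 \<le> \<kappa> w \<and> (\<kappa> w \<noteq> 0 \<longrightarrow> p s < p w \<and> p w \<le> p t \<and> k < p w)) \<and>
    0 < (\<Sum>w<n. \<kappa> w) \<and>
    (\<forall>v<n. v \<noteq> t \<longrightarrow> k < p v \<longrightarrow> (\<Sum>w<n. \<kappa> w * gap p s w v) = 0)"

context
  fixes p :: "nat \<Rightarrow> int" and s t :: nat
  assumes p: "order p" and s: "s < n" and t: "t < n" and st: "p s < p t"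
begin

lemma exch_start: "exch_inv p s t (\<lambda>w. if w = t then 1 else 0) (p t - 1)"
proof -
  have "(\<Sum>w<n. (if w = t then 1 else 0) * gap p s w v) = gap p s t v" for v
    using t by (subst sum.remove[of _ t]) auto
  moreover have "gap p s t v = 0" if "v < n" "v \<noteq> t" "p t \<le> p v" for v
    using that orderD[OF p that(1) t] bvec_mv_out[OF p s t st that(1)] unfolding gap_def by force
  ultimately show ?thesis unfolding exch_inv_def using t st by (auto simp: sum.delta)
qed

text \<open>The weight of \<open>u\<close> is chosen to cancel coordinate \<open>u\<close>, and the
  old weights are multiplied by \<open>gap p s u u\<close> instead of dividing by it. It is
  nonnegative because \<open>gap p s w u \<le> 0\<close> for all \<open>w\<close> in the support;
  earlier cancellations persist because \<open>gap p s u\<close> vanishes beyond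
  \<open>u\<close>.\<close>

lemma exch_step:
  assumes inv: "exch_inv p s t \<kappa> k" and k: "p s < k" "k < p t" and u: "u < n" "p u = k"
  shows "exch_inv p s t (if gap p s u u = 0 then (\<lambda>w. if w = u then 1 else 0) else
      (\<lambda>w. if w = u then - (\<Sum>w<n. \<kappa> w * gap p s w u) else \<kappa> w * gap p s u u)) (k - 1)"
proof -
  have su: "p s < p u" using k u by simp
  have nn: "0 \<le> \<kappa> w" and supp: "\<kappa> w \<noteq> 0 \<Longrightarrow> p s < p w \<and> p w \<le> p t \<and> k < p w" if "w < n" for w
    using inv that unfolding exch_inv_def by auto
  have pos: "0 < (\<Sum>w<n. \<kappa> w)" and zero: "\<And>v. v < n \<Longrightarrow> v \<noteq> t \<Longrightarrow> k < p v \<Longrightarrow> (\<Sum>w<n. \<kappa> w * gap p s w v) = 0"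
    using inv unfolding exch_inv_def by auto
  have ku: "\<kappa> u = 0" using supp[OF u(1)] u by auto
  have out: "gap p s u v = 0" if "v < n" "k < p v" for v
    using bvec_mv_out[OF p s u(1) su that(1)] that u unfolding gap_def by simp
  show ?thesis
  proof (cases "gap p s u u = 0")
    case True
    have z: "gap p s u v = 0" if "v < n" for v
      using bvec_mv_eq[OF p s u(1) su _ that] True unfolding gap_def by simp
    have "(\<Sum>w<n. (if w = u then 1 else 0) * gap p s w v) = gap p s u v" for v
      using u by (subst sum.remove[of _ u]) auto
    then show ?thesis using True z k u by (auto simp: exch_inv_def)
  next
    case False
    then have mu: "0 < gap p s u u" using bvec_mv_ge[OF p s u(1) su] unfolding gap_def by simp
    let ?r = "- (\<Sum>w<n. \<kappa> w * gap p s w u)"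
    let ?\<kappa> = "\<lambda>w. if w = u then ?r else \<kappa> w * gap p s u u"
    have "\<kappa> w * gap p s w u \<le> 0" if "w < n" for w
    proof (cases "\<kappa> w = 0")
      case False
      then have "p s < p w" "k < p w" using supp[OF that] by auto
      then have "gap p s w u \<le> 0" using bvec_mv_le[OF p s that _ u(1)] u unfolding gap_def by force
      then show ?thesis using nn[OF that] by (simp add: mult_nonneg_nonpos)
    qed simp
    then have "(\<Sum>w<n. \<kappa> w * gap p s w u) \<le> 0" by (intro sum_nonpos) auto
    then have r: "0 \<le> ?r" by simp
    have split: "(\<Sum>w<n. ?\<kappa> w * f w) = ?r * f u + gap p s u u * (\<Sum>w<n. \<kappa> w * f w)" for f
    proof -
      have "(\<Sum>w<n. ?\<kappa> w * f w) = ?r * f u + (\<Sum>w\<in>{..<n} - {u}. \<kappa> w * gap p s u u * f w)"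
        using u by (subst sum.remove[of _ u]) auto
      also have "(\<Sum>w\<in>{..<n} - {u}. \<kappa> w * gap p s u u * f w) = gap p s u u * (\<Sum>w<n. \<kappa> w * f w)"
        using u ku by (subst (2) sum.remove[of _ u]) (auto simp: sum_distrib_left mult_ac)
      finally show ?thesis .
    qed
    have "(\<Sum>w<n. ?\<kappa> w) = ?r + gap p s u u * (\<Sum>w<n. \<kappa> w)"
      using split[of "\<lambda>_. 1"] by simp
    then have "0 < (\<Sum>w<n. ?\<kappa> w)" using r mult_pos_pos[OF mu pos] by linarith
    moreover have "(\<Sum>w<n. ?\<kappa> w * gap p s w v) = 0" if "v < n" "v \<noteq> t" "k - 1 < p v" for v
    proof (cases "v = u")
      case True then show ?thesis unfolding split by simp
    next
      case False
      then have "k < p v" using that u orderD[OF p that(1) u(1)] by force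
      then show ?thesis unfolding split using zero out that by simp
    qed
    moreover have "0 \<le> ?\<kappa> w \<and> (?\<kappa> w \<noteq> 0 \<longrightarrow> p s < p w \<and> p w \<le> p t \<and> k - 1 < p w)" if "w < n" for w
      using nn[OF that] supp[OF that] r mu k u by auto
    ultimately show ?thesis using False unfolding exch_inv_def by (simp only: if_False) blast
  qed
qed

text \<open>All coordinates but those of \<open>s\<close> and \<open>t\<close> vanish and the total
  is 0, so these two are opposite. The one at \<open>t\<close> is nonnegative since only moving
  \<open>t\<close> itself changes it.\<close>

lemma exch_end:
  assumes inv: "exch_inv p s t \<kappa> (p s)"
  defines "\<delta> \<equiv> \<Sum>w<n. \<kappa> w * gap p s w t"
  shows "0 \<le> \<delta>" "\<And>v. v < n \<Longrightarrow> (\<Sum>w<n. \<kappa> w * gap p s w v) = (if v = t then \<delta> else if v = s then - \<delta> else 0)"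
proof -
  let ?y = "\<lambda>v. \<Sum>w<n. \<kappa> w * gap p s w v"
  have nn: "0 \<le> \<kappa> w" and supp: "\<kappa> w \<noteq> 0 \<Longrightarrow> p s < p w \<and> p w \<le> p t" if "w < n" for w
    using inv that unfolding exch_inv_def by auto
  have "0 \<le> \<kappa> w * gap p s w t" if "w < n" for w
  proof (cases "\<kappa> w = 0")
    case False
    then have w: "p s < p w" "p w \<le> p t" using supp[OF that] by auto
    have "0 \<le> gap p s w t"
    proof (cases "w = t")
      case True then show ?thesis using bvec_mv_ge[OF p s t st] unfolding gap_def by simp
    next
      case False
      then have "p w < p t" using w orderD[OF p that t] by force
      then show ?thesis using bvec_mv_out[OF p s that w(1) t] unfolding gap_def by simp
    qed
    then show ?thesis using nn[OF that] by simp
  qed simp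
  then show "0 \<le> \<delta>" unfolding \<delta>_def by (intro sum_nonneg) auto
  have z: "?y v = 0" if "v < n" "v \<noteq> t" "v \<noteq> s" for v
  proof (cases "p s < p v")
    case True then show ?thesis using inv that unfolding exch_inv_def by auto
  next
    case False
    then have v: "p v < p s" using orderD[OF p that(1) s] that by force
    have "\<kappa> w * gap p s w v = 0" if "w < n" for w
      using supp[OF that] bvec_mv_out[OF p s that _ \<open>v < n\<close>] v unfolding gap_def by auto
    then show ?thesis by (intro sum.neutral) auto
  qed
  have "(\<Sum>v<n. ?y v) = (\<Sum>w<n. \<kappa> w * (\<Sum>v<n. gap p s w v))"
    by (subst sum.swap) (simp add: sum_distrib_left)
  also have "\<dots> = 0"
  proof (intro sum.neutral ballI)
    fix w assume "w \<in> {..<n}"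
    then show "\<kappa> w * (\<Sum>v<n. gap p s w v) = 0"
      using supp[of w] sum_bvec_mv[OF p s, of w] unfolding gap_def by auto
  qed
  finally have "(\<Sum>v<n. ?y v) = 0" .
  moreover have "(\<Sum>v<n. ?y v) = ?y t + (?y s + (\<Sum>v\<in>{..<n} - {t} - {s}. ?y v))"
    using s t st by (subst sum.remove[of _ t], simp, simp, subst sum.remove[of _ s]) auto
  moreover have "(\<Sum>v\<in>{..<n} - {t} - {s}. ?y v) = 0" using z by (intro sum.neutral) auto
  ultimately have "?y s = - ?y t" by simp
  then show "?y v = (if v = t then \<delta> else if v = s then - \<delta> else 0)" if "v < n" for v
    using z[OF that] unfolding \<delta>_def by auto
qed

end

section \<open>Weighted orders, labels and optimality\<close>

definition xv :: "(nat \<Rightarrow> nat \<Rightarrow> int) \<Rightarrow> (nat \<Rightarrow> int) \<Rightarrow> nat \<Rightarrow> int" where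
  "xv pos lam v = (\<Sum>j<N. lam j * bvec (pos j) v)"

definition live :: "(nat \<Rightarrow> int) \<Rightarrow> nat set" where
  "live lam = {j. j < N \<and> 0 < lam j}"

lemma finite_live [simp]: "finite (live lam)" unfolding live_def by simp

text \<open>The order \<open>pos j\<close> is in use iff \<open>lam j > 0\<close>. As in push-relabel flow algorithms, \<open>d\<close> bounds from below
  the distance from the elements with positive \<open>x\<close> in the graph with an arc from \<open>u\<close> to \<open>v\<close>
  whenever \<open>u\<close> precedes \<open>v\<close> in an order in use.\<close>

definition valid :: "(nat \<Rightarrow> nat \<Rightarrow> int) \<Rightarrow> (nat \<Rightarrow> int) \<Rightarrow> (nat \<Rightarrow> int) \<Rightarrow> bool" where
  "valid pos lam d \<longleftrightarrow>
    (\<forall>j<N. 0 \<le> lam j) \<and> live lam \<noteq> {} \<and> (\<forall>j\<in>live lam. order (pos j)) \<and>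
    (\<forall>v<n. 0 \<le> d v \<and> d v \<le> int n) \<and>
    (\<forall>j\<in>live lam. \<forall>u<n. \<forall>v<n. pos j u < pos j v \<longrightarrow> d v \<le> d u + 1) \<and>
    (\<forall>v<n. 0 < xv pos lam v \<longrightarrow> d v = 0)"

definition active :: "(nat \<Rightarrow> nat \<Rightarrow> int) \<Rightarrow> (nat \<Rightarrow> int) \<Rightarrow> (nat \<Rightarrow> int) \<Rightarrow> nat \<Rightarrow> bool" where
  "active pos lam d v \<longleftrightarrow> v < n \<and> xv pos lam v < 0 \<and> d v < int n"

lemma sum_live: "(\<And>j. j < N \<Longrightarrow> 0 \<le> lam j) \<Longrightarrow> (\<Sum>j<N. lam j * f j) = (\<Sum>j\<in>live lam. lam j * f j)"
  by (rule sum.mono_neutral_right) (force simp: live_def order.strict_iff_order)+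

lemma sum_xv: "(\<Sum>v\<in>X. xv pos lam v) = (\<Sum>j<N. lam j * sum (bvec (pos j)) X)"
  unfolding xv_def by (subst sum.swap) (simp add: sum_distrib_left)

text \<open>With \<open>?s\<close> the total weight, \<open>x\<close> sums over any \<open>W\<close>
  to at most \<open>?s * (G W - G {})\<close>, with equality for \<open>U\<close>, which is an
  initial segment of every order in use. As \<open>U\<close> contains all negative elements of
  \<open>x\<close> and no positive one, no set has a smaller sum of \<open>x\<close>.\<close>

lemma minimiser_if_tight:
  assumes v: "valid pos lam d" and U: "U \<subseteq> {..<n}"
    and ideal: "\<And>j u v. j \<in> live lam \<Longrightarrow> v \<in> U \<Longrightarrow> u < n \<Longrightarrow> pos j u < pos j v \<Longrightarrow> u \<in> U"
    and neg: "\<And>v. v < n \<Longrightarrow> xv pos lam v < 0 \<Longrightarrow> v \<in> U" and pos: "\<And>v. v \<in> U \<Longrightarrow> xv pos lam v \<le> 0"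
    and W: "W \<subseteq> {..<n}"
  shows "G U \<le> G W"
proof -
  let ?x = "xv pos lam" and ?s = "\<Sum>j\<in>live lam. lam j"
  have nn: "\<And>j. j < N \<Longrightarrow> 0 \<le> lam j" and ord: "\<And>j. j \<in> live lam \<Longrightarrow> order (pos j)"
    and "live lam \<noteq> {}" using v unfolding valid_def by auto
  then have s: "0 < ?s" by (intro sum_pos) (auto simp: live_def)
  have fin: "finite U" "finite W" using U W finite_subset by blast+
  have "sum ?x U = (\<Sum>j\<in>live lam. lam j * sum (bvec (pos j)) U)" using sum_xv sum_live nn by simp
  also have "\<dots> = (\<Sum>j\<in>live lam. lam j * (G U - G {}))"
  proof (intro sum.cong refl)
    fix j assume "j \<in> live lam"
    then have "sum (bvec (pos j)) U = G U - G {}" using sum_bvec[OF ord U, of j] ideal[of j] by blast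
    then show "lam j * sum (bvec (pos j)) U = lam j * (G U - G {})" by simp
  qed
  also have "\<dots> = ?s * (G U - G {})" by (simp add: sum_distrib_right)
  finally have 1: "sum ?x U = ?s * (G U - G {})" .
  have "sum ?x W = (\<Sum>j\<in>live lam. lam j * sum (bvec (pos j)) W)" using sum_xv sum_live nn by simp
  also have "\<dots> \<le> (\<Sum>j\<in>live lam. lam j * (G W - G {}))"
    using sum_bvec[OF ord W] by (intro sum_mono mult_left_mono) (auto simp: live_def)
  also have "\<dots> = ?s * (G W - G {})" by (simp add: sum_distrib_right)
  finally have 2: "sum ?x W \<le> ?s * (G W - G {})" .
  have "sum ?x U = sum ?x (U \<inter> W) + sum ?x (U - W)" "sum ?x W = sum ?x (U \<inter> W) + sum ?x (W - U)"
    using sum.Int_Diff[OF fin(1), of ?x W] sum.Int_Diff[OF fin(2), of ?x U] by (simp_all only: Int_commute[of W U])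
  moreover have "sum ?x (U - W) \<le> 0" using pos by (intro sum_nonpos) auto
  moreover have "0 \<le> sum ?x (W - U)" using neg W by (intro sum_nonneg) force
  ultimately have "?s * (G U - G {}) \<le> ?s * (G W - G {})" using 1 2 by simp
  then show ?thesis using s by (simp add: mult_le_cancel_left)
qed

text \<open>Either \<open>x \<ge> 0\<close>, or some element has label \<open>n\<close> and the others leave one of the levels
  below \<open>n\<close> empty; the elements above the empty level form a tight set.\<close>

lemma level_minimiser:
  assumes v: "valid pos lam d" and na: "\<And>v. \<not> active pos lam d v"
  shows "\<exists>j\<le>n. \<forall>W\<subseteq>{..<n}. G {v. v < n \<and> int j < d v} \<le> G W"
proof -
  have d: "0 \<le> d v" "d v \<le> int n" if "v < n" for v using v that unfolding valid_def by auto
  have neg: "d v = int n" if "v < n" "xv pos lam v < 0" for v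
    using na[of v] that d[of v] unfolding active_def by force
  \<comment> \<open>If \<open>x \<ge> 0\<close>, then \<open>j = n\<close> describes the empty set,
    because labels never exceed \<open>n\<close>.\<close>
  have "\<exists>j\<le>n. (\<forall>v<n. d v \<noteq> int j) \<or> (j = n \<and> (\<forall>v<n. 0 \<le> xv pos lam v))"
  proof (cases "\<forall>v<n. 0 \<le> xv pos lam v")
    case False
    then obtain v0 where v0: "v0 < n" "xv pos lam v0 < 0" by force
    \<comment> \<open>\<open>v0\<close> has label \<open>n\<close>, and the other
      \<open>n - 1\<close> elements cannot occupy all \<open>n\<close> levels.\<close>
    have "\<not> {0..<int n} \<subseteq> d ` ({..<n} - {v0})"
    proof
      assume "{0..<int n} \<subseteq> d ` ({..<n} - {v0})"
      then have "card {0..<int n} \<le> card ({..<n} - {v0})" by (rule surj_card_le[rotated]) simp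
      then show False using v0 by simp
    qed
    then obtain k where "k \<in> {0..<int n}" and k3: "k \<notin> d ` ({..<n} - {v0})" by blast
    then have k: "0 \<le> k" "k < int n" by auto
    then have "d v \<noteq> int (nat k)" if "v < n" for v
      using neg[OF v0] that k k3 by (cases "v = v0") auto
    then show ?thesis using k by (intro exI[of _ "nat k"]) auto
  qed auto
  then obtain j where j: "j \<le> n" "(\<forall>v<n. d v \<noteq> int j) \<or> (j = n \<and> (\<forall>v<n. 0 \<le> xv pos lam v))" by blast
  let ?U = "{v. v < n \<and> int j < d v}"
  have "G ?U \<le> G W" if "W \<subseteq> {..<n}" for W
  proof (rule minimiser_if_tight[OF v _ _ _ _ that])
    fix i u w assume i: "i \<in> live lam" "w \<in> ?U" "u < n" "pos i u < pos i w"
    then have "d w \<le> d u + 1" using v unfolding valid_def by auto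
    then show "u \<in> ?U" using i j d[of w] by force
  next
    fix v assume "v < n" "xv pos lam v < 0"
    then show "v \<in> ?U" using neg[of v] j by force
  next
    fix w assume "w \<in> ?U"
    then show "xv pos lam w \<le> 0" using v j(1) unfolding valid_def by force
  qed auto
  then show ?thesis using j by blast
qed

section \<open>Relabelling and pushing\<close>

definition cand :: "(nat \<Rightarrow> nat \<Rightarrow> int) \<Rightarrow> (nat \<Rightarrow> int) \<Rightarrow> (nat \<Rightarrow> int) \<Rightarrow> nat \<Rightarrow> nat \<Rightarrow> bool" where
  "cand pos lam d t s \<longleftrightarrow> s < n \<and> d t = d s + 1 \<and> (\<exists>j\<in>live lam. pos j s < pos j t)"

text \<open>Without a candidate, each element before \<open>t\<close> in an order in use has a label
  at least \<open>d t\<close>, so one step up violates no arc; and \<open>x t < 0\<close>, so the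
  labels of positive elements are unaffected.\<close>

lemma valid_relabel:
  assumes v: "valid pos lam d" and t: "active pos lam d t" and nc: "\<And>s. \<not> cand pos lam d t s"
  shows "valid pos lam (d(t := d t + 1))"
proof -
  have *: "d t + 1 \<le> d u + 1" if "j \<in> live lam" "u < n" "pos j u < pos j t" for j u
  proof -
    have "d t \<le> d u + 1" using v that t unfolding valid_def active_def by auto
    then show ?thesis using nc[of u] that unfolding cand_def by force
  qed
  have "(d(t := d t + 1)) w \<le> (d(t := d t + 1)) u + 1"
    if "j \<in> live lam" "u < n" "w < n" "pos j u < pos j w" for j u w
  proof -
    have "d w \<le> d u + 1" using v that unfolding valid_def by blast
    then show ?thesis using *[of j u] that by (cases "w = t"; cases "u = t") auto
  qed
  moreover have "0 \<le> (d(t := d t + 1)) w \<and> (d(t := d t + 1)) w \<le> int n" if "w < n" for w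
    using v t that unfolding valid_def active_def by auto
  moreover have "(d(t := d t + 1)) w = 0" if "w < n" "0 < xv pos lam w" for w
    using v t that unfolding valid_def active_def by auto
  ultimately show ?thesis using v unfolding valid_def by blast
qed

text \<open>With \<open>(q, r) = (K, lam i)\<close> order \<open>i\<close> is replaced entirely by the moved orders; the other choice stops
  when \<open>x t\<close> reaches 0.\<close>

lemma valid_push:
  assumes v: "valid pos lam d"
    and free: "\<And>j. nx \<le> j \<Longrightarrow> j < N \<Longrightarrow> lam j = 0" and nx: "nx + n \<le> N"
    and i: "i \<in> live lam" and s: "s < n" and t: "t < n" and st: "pos i s < pos i t" "d t = d s + 1"
    and xt: "xv pos lam t < 0"
    and inv: "exch_inv (pos i) s t \<kappa> (pos i s)"
    and pos': "\<And>j. j < N \<Longrightarrow> pos' j = (if nx \<le> j \<and> j < nx + n then mv (pos i) s (j - nx) else pos j)"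
    and K: "K = (\<Sum>w<n. \<kappa> w)" and \<delta>: "\<delta> = (\<Sum>w<n. \<kappa> w * gap (pos i) s w t)"
    and qr: "(q, r) = (if K * xv pos lam t + lam i * \<delta> \<le> 0 then (K, lam i) else (\<delta>, - xv pos lam t))"
    and lam': "\<And>j. j < N \<Longrightarrow> lam' j = q * lam j - (if j = i then r * K else 0) +
        (if nx \<le> j \<and> j < nx + n then r * \<kappa> (j - nx) else 0)"
  shows "valid pos' lam' d"
    "\<And>v. v < n \<Longrightarrow> v \<noteq> t \<Longrightarrow> xv pos' lam' v < 0 \<Longrightarrow> v = s \<or> xv pos lam v < 0"
    "xv pos' lam' t \<le> 0" "xv pos' lam' t = 0 \<or> i \<notin> live lam'"
    "\<And>j. j \<in> live lam' \<Longrightarrow> (j \<in> live lam \<and> pos' j = pos j) \<or>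
       (\<exists>u<n. pos i s < pos i u \<and> pos i u \<le> pos i t \<and> pos' j = mv (pos i) s u)"
proof -
  have nn: "\<And>j. j < N \<Longrightarrow> 0 \<le> lam j" and ord: "\<And>j. j \<in> live lam \<Longrightarrow> order (pos j)"
    and dr: "\<And>v. v < n \<Longrightarrow> 0 \<le> d v \<and> d v \<le> int n"
    and arc: "\<And>j u v. j \<in> live lam \<Longrightarrow> u < n \<Longrightarrow> v < n \<Longrightarrow> pos j u < pos j v \<Longrightarrow> d v \<le> d u + 1"
    and P: "\<And>v. v < n \<Longrightarrow> 0 < xv pos lam v \<Longrightarrow> d v = 0" using v unfolding valid_def by auto
  note pi = ord[OF i]
  have iN: "i < N" "0 < lam i" "i < nx" using i free[of i] unfolding live_def by force+
  have K0: "0 < K" using inv K unfolding exch_inv_def by simp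
  have \<delta>0: "0 \<le> \<delta>" using exch_end(1)[OF pi s t st(1) inv] \<delta> by simp
  have y: "(\<Sum>w<n. \<kappa> w * gap (pos i) s w v) = (if v = t then \<delta> else if v = s then - \<delta> else 0)" if "v < n" for v
    using exch_end(2)[OF pi s t st(1) inv that] \<delta> by simp
  have \<kappa>: "0 \<le> \<kappa> w" "\<kappa> w \<noteq> 0 \<Longrightarrow> pos i s < pos i w \<and> pos i w \<le> pos i t" if "w < n" for w
    using inv that unfolding exch_inv_def by auto
  have "0 < q \<and> 0 < r \<and> r * K \<le> q * lam i \<and> q * xv pos lam t + r * \<delta> \<le> 0 \<and>
    (q * xv pos lam t + r * \<delta> = 0 \<or> r * K = q * lam i)"
  proof -
    consider "K * xv pos lam t + lam i * \<delta> \<le> 0" "q = K" "r = lam i"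
      | "K * xv pos lam t + lam i * \<delta> > 0" "q = \<delta>" "r = - xv pos lam t"
      using qr by (auto split: if_splits)
    then show ?thesis
    proof cases
      case 2
      \<comment> \<open>With \<open>\<delta> = 0\<close> the quantity assumed to be positive would
        reduce to this negative one.\<close>
      have "K * xv pos lam t < 0" using K0 xt by (simp add: mult_pos_neg)
      then have "\<delta> \<noteq> 0" using 2(1) by auto
      then have "0 < q" using \<delta>0 2 by simp
      moreover have "r * K \<le> q * lam i" using 2 by (simp add: algebra_simps)
      ultimately show ?thesis using 2 xt by simp
    qed (use K0 iN in \<open>auto simp: algebra_simps\<close>)
  qed
  then have q0: "0 < q" and r0: "0 < r" and full: "r * K \<le> q * lam i"
    and sat: "q * xv pos lam t + r * \<delta> \<le> 0" "q * xv pos lam t + r * \<delta> = 0 \<or> r * K = q * lam i" by auto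
  have lam_i: "lam' i = q * lam i - r * K" using lam'[OF iN(1)] iN by simp
  have nn': "0 \<le> lam' j" if "j < N" for j
    using lam'[OF that] nn[OF that] q0 r0 full \<kappa>(1)[of "j - nx"] iN by (auto split: if_splits)
  have cases': "(j \<in> live lam \<and> pos' j = pos j) \<or>
       (\<exists>u<n. pos i s < pos i u \<and> pos i u \<le> pos i t \<and> pos' j = mv (pos i) s u)" if j: "j \<in> live lam'" for j
  proof -
    have jN: "j < N" "0 < lam' j" using j unfolding live_def by auto
    show ?thesis
    proof (cases "nx \<le> j \<and> j < nx + n")
      case True
      then have "lam' j = r * \<kappa> (j - nx)" using lam'[OF jN(1)] free[of j] jN iN by auto
      then have "\<kappa> (j - nx) \<noteq> 0" using jN by auto
      then show ?thesis using \<kappa>(2)[of "j - nx"] True pos'[OF jN(1)] by (intro disjI2 exI[of _ "j - nx"]) auto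
    next
      case False
      then have "lam' j \<le> q * lam j" using lam'[OF jN(1)] r0 K0 by auto
      then have "0 < q * lam j" using jN by simp
      then have "0 < lam j" using q0 by (simp add: zero_less_mult_iff)
      then show ?thesis using False pos'[OF jN(1)] jN unfolding live_def by auto
    qed
  qed
  \<comment> \<open>The moved orders together carry exactly the weight \<open>r * K\<close> taken
    from order \<open>i\<close>, so, up to the scale \<open>q\<close>, \<open>x\<close> changes by
    \<open>r\<close> times the exchange vector.\<close>
  have x': "xv pos' lam' v = q * xv pos lam v + r * (if v = t then \<delta> else if v = s then - \<delta> else 0)" if vn: "v < n" for v
  proof -
    have "xv pos' lam' v = (\<Sum>j<N. q * (lam j * bvec (pos j) v) - (if j = i then r * K * bvec (pos i) v else 0) +
        (if nx \<le> j \<and> j < nx + n then r * \<kappa> (j - nx) * bvec (mv (pos i) s (j - nx)) v else 0))"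
      unfolding xv_def
    proof (intro sum.cong refl)
      fix j assume "j \<in> {..<N}"
      then have j: "j < N" by simp
      show "lam' j * bvec (pos' j) v = q * (lam j * bvec (pos j) v) - (if j = i then r * K * bvec (pos i) v else 0) +
        (if nx \<le> j \<and> j < nx + n then r * \<kappa> (j - nx) * bvec (mv (pos i) s (j - nx)) v else 0)"
      proof (cases "nx \<le> j \<and> j < nx + n")
        case True
        then have "lam' j = r * \<kappa> (j - nx)" "pos' j = mv (pos i) s (j - nx)" "lam j = 0" "j \<noteq> i"
          using lam'[OF j] pos'[OF j] free[of j] j iN by auto
        then show ?thesis using True by simp
      next
        case False
        then have "lam' j = q * lam j - (if j = i then r * K else 0)" "pos' j = pos j"
          using lam'[OF j] pos'[OF j] by auto
        then show ?thesis using False by (cases "j = i") (auto simp: left_diff_distrib mult.assoc)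
      qed
    qed
    also have "\<dots> = q * xv pos lam v - r * K * bvec (pos i) v +
        (\<Sum>j<N. (if nx \<le> j \<and> j < nx + n then r * \<kappa> (j - nx) * bvec (mv (pos i) s (j - nx)) v else 0))"
      using iN by (simp add: sum.distrib sum_subtractf xv_def sum_distrib_left sum.delta)
    also have "(\<Sum>j<N. (if nx \<le> j \<and> j < nx + n then r * \<kappa> (j - nx) * bvec (mv (pos i) s (j - nx)) v else 0))
      = (\<Sum>j\<in>{nx..<nx + n}. r * \<kappa> (j - nx) * bvec (mv (pos i) s (j - nx)) v)"
      using nx by (intro sum.mono_neutral_cong_right) auto
    also have "\<dots> = (\<Sum>w<n. r * \<kappa> w * bvec (mv (pos i) s w) v)"
      by (rule sum.reindex_bij_witness[of _ "\<lambda>w. w + nx" "\<lambda>j. j - nx"]) auto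
    also have "\<dots> = r * (\<Sum>w<n. \<kappa> w * gap (pos i) s w v) + r * K * bvec (pos i) v"
      unfolding K gap_def by (simp add: sum_distrib_left sum_distrib_right sum_subtractf algebra_simps)
    finally show ?thesis using y[OF vn] by simp
  qed
  show "xv pos' lam' t \<le> 0" using x'[OF t] sat by simp
  show "xv pos' lam' t = 0 \<or> i \<notin> live lam'" using x'[OF t] sat lam_i unfolding live_def by auto
  show "v = s \<or> xv pos lam v < 0" if "v < n" "v \<noteq> t" "xv pos' lam' v < 0" for v
  proof (cases "v = s")
    case False
    then have "q * xv pos lam v < 0" using x'[OF that(1)] that by simp
    then show ?thesis using q0 by (simp add: mult_less_0_iff)
  qed simp
  have d': "d v = 0" if "v < n" "0 < xv pos' lam' v" for v
  proof -
    have "v \<noteq> t" using that \<open>xv pos' lam' t \<le> 0\<close> by auto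
    then have "xv pos' lam' v \<le> q * xv pos lam v" using x'[OF that(1)] r0 \<delta>0 by auto
    then have "0 < q * xv pos lam v" using that by simp
    then show ?thesis using P[OF that(1)] q0 by (simp add: zero_less_mult_iff)
  qed
  have arc': "d b \<le> d a + 1" if j: "j \<in> live lam'" and ab: "a < n" "b < n" "pos' j a < pos' j b" for j a b
    using cases'[OF j]
  proof (elim disjE exE conjE)
    fix u assume u: "u < n" "pos i s < pos i u" "pos i u \<le> pos i t" "pos' j = mv (pos i) s u"
    \<comment> \<open>The only new arcs lead from \<open>u\<close> to elements of the segment from
      \<open>s\<close> up to \<open>u\<close>. Their labels are at most
      \<open>d s + 1 = d t\<close>, and \<open>d t \<le> d u + 1\<close> because \<open>u\<close>
      does not come after \<open>t\<close>.\<close>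
    consider "pos i a < pos i b" | "a = u" "pos i s \<le> pos i b" "pos i b < pos i u"
      using ab u(1,2) orderD[OF pi ab(2) u(1)] unfolding u(4) mv_def
      by (cases "pos i u < pos i b") (auto split: if_splits)
    then show ?thesis
    proof cases
      case 2
      have "d b \<le> d s + 1" using arc[OF i s ab(2)] 2 orderD[OF pi ab(2) s] by force
      moreover have "d t \<le> d u + 1" using arc[OF i u(1) t] u orderD[OF pi u(1) t] by force
      ultimately show ?thesis using 2 st by simp
    qed (use arc[OF i ab(1,2)] in auto)
  qed (use arc ab in auto)
  have ord': "order (pos' j)" if "j \<in> live lam'" for j
    using cases'[OF that] ord order_mv[OF pi s] by auto
  have "live lam' \<noteq> {}"
  proof -
    obtain w where w: "w < n" "\<kappa> w \<noteq> 0"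
      using K0 K by (metis lessThan_iff less_irrefl sum.neutral)
    have "lam' (nx + w) = r * \<kappa> w" using lam'[of "nx + w"] free[of "nx + w"] w nx iN by auto
    then have "0 < lam' (nx + w)" using r0 \<kappa>(1)[OF w(1)] w(2) by simp
    then show ?thesis using w nx unfolding live_def by force
  qed
  then show "valid pos' lam' d" unfolding valid_def using nn' ord' dr arc' d' by blast
  show "(j \<in> live lam \<and> pos' j = pos j) \<or>
       (\<exists>u<n. pos i s < pos i u \<and> pos i u \<le> pos i t \<and> pos' j = mv (pos i) s u)" if "j \<in> live lam'" for j
    using cases'[OF that] .
qed

section \<open>Bounding the number of orders in use\<close>

lemma live_reduce:
  assumes nn: "\<And>j. j < N \<Longrightarrow> 0 \<le> lam j"
    and sup: "\<And>j. j < N \<Longrightarrow> c j \<noteq> 0 \<Longrightarrow> 0 < lam j"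
    and k: "k < N" "0 < c k" and minr: "\<And>j. j < N \<Longrightarrow> 0 < c j \<Longrightarrow> lam k * c j \<le> lam j * c k"
    and lam': "\<And>j. j < N \<Longrightarrow> lam' j = c k * lam j - lam k * c j"
  shows "\<And>j. j < N \<Longrightarrow> 0 \<le> lam' j" "live lam' \<subseteq> live lam - {k}"
proof -
  show "0 \<le> lam' j" if j: "j < N" for j
  proof (cases "0 < c j")
    case True
    then show ?thesis using minr[OF j] lam'[OF j] by (simp add: mult.commute)
  next
    case False
    then have "lam k * c j \<le> 0" "0 \<le> c k * lam j" using nn[OF k(1)] nn[OF j] k(2)
      by (auto simp: mult_nonneg_nonpos)
    then show ?thesis using lam'[OF j] by simp
  qed
  have "0 < lam j" if j: "j < N" "0 < lam' j" for j
  proof (cases "c j = 0")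
    case True
    then have "0 < c k * lam j" using j lam'[OF j(1)] by simp
    then show ?thesis using k(2) by (simp add: zero_less_mult_iff)
  qed (use sup j in auto)
  moreover have "lam' k = 0" using lam'[OF k(1)] by simp
  ultimately show "live lam' \<subseteq> live lam - {k}" unfolding live_def by auto
qed

text \<open>A Caratheodory step: by the ratio test, the dependence \<open>c\<close> is subtracted
  with the largest multiple that keeps the weights nonnegative, so that order \<open>k\<close> drops
  out, and everything is multiplied by \<open>c k\<close>. As \<open>c\<close> sums to 0, the total
  weight stays positive and some order survives.\<close>

lemma valid_reduce:
  assumes v: "valid pos lam d"
    and sup: "\<And>j. j < N \<Longrightarrow> c j \<noteq> 0 \<Longrightarrow> 0 < lam j"
    and c0: "(\<Sum>j<N. c j) = 0" and cv: "\<And>v. v < n \<Longrightarrow> (\<Sum>j<N. c j * bvec (pos j) v) = 0"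
    and k: "k < N" "0 < c k" and minr: "\<And>j. j < N \<Longrightarrow> 0 < c j \<Longrightarrow> lam k * c j \<le> lam j * c k"
    and lam': "\<And>j. j < N \<Longrightarrow> lam' j = c k * lam j - lam k * c j"
  shows "valid pos lam' d" "\<And>v. v < n \<Longrightarrow> xv pos lam' v = c k * xv pos lam v"
    "live lam' \<subseteq> live lam - {k}"
proof -
  have nn: "\<And>j. j < N \<Longrightarrow> 0 \<le> lam j" using v unfolding valid_def by auto
  note L = live_reduce[where lam = lam and lam' = lam' and c = c and k = k, OF nn sup k minr lam']
  show x: "xv pos lam' w = c k * xv pos lam w" if "w < n" for w
  proof -
    have "xv pos lam' w = c k * xv pos lam w - lam k * (\<Sum>j<N. c j * bvec (pos j) w)"
      unfolding xv_def by (simp add: lam' sum_distrib_left sum_subtractf algebra_simps)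
    then show ?thesis using cv[OF that] by simp
  qed
  show l: "live lam' \<subseteq> live lam - {k}" using L(2) by blast
  have "(\<Sum>j<N. lam' j) = c k * (\<Sum>j<N. lam j) - lam k * (\<Sum>j<N. c j)"
    by (simp add: lam' sum_distrib_left sum_subtractf)
  moreover have "0 < (\<Sum>j<N. lam j)"
  proof -
    obtain j where "j < N" "0 < lam j" using v unfolding valid_def live_def by auto
    then show ?thesis using nn by (intro sum_pos2[of _ j]) auto
  qed
  ultimately have pos: "0 < (\<Sum>j<N. lam' j)" using c0 k(2) by simp
  have "live lam' \<noteq> {}"
  proof
    assume "live lam' = {}"
    then have "lam' j \<le> 0" if "j < N" for j using that unfolding live_def by force
    then have "(\<Sum>j<N. lam' j) \<le> 0" by (intro sum_nonpos) auto
    then show False using pos by simp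
  qed
  moreover have "d w = 0" if "w < n" "0 < xv pos lam' w" for w
    using v that x[OF that(1)] k(2) unfolding valid_def by (auto simp: zero_less_mult_iff)
  ultimately show "valid pos lam' d" using v l L(1) unfolding valid_def by blast
qed

text \<open>Row \<open>j\<close> of \<open>C\<close> holds the coefficients of a combination of the vectors \<open>bvec (pos i)\<close>, each
  extended by a last coordinate 1; the rows in \<open>al\<close> vanish in the coordinates below \<open>r\<close>.\<close>

definition hvec :: "(nat \<Rightarrow> nat \<Rightarrow> int) \<Rightarrow> nat \<Rightarrow> nat \<Rightarrow> int" where
  "hvec pos i r = (if r < n then bvec (pos i) r else 1)"

definition rowval :: "(nat \<Rightarrow> nat \<Rightarrow> int) \<Rightarrow> (nat \<Rightarrow> nat \<Rightarrow> int) \<Rightarrow> nat \<Rightarrow> nat \<Rightarrow> int" where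
  "rowval pos C j r = (\<Sum>i<N. C j i * hvec pos i r)"

text \<open>Each coordinate costs at most one row, so with more than \<open>n + 1\<close> orders a
  row survives all \<open>n + 1\<close> coordinates. The diagonal shape on \<open>al\<close>
  guarantees that surviving rows are not zero.\<close>

definition elim_inv :: "(nat \<Rightarrow> nat \<Rightarrow> int) \<Rightarrow> nat set \<Rightarrow> (nat \<Rightarrow> nat \<Rightarrow> int) \<Rightarrow> nat set \<Rightarrow> nat \<Rightarrow> bool" where
  "elim_inv pos L C al r \<longleftrightarrow> al \<subseteq> L \<and> card L \<le> card al + r \<and>
    (\<forall>j\<in>al. C j j \<noteq> 0 \<and> (\<forall>i\<in>al. i \<noteq> j \<longrightarrow> C j i = 0) \<and> (\<forall>i<N. i \<notin> L \<longrightarrow> C j i = 0) \<and>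
      (\<forall>r'<r. rowval pos C j r' = 0))"

lemma elim_start: "elim_inv pos L (\<lambda>j i. if i = j then 1 else 0) L 0"
  unfolding elim_inv_def by auto

lemma elim_skip:
  assumes "elim_inv pos L C al r" "\<And>j. j \<in> al \<Longrightarrow> rowval pos C j r = 0"
  shows "elim_inv pos L C al (Suc r)"
  using assms unfolding elim_inv_def by (auto simp: less_Suc_eq)

text \<open>Cross-multiplication with the pivot row cancels coordinate \<open>r\<close>. The
  diagonal entry of row \<open>j\<close> stays nonzero because the pivot row, itself a row in
  \<open>al\<close>, vanishes at \<open>j\<close>.\<close>

lemma elim_step:
  assumes inv: "elim_inv pos L C al r" and fin: "finite L" "L \<subseteq> {..<N}" and pv: "pv \<in> al" "rowval pos C pv r \<noteq> 0"
    and C': "\<And>j i. j \<in> al - {pv} \<Longrightarrow> i < N \<Longrightarrow> C' j i = rowval pos C pv r * C j i - rowval pos C j r * C pv i"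
  shows "elim_inv pos L C' (al - {pv}) (Suc r)"
proof -
  have al: "al \<subseteq> L" "card L \<le> card al + r" and
    C: "\<And>j. j \<in> al \<Longrightarrow> C j j \<noteq> 0" "\<And>j i. j \<in> al \<Longrightarrow> i \<in> al \<Longrightarrow> i \<noteq> j \<Longrightarrow> C j i = 0"
    "\<And>j i. j \<in> al \<Longrightarrow> i < N \<Longrightarrow> i \<notin> L \<Longrightarrow> C j i = 0" "\<And>j r'. j \<in> al \<Longrightarrow> r' < r \<Longrightarrow> rowval pos C j r' = 0"
    using inv unfolding elim_inv_def by auto
  have "card al = Suc (card (al - {pv}))" using pv al fin by (metis card.remove finite_subset)
  moreover have "rowval pos C' j r' = 0" if j: "j \<in> al - {pv}" and "r' < Suc r" for j r'
  proof -
    have "rowval pos C' j r' = rowval pos C pv r * rowval pos C j r' - rowval pos C j r * rowval pos C pv r'"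
    proof -
      have "rowval pos C' j r' = (\<Sum>i<N. rowval pos C pv r * (C j i * hvec pos i r') - rowval pos C j r * (C pv i * hvec pos i r'))"
        unfolding rowval_def[of _ C' j] using C'[OF j]
        by (intro sum.cong) (simp_all add: left_diff_distrib mult.assoc)
      then show ?thesis unfolding rowval_def[of _ _ _ r'] by (simp add: sum_subtractf sum_distrib_left)
    qed
    then show ?thesis using C(4)[of j r'] C(4)[OF pv(1), of r'] that by (cases "r' = r") auto
  qed
  ultimately show ?thesis unfolding elim_inv_def using al C C' pv fin(2) by (auto simp: subset_iff)
qed

text \<open>The coefficients sum to 0 by the appended coordinate 1, and the diagonal entry is
  nonzero, so some coefficient is positive, as the ratio test requires.\<close>

lemma elim_end:
  assumes inv: "elim_inv pos L C al (Suc n)" and j: "j \<in> al" and "L \<subseteq> {..<N}"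
  shows "(\<Sum>i<N. C j i) = 0" "\<And>v. v < n \<Longrightarrow> (\<Sum>i<N. C j i * bvec (pos i) v) = 0"
    "\<And>i. i < N \<Longrightarrow> C j i \<noteq> 0 \<Longrightarrow> i \<in> L" "\<exists>i<N. 0 < C j i"
proof -
  have C: "C j j \<noteq> 0" "\<And>i. i < N \<Longrightarrow> i \<notin> L \<Longrightarrow> C j i = 0" "\<And>r. r \<le> n \<Longrightarrow> rowval pos C j r = 0" "j < N"
    using inv assms unfolding elim_inv_def by (auto simp: subset_iff)
  show s: "(\<Sum>i<N. C j i) = 0" using C(3)[of n] unfolding rowval_def hvec_def by simp
  show "(\<Sum>i<N. C j i * bvec (pos i) v) = 0" if "v < n" for v
    using C(3)[of v] that unfolding rowval_def hvec_def by simp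
  show "i \<in> L" if "i < N" "C j i \<noteq> 0" for i using C that by auto
  show "\<exists>i<N. 0 < C j i"
  proof (rule ccontr)
    assume "\<not> ?thesis"
    then have "\<And>i. i < N \<Longrightarrow> 0 \<le> - C j i" by force
    moreover have "(\<Sum>i<N. - C j i) = 0" using s by (simp add: sum_negf)
    ultimately have "\<forall>i\<in>{..<N}. - C j i = 0" by (subst (asm) sum_nonneg_eq_0_iff) auto
    then show False using C by auto
  qed
qed

section \<open>Choice rules and the potential\<close>

definition topactive :: "(nat \<Rightarrow> nat \<Rightarrow> int) \<Rightarrow> (nat \<Rightarrow> int) \<Rightarrow> (nat \<Rightarrow> int) \<Rightarrow> nat \<Rightarrow> bool" where
  "topactive pos lam d t \<longleftrightarrow> active pos lam d t \<and>
    (\<forall>w<n. active pos lam d w \<longrightarrow> d w < d t \<or> d w = d t \<and> w \<le> t)"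

lemma topactive_exists:
  assumes "active pos lam d v"
  shows "\<exists>t. topactive pos lam d t"
proof -
  let ?A = "{v. active pos lam d v}"
  have fin: "finite ?A" by (rule finite_subset[of _ "{..<n}"]) (auto simp: active_def)
  let ?m = "Max (d ` ?A)"
  let ?B = "{v \<in> ?A. d v = ?m}"
  have "?m \<in> d ` ?A" using fin assms by (intro Max_in) auto
  then have B: "?B \<noteq> {}" "finite ?B" using fin by auto
  then have "Max ?B \<in> ?B" by (intro Max_in) auto
  moreover have "d w < ?m \<or> d w = ?m \<and> w \<le> Max ?B" if "active pos lam d w" for w
  proof (cases "d w = ?m")
    case True
    then have "w \<le> Max ?B" using B that by (intro Max_ge) auto
    then show ?thesis using True by simp
  next
    case False
    have "d w \<le> ?m" using fin that by (intro Max_ge) auto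
    then show ?thesis using False by simp
  qed
  ultimately show ?thesis unfolding topactive_def by (intro exI[of _ "Max ?B"]) auto
qed

lemma topactive_unique: "topactive pos lam d t \<Longrightarrow> topactive pos lam d t' \<Longrightarrow> t = t'"
proof -
  assume "topactive pos lam d t" "topactive pos lam d t'"
  then have "d t < d t' \<or> d t = d t' \<and> t \<le> t'" "d t' < d t \<or> d t' = d t \<and> t' \<le> t"
    unfolding topactive_def active_def by blast+
  then show "t = t'" by auto
qed

definition target :: "(nat \<Rightarrow> nat \<Rightarrow> int) \<Rightarrow> (nat \<Rightarrow> int) \<Rightarrow> (nat \<Rightarrow> int) \<Rightarrow> nat" where
  "target pos lam d = first N (topactive pos lam d)"

definition source :: "(nat \<Rightarrow> nat \<Rightarrow> int) \<Rightarrow> (nat \<Rightarrow> int) \<Rightarrow> (nat \<Rightarrow> int) \<Rightarrow> nat \<Rightarrow> nat" where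
  "source pos lam d t = first N (cand pos lam d t)"

definition widest :: "(nat \<Rightarrow> nat \<Rightarrow> int) \<Rightarrow> (nat \<Rightarrow> int) \<Rightarrow> nat \<Rightarrow> nat \<Rightarrow> nat \<Rightarrow> bool" where
  "widest pos lam s t i \<longleftrightarrow> i \<in> live lam \<and> (\<forall>j\<in>live lam. pos j t - pos j s \<le> pos i t - pos i s)"

lemma widest_exists:
  assumes "live lam \<noteq> {}"
  shows "\<exists>i. widest pos lam s t i"
proof -
  let ?h = "\<lambda>j. pos j t - pos j s"
  have "Max (?h ` live lam) \<in> ?h ` live lam" using assms by (intro Max_in) auto
  then obtain i where "i \<in> live lam" "Max (?h ` live lam) = ?h i" by auto
  moreover have "?h j \<le> Max (?h ` live lam)" if "j \<in> live lam" for j using that by (intro Max_ge) auto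
  ultimately show ?thesis unfolding widest_def by metis
qed

definition wide :: "(nat \<Rightarrow> nat \<Rightarrow> int) \<Rightarrow> (nat \<Rightarrow> int) \<Rightarrow> nat \<Rightarrow> nat \<Rightarrow> nat" where
  "wide pos lam s t = first N (widest pos lam s t)"

lemma target_topactive: assumes "active pos lam d v" shows "topactive pos lam d (target pos lam d)"
proof -
  obtain t where t: "topactive pos lam d t" using topactive_exists[OF assms] by blast
  then have "t < N" using n_le_N unfolding topactive_def active_def by simp
  then show ?thesis unfolding target_def using t by (rule_tac first_satisfies)
qed

lemma cand_source: assumes "cand pos lam d t s" shows "cand pos lam d t (source pos lam d t)"
proof -
  have "s < N" using assms n_le_N unfolding cand_def by simp
  then show ?thesis unfolding source_def using assms by (rule_tac first_satisfies)
qed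

lemma wide_widest: assumes "live lam \<noteq> {}" shows "widest pos lam s t (wide pos lam s t)"
proof -
  obtain i where i: "widest pos lam s t i" using widest_exists[OF assms] by blast
  then have "i < N" unfolding widest_def live_def by simp
  then show ?thesis unfolding wide_def using i by (rule_tac first_satisfies)
qed

definition lvl :: "(nat \<Rightarrow> int) \<Rightarrow> nat" where "lvl d = nat (\<Sum>v<n. int n - d v)"

definition rnk :: "(nat \<Rightarrow> int) \<Rightarrow> nat \<Rightarrow> nat" where
  "rnk d t = card {v. v < n \<and> (d v < d t \<or> d v = d t \<and> v \<le> t)}"

definition cands :: "(nat \<Rightarrow> nat \<Rightarrow> int) \<Rightarrow> (nat \<Rightarrow> int) \<Rightarrow> (nat \<Rightarrow> int) \<Rightarrow> nat \<Rightarrow> nat" where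
  "cands pos lam d t = card {s. cand pos lam d t s}"

text \<open>Without candidates \<open>source\<close> returns \<open>N\<close>, which is no element;
  the explicit 0 keeps the value within the range of a digit.\<close>

definition width :: "(nat \<Rightarrow> nat \<Rightarrow> int) \<Rightarrow> (nat \<Rightarrow> int) \<Rightarrow> (nat \<Rightarrow> int) \<Rightarrow> nat \<Rightarrow> nat" where
  "width pos lam d t = (if cands pos lam d t = 0 then 0 else
     let s = source pos lam d t; i = wide pos lam s t in nat (pos i t - pos i s))"

definition mult :: "(nat \<Rightarrow> nat \<Rightarrow> int) \<Rightarrow> (nat \<Rightarrow> int) \<Rightarrow> (nat \<Rightarrow> int) \<Rightarrow> nat \<Rightarrow> nat" where
  "mult pos lam d t = (if cands pos lam d t = 0 then 0 else
     let s = source pos lam d t; i = wide pos lam s t in card {j \<in> live lam. pos j t - pos j s = pos i t - pos i s})"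

text \<open>Relabelling decreases \<open>lvl\<close>. A push leaves the labels alone and decreases \<open>rnk\<close> if it makes \<open>x t\<close>
  vanish; otherwise it replaces an order of maximal width by narrower ones.\<close>

definition pot :: "(nat \<Rightarrow> nat \<Rightarrow> int) \<Rightarrow> (nat \<Rightarrow> int) \<Rightarrow> (nat \<Rightarrow> int) \<Rightarrow> nat" where
  "pot pos lam d = (let t = target pos lam d; K = n + 2 in
     (((lvl d * K + rnk d t) * K + cands pos lam d t) * K + width pos lam d t) * K + mult pos lam d t)"

lemma digit_less:
  fixes x x' y y' K :: nat
  assumes "x' < x \<or> x' = x \<and> y' < y" "y' < K"
  shows "x' * K + y' < x * K + y"
proof -
  have "x' * K + y' < x * K + y" if "x' < x"
  proof -
    have "x' * K + y' < Suc x' * K" using assms(2) by simp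
    also have "\<dots> \<le> x * K" using that by (intro mult_right_mono) auto
    finally show ?thesis by simp
  qed
  then show ?thesis using assms by auto
qed

lemma digits_less:
  fixes a a' b b' c c' e e' f f' K :: nat
  assumes "a' < a \<or> a' = a \<and> (b' < b \<or> b' = b \<and> (c' < c \<or> c' = c \<and> (e' < e \<or> e' = e \<and> f' < f)))"
    and "b' < K" "c' < K" "e' < K" "f' < K"
  shows "(((a' * K + b') * K + c') * K + e') * K + f' < (((a * K + b) * K + c) * K + e) * K + f"
proof -
  have 1: "a' * K + b' < a * K + b \<or> a' * K + b' = a * K + b \<and> (c' < c \<or> c' = c \<and> (e' < e \<or> e' = e \<and> f' < f))"
    using assms(1) digit_less[OF _ assms(2), of a' a b] by auto
  have 2: "(a' * K + b') * K + c' < (a * K + b) * K + c \<or>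
      (a' * K + b') * K + c' = (a * K + b) * K + c \<and> (e' < e \<or> e' = e \<and> f' < f)"
    using 1 digit_less[OF _ assms(3), of "a' * K + b'" "a * K + b" c] by auto
  have "((a' * K + b') * K + c') * K + e' < ((a * K + b) * K + c) * K + e \<or>
      ((a' * K + b') * K + c') * K + e' = ((a * K + b) * K + c) * K + e \<and> f' < f"
    using 2 digit_less[OF _ assms(4), of "(a' * K + b') * K + c'" "(a * K + b) * K + c" e] by auto
  then show ?thesis by (rule digit_less) (rule assms(5))
qed

lemma rnk_le: "rnk d t \<le> n"
proof -
  have "rnk d t \<le> card {..<n}" unfolding rnk_def by (intro card_mono) auto
  then show ?thesis by simp
qed

lemma cands_le: "cands pos lam d t \<le> n"
proof -
  have "cands pos lam d t \<le> card {..<n}" unfolding cands_def by (intro card_mono) (auto simp: cand_def)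
  then show ?thesis by simp
qed

lemma cands_pos: "cands pos lam d t \<noteq> 0 \<longleftrightarrow> (\<exists>s. cand pos lam d t s)"
proof -
  have "finite {s. cand pos lam d t s}" by (rule finite_subset[of _ "{..<n}"]) (auto simp: cand_def)
  then show ?thesis unfolding cands_def by auto
qed

lemma width_le:
  assumes "valid pos lam d" "t < n"
  shows "width pos lam d t \<le> n"
proof (cases "cands pos lam d t = 0")
  case False
  then obtain s0 where "cand pos lam d t s0" using cands_pos by blast
  then have s: "source pos lam d t < n" using cand_source unfolding cand_def by blast
  have "wide pos lam (source pos lam d t) t \<in> live lam"
    using wide_widest assms unfolding widest_def valid_def by blast
  then have "order (pos (wide pos lam (source pos lam d t) t))" using assms unfolding valid_def by blast
  then show ?thesis using order_range[of _ t] order_range[OF _ s] assms(2) False unfolding width_def Let_def by force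
qed (simp add: width_def)

lemma mult_le: "mult pos lam d t \<le> card (live lam)"
  unfolding mult_def Let_def by (auto intro: card_mono)

text \<open>Positional notation requires each lower digit to be below the base \<open>n + 2\<close>.
  For \<open>mult\<close> this rests on having at most \<open>n + 1\<close> orders in use, which is
  why every push is followed by reductions.\<close>

lemma pot_less:
  assumes v': "valid pos' lam' d'" and act: "active pos' lam' d' v" and L: "card (live lam') \<le> n + 1"
    and less: "lvl d' < lvl d \<or> lvl d' = lvl d \<and> (rnk d' (target pos' lam' d') < rnk d (target pos lam d) \<or>
      rnk d' (target pos' lam' d') = rnk d (target pos lam d) \<and>
      (cands pos' lam' d' (target pos' lam' d') < cands pos lam d (target pos lam d) \<or>
       cands pos' lam' d' (target pos' lam' d') = cands pos lam d (target pos lam d) \<and>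
      (width pos' lam' d' (target pos' lam' d') < width pos lam d (target pos lam d) \<or>
       width pos' lam' d' (target pos' lam' d') = width pos lam d (target pos lam d) \<and>
       mult pos' lam' d' (target pos' lam' d') < mult pos lam d (target pos lam d))))"
  shows "pot pos' lam' d' < pot pos lam d"
proof -
  have t: "target pos' lam' d' < n" using target_topactive[OF act] unfolding topactive_def active_def by blast
  show ?thesis
    unfolding pot_def Let_def
  proof (rule digits_less[OF less])
    show "rnk d' (target pos' lam' d') < n + 2" using rnk_le[of d' "target pos' lam' d'"] by simp
    show "cands pos' lam' d' (target pos' lam' d') < n + 2" using cands_le[of pos' lam' d' "target pos' lam' d'"] by simp
    show "width pos' lam' d' (target pos' lam' d') < n + 2" using width_le[OF v' t] by simp
    show "mult pos' lam' d' (target pos' lam' d') < n + 2" using mult_le[of pos' lam' d' "target pos' lam' d'"] L by simp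
  qed
qed

text \<open>The leading digit \<open>lvl\<close> is at most \<open>n * n\<close>, less than the
  square of the base, and four digits follow: hence the exponent 6.\<close>

lemma pot_bound:
  assumes v: "valid pos lam d" and act: "active pos lam d v" and L: "card (live lam) \<le> n + 1"
  shows "pot pos lam d < (n + 2) ^ 6"
proof -
  let ?K = "n + 2" and ?t = "target pos lam d"
  have t: "?t < n" using target_topactive[OF act] unfolding topactive_def active_def by blast
  have "(\<Sum>v<n. int n - d v) \<le> (\<Sum>v<n. int n)" using v unfolding valid_def by (intro sum_mono) auto
  also have "\<dots> = int (n * n)" by simp
  finally have "lvl d \<le> n * n" unfolding lvl_def by linarith
  then have "lvl d < ?K * ?K" by simp
  then have "pot pos lam d < (((?K * ?K * ?K + 0) * ?K + 0) * ?K + 0) * ?K + 0"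
    unfolding pot_def Let_def
    using rnk_le[of d ?t] cands_le[of pos lam d ?t] width_le[OF v t] mult_le[of pos lam d ?t] L
    by (intro digits_less disjI1) linarith+
  moreover have "(((k * k * k + 0) * k + 0) * k + 0) * k + 0 = k ^ 6" for k :: nat
    by (simp add: eval_nat_numeral mult.assoc)
  ultimately show ?thesis by (simp only:)
qed

lemma pot_relabel:
  assumes v: "valid pos lam d" and act: "active pos lam d v" and nc: "\<And>s. \<not> cand pos lam d t s"
    and t: "t = target pos lam d" and d': "d' = d(t := d t + 1)" and act': "active pos lam d' v'"
    and L: "card (live lam) \<le> n + 1"
  shows "pot pos lam d' < pot pos lam d"
proof -
  have at: "active pos lam d t" using target_topactive[OF act] unfolding t topactive_def by blast
  then have v': "valid pos lam d'" unfolding d' using valid_relabel[OF v _ nc] by blast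
  have tn: "t < n" "d t < int n" using at unfolding active_def by auto
  have "(\<Sum>v<n. int n - d' v) < (\<Sum>v<n. int n - d v)"
    unfolding d' using tn by (intro sum_strict_mono_ex1) auto
  moreover have "0 \<le> (\<Sum>v<n. int n - d' v)"
    unfolding d' using tn v unfolding valid_def by (intro sum_nonneg) auto
  ultimately have "lvl d' < lvl d" unfolding lvl_def by simp
  then show ?thesis by (intro pot_less[OF v' act' L]) simp
qed

text \<open>What the potential argument needs of a push, phrased so that it survives the subsequent
  reduction, which changes \<open>lam'\<close> but not \<open>pos'\<close>.\<close>

definition pushed where
  "pushed pos lam d s t i pos' lam' \<longleftrightarrow> valid pos' lam' d \<and>
    (\<forall>v<n. v \<noteq> t \<longrightarrow> xv pos' lam' v < 0 \<longrightarrow> v = s \<or> xv pos lam v < 0) \<and>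
    xv pos' lam' t \<le> 0 \<and> (xv pos' lam' t = 0 \<or> i \<notin> live lam') \<and>
    (\<forall>j\<in>live lam'. (j \<in> live lam \<and> pos' j = pos j) \<or>
       (\<exists>u<n. pos i s < pos i u \<and> pos i u \<le> pos i t \<and> pos' j = mv (pos i) s u))"

text \<open>A push can activate \<open>s\<close> only, which lies one level below \<open>t\<close>,
  so no active element ranks above \<open>t\<close> afterwards. If \<open>x t\<close> becomes 0, the
  next target has smaller rank. Otherwise order \<open>i\<close> is gone, \<open>t\<close> remains
  the target, and the number of candidates, the largest width or the number of orders attaining it
  goes down.\<close>

lemma pot_push:
  assumes v: "valid pos lam d" and act: "active pos lam d v"
    and t: "t = target pos lam d" and s: "s = source pos lam d t" and c: "cand pos lam d t s0"
    and i: "i = wide pos lam s t"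
    and push: "pushed pos lam d s t i pos' lam'" and act': "active pos' lam' d v'"
    and L: "card (live lam') \<le> n + 1"
  shows "pot pos' lam' d < pot pos lam d"
proof (rule pot_less[OF _ act' L])
  let ?t' = "target pos' lam' d"
  show v': "valid pos' lam' d" using push unfolding pushed_def by blast
  have top: "topactive pos lam d t" "topactive pos' lam' d ?t'"
    using target_topactive[OF act] target_topactive[OF act'] unfolding t by auto
  have cs: "cand pos lam d t s" using cand_source[OF c] s by simp
  then have sn: "s < n" "d t = d s + 1" unfolding cand_def by auto
  have tn: "t < n" "xv pos lam t < 0" using top(1) unfolding topactive_def active_def by auto
  have wi: "widest pos lam s t i" using wide_widest v i unfolding valid_def by blast
  then have i_live: "i \<in> live lam" unfolding widest_def by simp
  then have pi: "order (pos i)" using v unfolding valid_def by blast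
  have st: "pos i s < pos i t" using cs wi unfolding cand_def widest_def by force
  have act_sub: "active pos' lam' d w \<Longrightarrow> w \<noteq> t \<Longrightarrow> w = s \<or> active pos lam d w" for w
    using push unfolding pushed_def active_def by blast
  have below: "d w < d t \<or> d w = d t \<and> w < t" if "active pos' lam' d w" "w \<noteq> t" for w
    using act_sub[OF that] top(1) that sn unfolding topactive_def active_def by force
  show "lvl d < lvl d \<or> lvl d = lvl d \<and> (rnk d ?t' < rnk d (target pos lam d) \<or>
      rnk d ?t' = rnk d (target pos lam d) \<and>
      (cands pos' lam' d ?t' < cands pos lam d (target pos lam d) \<or>
       cands pos' lam' d ?t' = cands pos lam d (target pos lam d) \<and>
      (width pos' lam' d ?t' < width pos lam d (target pos lam d) \<or>
       width pos' lam' d ?t' = width pos lam d (target pos lam d) \<and>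
       mult pos' lam' d ?t' < mult pos lam d (target pos lam d))))"
  proof (cases "xv pos' lam' t < 0")
    case False
    then have "?t' \<noteq> t" using top(2) unfolding topactive_def active_def by auto
    then have b: "d ?t' < d t \<or> d ?t' = d t \<and> ?t' < t" using below top(2) unfolding topactive_def by blast
    have "{v. v < n \<and> (d v < d ?t' \<or> d v = d ?t' \<and> v \<le> ?t')} \<subset> {v. v < n \<and> (d v < d t \<or> d v = d t \<and> v \<le> t)}"
    proof
      show "{v. v < n \<and> (d v < d ?t' \<or> d v = d ?t' \<and> v \<le> ?t')} \<subseteq> {v. v < n \<and> (d v < d t \<or> d v = d t \<and> v \<le> t)}"
        using b by auto
      have "t \<in> {v. v < n \<and> (d v < d t \<or> d v = d t \<and> v \<le> t)}" using tn by simp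
      moreover have "t \<notin> {v. v < n \<and> (d v < d ?t' \<or> d v = d ?t' \<and> v \<le> ?t')}" using b by auto
      ultimately show "{v. v < n \<and> (d v < d ?t' \<or> d v = d ?t' \<and> v \<le> ?t')} \<noteq> {v. v < n \<and> (d v < d t \<or> d v = d t \<and> v \<le> t)}"
        by blast
    qed
    then have "rnk d ?t' < rnk d t" unfolding rnk_def by (intro psubset_card_mono) auto
    then show ?thesis using t by simp
  next
    case True
    then have at: "active pos' lam' d t" using top(1) unfolding topactive_def active_def by simp
    then have "topactive pos' lam' d t" unfolding topactive_def using below by force
    then have t': "?t' = t" using topactive_unique top(2) by blast
    have i_dead: "i \<notin> live lam'" using push True unfolding pushed_def by auto
    have new: "(j \<in> live lam \<and> pos' j = pos j \<and> j \<noteq> i) \<or>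
       (\<exists>u<n. pos i s < pos i u \<and> pos i u \<le> pos i t \<and> pos' j = mv (pos i) s u)" if "j \<in> live lam'" for j
      using push i_dead that unfolding pushed_def by blast
    \<comment> \<open>A move only brings \<open>u\<close> forward, and \<open>u\<close> does not
      come after \<open>t\<close>; so whatever precedes \<open>t\<close> in a moved order preceded
      it in order \<open>i\<close>.\<close>
    have csub: "cand pos lam d t w" if "cand pos' lam' d t w" for w
    proof -
      obtain j where j: "j \<in> live lam'" "pos' j w < pos' j t" and w: "w < n" "d t = d w + 1"
        using \<open>cand pos' lam' d t w\<close> unfolding cand_def by auto
      have "\<exists>j\<in>live lam. pos j w < pos j t"
        using new[OF j(1)]
      proof (elim disjE exE conjE)
        fix u assume u: "u < n" "pos i s < pos i u" "pos i u \<le> pos i t" "pos' j = mv (pos i) s u"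
        have "pos i w < pos i t"
          using j(2) u orderD[OF pi u(1) tn(1)] unfolding u(4) mv_def by (force split: if_splits)
        then show ?thesis using i_live by blast
      qed (use j in auto)
      then show ?thesis using w unfolding cand_def by blast
    qed
    have fin: "finite {w. cand pos lam d t w}" by (rule finite_subset[of _ "{..<n}"]) (auto simp: cand_def)
    have le: "cands pos' lam' d t \<le> cands pos lam d t"
      unfolding cands_def using csub fin by (intro card_mono) auto
    show ?thesis
    proof (cases "cands pos' lam' d t = cands pos lam d t")
      case False
      then show ?thesis using le t t' by simp
    next
      case eq: True
      then have "{w. cand pos' lam' d t w} = {w. cand pos lam d t w}"
        unfolding cands_def using csub fin by (intro card_subset_eq) auto
      then have "cand pos' lam' d t = cand pos lam d t" by (auto simp: fun_eq_iff set_eq_iff)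
      then have s': "source pos' lam' d t = s" unfolding s source_def by simp
      have c0: "cands pos lam d t \<noteq> 0" using cs cands_pos by blast
      let ?i = "wide pos' lam' s t"
      have wi': "widest pos' lam' s t ?i" using wide_widest v' unfolding valid_def by blast
      \<comment> \<open>Moving \<open>u\<close> shifts \<open>s\<close> one place back, while
        \<open>t\<close> keeps its place or, if it is \<open>u\<close>, comes to the front of the
        segment; so every moved order is narrower.\<close>
      have h: "pos' j t - pos' j s < pos i t - pos i s \<or>
          j \<in> live lam \<and> j \<noteq> i \<and> pos' j = pos j \<and> pos' j t - pos' j s \<le> pos i t - pos i s" if "j \<in> live lam'" for j
        using new[OF that]
      proof (elim disjE exE conjE)
        assume "j \<in> live lam" "pos' j = pos j" "j \<noteq> i"
        then show ?thesis using wi unfolding widest_def by auto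
      next
        fix u assume u: "u < n" "pos i s < pos i u" "pos i u \<le> pos i t" "pos' j = mv (pos i) s u"
        have "s \<noteq> u" "s < n" using u sn by auto
        then have "pos' j t - pos' j s < pos i t - pos i s"
          using u st orderD[OF pi u(1) tn(1)] unfolding u(4) mv_def by (auto split: if_splits)
        then show ?thesis ..
      qed
      have "?i \<in> live lam'" using wi' unfolding widest_def by simp
      then have hle: "pos' ?i t - pos' ?i s \<le> pos i t - pos i s" using h by force
      have w: "width pos' lam' d t = nat (pos' ?i t - pos' ?i s)" "width pos lam d t = nat (pos i t - pos i s)"
        using c0 eq s s' i unfolding width_def Let_def by auto
      have m: "mult pos' lam' d t = card {j \<in> live lam'. pos' j t - pos' j s = pos' ?i t - pos' ?i s}"
        "mult pos lam d t = card {j \<in> live lam. pos j t - pos j s = pos i t - pos i s}"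
        using c0 eq s s' i unfolding mult_def Let_def by auto
      show ?thesis
      proof (cases "pos' ?i t - pos' ?i s = pos i t - pos i s")
        case False
        then have "width pos' lam' d t < width pos lam d t" using w hle st by simp
        then show ?thesis using eq t t' by simp
      next
        case True
        have "{j \<in> live lam'. pos' j t - pos' j s = pos' ?i t - pos' ?i s} \<subseteq>
          {j \<in> live lam. pos j t - pos j s = pos i t - pos i s} - {i}" using h True by force
        moreover have "i \<in> {j \<in> live lam. pos j t - pos j s = pos i t - pos i s}" using i_live by simp
        ultimately have "{j \<in> live lam'. pos' j t - pos' j s = pos' ?i t - pos' ?i s} \<subset>
          {j \<in> live lam. pos j t - pos j s = pos i t - pos i s}" by blast
        then have "mult pos' lam' d t < mult pos lam d t" unfolding m by (intro psubset_card_mono) auto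
        moreover have "width pos' lam' d t = width pos lam d t" using w True by simp
        ultimately show ?thesis using eq t t' by simp
      qed
    qed
  qed
qed

end

section \<open>The minimisation program\<close>

instantiation ex :: "{zero, one, plus, minus, times}"
begin
definition "0 = Lit 0"
definition "1 = Lit 1"
definition "a + b = Pls a b"
definition "a - b = Mns a b"
definition "a * b = Tms a b"
instance ..
end

lemma ev_arith [simp]:
  "ev n N F \<sigma> \<rho> 0 = 0" "ev n N F \<sigma> \<rho> 1 = 1"
  "ev n N F \<sigma> \<rho> (a + b) = ev n N F \<sigma> \<rho> a + ev n N F \<sigma> \<rho> b"
  "ev n N F \<sigma> \<rho> (a - b) = ev n N F \<sigma> \<rho> a - ev n N F \<sigma> \<rho> b"
  "ev n N F \<sigma> \<rho> (a * b) = ev n N F \<sigma> \<rho> a * ev n N F \<sigma> \<rho> b"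
  by (simp_all add: zero_ex_def one_ex_def plus_ex_def minus_ex_def times_ex_def)

text \<open>\<open>Ite\<close> only compares with \<open><\<close>, so the test for a nonzero value
  takes two of them.\<close>

definition IfE :: "ex \<Rightarrow> ex \<Rightarrow> ex \<Rightarrow> ex" where "IfE c a b = Ite c 0 a (Ite 0 c a b)"
definition LtE :: "ex \<Rightarrow> ex \<Rightarrow> ex" where "LtE a b = Ite a b 1 0"
definition LeE :: "ex \<Rightarrow> ex \<Rightarrow> ex" where "LeE a b = Ite b a 0 1"
definition EqE :: "ex \<Rightarrow> ex \<Rightarrow> ex" where "EqE a b = IfE (a - b) 0 1"
definition NotE :: "ex \<Rightarrow> ex" where "NotE a = IfE a 0 1"
definition ImpE :: "ex \<Rightarrow> ex \<Rightarrow> ex" where "ImpE a b = IfE a (IfE b 1 0) 1"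
definition ExE :: "nat \<Rightarrow> ex \<Rightarrow> ex" where "ExE v a = LtE 0 (Summ v (IfE a 1 0))"
definition AllE :: "nat \<Rightarrow> ex \<Rightarrow> ex" where "AllE v a = NotE (ExE v (NotE a))"
definition SumE :: "nat \<Rightarrow> ex \<Rightarrow> ex" where "SumE v a = Summ v (IfE (LtE (Var v) Dim) a 0)"

lemma ev_logic [simp]:
  "ev n N F \<sigma> \<rho> (IfE c a b) = (if ev n N F \<sigma> \<rho> c \<noteq> 0 then ev n N F \<sigma> \<rho> a else ev n N F \<sigma> \<rho> b)"
  "ev n N F \<sigma> \<rho> (LtE a b) = of_bool (ev n N F \<sigma> \<rho> a < ev n N F \<sigma> \<rho> b)"
  "ev n N F \<sigma> \<rho> (LeE a b) = of_bool (ev n N F \<sigma> \<rho> a \<le> ev n N F \<sigma> \<rho> b)"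
  "ev n N F \<sigma> \<rho> (EqE a b) = of_bool (ev n N F \<sigma> \<rho> a = ev n N F \<sigma> \<rho> b)"
  "ev n N F \<sigma> \<rho> (NotE a) = of_bool (ev n N F \<sigma> \<rho> a = 0)"
  "ev n N F \<sigma> \<rho> (ImpE a b) = of_bool (ev n N F \<sigma> \<rho> a \<noteq> 0 \<longrightarrow> ev n N F \<sigma> \<rho> b \<noteq> 0)"
  by (auto simp: IfE_def LtE_def LeE_def EqE_def NotE_def ImpE_def)

declare if_weak_cong [cong del]

lemma ev_Exi [simp]: "ev n N F \<sigma> \<rho> (ExE v a) = of_bool (\<exists>i<N. ev n N F \<sigma> (\<rho>(v := i)) a \<noteq> 0)"
proof -
  have "(\<Sum>i<N. (if P i then 1 else 0)) = int (card {i. i < N \<and> P i})" for P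
    by (simp add: sum.If_cases Collect_conj_eq lessThan_def)
  then have "0 < (\<Sum>i<N. (if P i then 1 else (0::int))) \<longleftrightarrow> (\<exists>i<N. P i)" for P
    by (simp add: card_gt_0_iff)
  from this[of "\<lambda>i. ev n N F \<sigma> (\<rho>(v := i)) a \<noteq> 0"] show ?thesis by (simp add: ExE_def)
qed

lemma ev_All [simp]: "ev n N F \<sigma> \<rho> (AllE v a) = of_bool (\<forall>i<N. ev n N F \<sigma> (\<rho>(v := i)) a \<noteq> 0)"
  by (auto simp: AllE_def)

lemma ev_Sumn [simp]:
  assumes "n \<le> N"
  shows "ev n N F \<sigma> \<rho> (SumE v a) = (\<Sum>i<n. ev n N F \<sigma> (\<rho>(v := i)) a)"
  unfolding SumE_def using assms by (simp, intro sum.mono_neutral_cong_right) auto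

abbreviation A1 :: "nat \<Rightarrow> ex \<Rightarrow> ex" where "A1 a \<equiv> Arr a 0"
abbreviation A0 :: "nat \<Rightarrow> ex" where "A0 a \<equiv> Arr a 0 0"

primrec writes :: "pr \<Rightarrow> nat set" where
  "writes (Asg a i j e) = {a}"
| "writes (Then c d) = writes c \<union> writes d"
| "writes (Cond a b c d) = writes c \<union> writes d"
| "writes (Rep c) = writes c"

lemma run_frame: "a \<notin> writes c \<Longrightarrow> run n N F c \<sigma> a = \<sigma> a"
proof (induction c arbitrary: \<sigma>)
  case (Rep c)
  then have "((run n N F c) ^^ k) \<sigma> a = \<sigma> a" for k by (induction k) auto
  then show ?case by simp
qed auto

text \<open>A scalar is an array with equal entries, read in position \<open>(0, 0)\<close>; a vector is an array with equal rows,
  read in row 0.\<close>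

abbreviation r_inc :: nat where "r_inc \<equiv> 28"
abbreviation r_exc :: nat where "r_exc \<equiv> 29"
abbreviation r_pos :: nat where "r_pos \<equiv> 2"
abbreviation r_lam :: nat where "r_lam \<equiv> 3"
abbreviation r_dist :: nat where "r_dist \<equiv> 4"
abbreviation r_next :: nat where "r_next \<equiv> 5"
abbreviation r_bvec :: nat where "r_bvec \<equiv> 6"
abbreviation r_x :: nat where "r_x \<equiv> 7"
abbreviation r_target :: nat where "r_target \<equiv> 8"
abbreviation r_source :: nat where "r_source \<equiv> 9"
abbreviation r_order :: nat where "r_order \<equiv> 10"
abbreviation r_kap :: nat where "r_kap \<equiv> 11"
abbreviation r_place :: nat where "r_place \<equiv> 12"
abbreviation r_elem :: nat where "r_elem \<equiv> 13"
abbreviation r_ksum :: nat where "r_ksum \<equiv> 14"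
abbreviation r_delta :: nat where "r_delta \<equiv> 15"
abbreviation r_scale :: nat where "r_scale \<equiv> 16"
abbreviation r_amount :: nat where "r_amount \<equiv> 17"
abbreviation r_coef :: nat where "r_coef \<equiv> 18"
abbreviation r_alive :: nat where "r_alive \<equiv> 19"
abbreviation r_col :: nat where "r_col \<equiv> 20"
abbreviation r_pivot :: nat where "r_pivot \<equiv> 21"
abbreviation r_row :: nat where "r_row \<equiv> 22"
abbreviation r_min :: nat where "r_min \<equiv> 23"
abbreviation r_index :: nat where "r_index \<equiv> 24"
abbreviation r_sets :: nat where "r_sets \<equiv> 25"
abbreviation r_vals :: nat where "r_vals \<equiv> 26"
abbreviation r_level :: nat where "r_level \<equiv> 27"

text \<open>The oracle for \<open>F ((X \<union> inc) - exc)\<close>: minimising over an interval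
  becomes unconstrained minimisation of another submodular function. Exclusion takes precedence over
  inclusion.\<close>

definition Orcm :: "nat \<Rightarrow> ex \<Rightarrow> ex" where
  "Orcm v a = Orc v (IfE (A1 r_exc (Var v)) 0 (IfE (A1 r_inc (Var v)) 1 a))"

text \<open>\<open>pr\<close> has no empty statement. Overwriting \<open>r_elem\<close> is harmless,
  since it is read only right after it has been set.\<close>

definition skip :: pr where "skip = Asg r_elem 0 1 0"

definition c_bvec :: pr where
  "c_bvec = Asg r_bvec 0 1 (Orcm 2 (LeE (Arr r_pos (Var 0) (Var 2)) (Arr r_pos (Var 0) (Var 1)))
     - Orcm 2 (LtE (Arr r_pos (Var 0) (Var 2)) (Arr r_pos (Var 0) (Var 1))))"

definition c_x :: pr where
  "c_x = Asg r_x 0 1 (Summ 2 (A1 r_lam (Var 2) * Arr r_bvec (Var 2) (Var 1)))"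

definition Act :: "nat \<Rightarrow> ex" where
  "Act v = LtE (Var v) Dim * LtE (A1 r_x (Var v)) 0 * LtE (A1 r_dist (Var v)) Dim"

definition c_target :: pr where
  "c_target = Asg r_target 0 1 (Mu 2 (Act 2 * AllE 3 (ImpE (Act 3)
     (IfE (LtE (A1 r_dist (Var 3)) (A1 r_dist (Var 2))) 1
       (EqE (A1 r_dist (Var 3)) (A1 r_dist (Var 2)) * LeE (Var 3) (Var 2))))))"

definition Cand :: ex where
  "Cand = LtE (Var 2) Dim * EqE (A1 r_dist (A0 r_target)) (A1 r_dist (Var 2) + 1) *
     ExE 3 (LtE 0 (A1 r_lam (Var 3)) * LtE (Arr r_pos (Var 3) (Var 2)) (Arr r_pos (Var 3) (A0 r_target)))"

definition c_source :: pr where "c_source = Asg r_source 0 1 (Mu 2 Cand)"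

definition c_relabel :: pr where
  "c_relabel = Asg r_dist 0 1 (A1 r_dist (Var 1) + EqE (Var 1) (A0 r_target))"

definition Wdt :: "ex \<Rightarrow> ex" where
  "Wdt j = Arr r_pos j (A0 r_target) - Arr r_pos j (A0 r_source)"

definition c_wide :: pr where
  "c_wide = Asg r_order 0 1 (Mu 2 (LtE 0 (A1 r_lam (Var 2)) * AllE 3 (ImpE (LtE 0 (A1 r_lam (Var 3))) (LeE (Wdt (Var 3)) (Wdt (Var 2))))))"

definition Fresh :: "ex \<Rightarrow> ex" where
  "Fresh j = LeE (A0 r_next) j * LtE j (A0 r_next + Dim)"

text \<open>The order in which \<open>u\<close> is moved is stored in row \<open>r_next + u\<close>. Rows are never reused, which
  is affordable since the number of pushes is polynomially bounded.\<close>

definition c_move :: pr where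
  "c_move = Asg r_pos 0 1 (IfE (Fresh (Var 0))
     (IfE (EqE (A0 r_next + Var 1) (Var 0)) (Arr r_pos (A0 r_order) (A0 r_source))
       (IfE (LtE (Var 1) Dim * LeE (Arr r_pos (A0 r_order) (A0 r_source)) (Arr r_pos (A0 r_order) (Var 1)) *
             LtE (Arr r_pos (A0 r_order) (Var 1)) (Arr r_pos (A0 r_order) (Var 0 - A0 r_next)))
         (Arr r_pos (A0 r_order) (Var 1) + 1) (Arr r_pos (A0 r_order) (Var 1))))
     (Arr r_pos (Var 0) (Var 1)))"

definition Gap :: "ex \<Rightarrow> ex \<Rightarrow> ex" where
  "Gap u v = Arr r_bvec (A0 r_next + u) v - Arr r_bvec (A0 r_order) v"

definition c_exch_start :: pr where
  "c_exch_start = Then (Asg r_kap 0 1 (EqE (Var 1) (A0 r_target))) (Asg r_place 0 1 (Arr r_pos (A0 r_order) (A0 r_target) - 1))"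

text \<open>Positions are visited downwards from \<open>t\<close>. Once \<open>r_place\<close> has
  reached the position of the source, the guard fails and the remaining rounds idle.\<close>

definition c_exch_step :: pr where
  "c_exch_step = Cond (Arr r_pos (A0 r_order) (A0 r_source)) (A0 r_place)
     (Then (Asg r_elem 0 1 (Mu 2 (LtE (Var 2) Dim * EqE (Arr r_pos (A0 r_order) (Var 2)) (A0 r_place))))
     (Then (Asg r_kap 0 1 (IfE (Gap (A0 r_elem) (A0 r_elem))
              (IfE (EqE (Var 1) (A0 r_elem)) (0 - SumE 2 (A1 r_kap (Var 2) * Gap (Var 2) (A0 r_elem)))
                 (A1 r_kap (Var 1) * Gap (A0 r_elem) (A0 r_elem)))
              (EqE (Var 1) (A0 r_elem))))
       (Asg r_place 0 1 (A0 r_place - 1))))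
     skip"

definition Full :: ex where
  "Full = LeE (A0 r_ksum * A1 r_x (A0 r_target) + A1 r_lam (A0 r_order) * A0 r_delta) 0"

definition c_weights :: pr where
  "c_weights = Then (Asg r_ksum 0 1 (SumE 2 (A1 r_kap (Var 2))))
    (Then (Asg r_delta 0 1 (SumE 2 (A1 r_kap (Var 2) * Gap (Var 2) (A0 r_target))))
    (Then (Asg r_scale 0 1 (IfE Full (A0 r_ksum) (A0 r_delta)))
    (Then (Asg r_amount 0 1 (IfE Full (A1 r_lam (A0 r_order)) (0 - A1 r_x (A0 r_target))))
    (Then (Asg r_lam 0 1 (A0 r_scale * A1 r_lam (Var 1) - IfE (EqE (Var 1) (A0 r_order)) (A0 r_amount * A0 r_ksum) 0 +
              IfE (Fresh (Var 1)) (A0 r_amount * A1 r_kap (Var 1 - A0 r_next)) 0))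
       (Asg r_next 0 1 (A0 r_next + Dim))))))"

definition c_push :: pr where
  "c_push = Then c_wide (Then c_move (Then c_bvec (Then c_exch_start (Then (Rep c_exch_step) c_weights))))"

definition Row :: "ex \<Rightarrow> ex" where
  "Row j = Summ 3 (Arr r_coef j (Var 3) * IfE (LtE (A0 r_col) Dim) (Arr r_bvec (Var 3) (A0 r_col)) 1)"

definition c_elim :: pr where
  "c_elim = Cond (A0 r_col) (Dim + 1)
     (Then (Cond 0 (ExE 2 (A1 r_alive (Var 2) * Row (Var 2)))
        (Then (Asg r_pivot 0 1 (Mu 2 (A1 r_alive (Var 2) * Row (Var 2))))
        (Then (Asg r_coef 0 1 (IfE (A1 r_alive (Var 0) * NotE (EqE (Var 0) (A0 r_pivot)))
                 (Row (A0 r_pivot) * Arr r_coef (Var 0) (Var 1) - Row (Var 0) * Arr r_coef (A0 r_pivot) (Var 1))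
                 (Arr r_coef (Var 0) (Var 1))))
              (Asg r_alive 0 1 (IfE (EqE (Var 1) (A0 r_pivot)) 0 (A1 r_alive (Var 1))))))
        skip)
       (Asg r_col 0 1 (A0 r_col + 1)))
     skip"

definition c_reduce :: pr where
  "c_reduce = Then (Asg r_coef 0 1 (EqE (Var 1) (Var 0)))
    (Then (Asg r_alive 0 1 (LtE 0 (A1 r_lam (Var 1))))
    (Then (Asg r_col 0 1 0)
    (Then (Rep c_elim)
      (Cond 0 (ExE 2 (A1 r_alive (Var 2)))
        (Then (Asg r_row 0 1 (Mu 2 (A1 r_alive (Var 2))))
        (Then (Asg r_min 0 1 (Mu 2 (LtE 0 (Arr r_coef (A0 r_row) (Var 2)) * AllE 3 (ImpE (LtE 0 (Arr r_coef (A0 r_row) (Var 3)))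
                 (LeE (A1 r_lam (Var 2) * Arr r_coef (A0 r_row) (Var 3)) (A1 r_lam (Var 3) * Arr r_coef (A0 r_row) (Var 2)))))))
          (Asg r_lam 0 1 (Arr r_coef (A0 r_row) (A0 r_min) * A1 r_lam (Var 1) - A1 r_lam (A0 r_min) * Arr r_coef (A0 r_row) (Var 1)))))
        skip))))"

definition c_step :: pr where
  "c_step = Then c_bvec (Then c_x (Cond 0 (ExE 2 (Act 2))
     (Then c_target (Cond 0 (ExE 2 Cand) (Then c_source (Then c_push (Rep c_reduce))) c_relabel))
     skip))"

definition c_init :: pr where
  "c_init = Then (Asg r_pos 0 1 (Var 1)) (Then (Asg r_lam 0 1 (EqE (Var 1) 0)) (Then (Asg r_dist 0 1 0) (Asg r_next 0 1 1)))"

definition Lev :: "ex \<Rightarrow> ex" where "Lev j = Orcm 3 (LtE j (A1 r_dist (Var 3)))"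

text \<open>All \<open>n + 1\<close> level sets are compared through the oracle, which avoids having
  to know which level is empty or whether \<open>x \<ge> 0\<close>.\<close>

definition c_best :: pr where
  "c_best = Asg r_level 0 1 (Mu 2 (LeE (Var 2) Dim * AllE 4 (ImpE (LeE (Var 4) Dim) (LeE (Lev (Var 2)) (Lev (Var 4))))))"

definition c_sfm :: pr where "c_sfm = Then c_init (Then (Rep c_step) c_best)"

lemmas c_defs = skip_def c_bvec_def c_x_def c_target_def c_source_def c_relabel_def c_wide_def c_move_def
  c_exch_start_def c_exch_step_def c_weights_def c_push_def c_elim_def c_reduce_def c_step_def c_init_def
  c_best_def c_sfm_def

section \<open>The program follows the abstract algorithm\<close>

lemma first_cong: "(\<And>i. i < N \<Longrightarrow> P i = Q i) \<Longrightarrow> first N P = first N Q"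
  unfolding first_def by (metis (mono_tags, lifting))

text \<open>The potential admits at most \<open>(n + 2) ^ 6\<close> steps, each using up to
  \<open>n\<close> new rows besides the initial one, and the main loop needs more than
  \<open>(n + 2) ^ 6\<close> rounds.\<close>

locale sfm = submodular_fun n N G for n N G +
  fixes F :: "nat set \<Rightarrow> int"
  assumes N_large: "(n + 1) * (n + 2) ^ 6 + n + 2 \<le> N"
begin

lemma N_gt: "n + 1 < N" using N_large by simp

abbreviation "E \<equiv> ev n N F"
abbreviation "R \<equiv> run n N F"

text \<open>\<open>F\<close> is the oracle of the machine and \<open>G\<close> the function to be
  minimised; the two mask arrays turn the one into the other.\<close>

definition masked :: "store \<Rightarrow> bool" where
  "masked \<sigma> \<longleftrightarrow> (\<forall>X\<subseteq>{..<n}. F {i. i < n \<and> \<sigma> r_exc 0 i = 0 \<and> (\<sigma> r_inc 0 i \<noteq> 0 \<or> i \<in> X)} = G X)"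

lemma masked_run: "masked \<sigma> \<Longrightarrow> r_inc \<notin> writes c \<Longrightarrow> r_exc \<notin> writes c \<Longrightarrow> masked (R c \<sigma>)"
  unfolding masked_def by (simp add: run_frame)

lemma ev_Orcm:
  assumes "masked \<sigma>"
  shows "E \<sigma> \<rho> (Orcm v a) = G {i. i < n \<and> E \<sigma> (\<rho>(v := i)) a \<noteq> 0}"
proof -
  let ?X = "{i. i < n \<and> E \<sigma> (\<rho>(v := i)) a \<noteq> 0}"
  have 1: "E \<sigma> \<rho> (Orcm v a) = F {i. i < n \<and> \<sigma> r_exc 0 i = 0 \<and> (\<sigma> r_inc 0 i \<noteq> 0 \<or> i \<in> ?X)}"
    unfolding Orcm_def by (simp, intro arg_cong[where f = F]) auto
  have "?X \<subseteq> {..<n} \<longrightarrow> F {i. i < n \<and> \<sigma> r_exc 0 i = 0 \<and> (\<sigma> r_inc 0 i \<noteq> 0 \<or> i \<in> ?X)} = G ?X"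
    using assms unfolding masked_def by (rule spec)
  moreover have "?X \<subseteq> {..<n}" by auto
  ultimately show ?thesis using trans[OF 1] mp by blast
qed

text \<open>Cut off outside the ground set, so that the effect of a program can be stated as an
  equation between functions.\<close>

definition posof :: "store \<Rightarrow> nat \<Rightarrow> nat \<Rightarrow> int" where "posof \<sigma> j v = (if v < n then \<sigma> r_pos j v else 0)"
definition lamof :: "store \<Rightarrow> nat \<Rightarrow> int" where "lamof \<sigma> j = \<sigma> r_lam 0 j"
definition dof :: "store \<Rightarrow> nat \<Rightarrow> int" where "dof \<sigma> v = (if v < n then \<sigma> r_dist 0 v else 0)"

lemma run_bvec:
  assumes "masked \<sigma>" "j < N" "v < n"
  shows "R c_bvec \<sigma> r_bvec j v = bvec (posof \<sigma> j) v"
proof -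
  have "v < N" using assms n_le_N by simp
  then show ?thesis using assms unfolding c_bvec_def bvec_def posof_def
    by (simp add: ev_Orcm cong: conj_cong)
qed

lemma run_x:
  assumes "\<And>j v. j < N \<Longrightarrow> v < n \<Longrightarrow> \<sigma> r_bvec j v = bvec (posof \<sigma> j) v" "v < n"
  shows "R c_x \<sigma> r_x 0 v = xv (posof \<sigma>) (lamof \<sigma>) v"
  using assms N_gt unfolding c_x_def xv_def lamof_def by simp

lemma ev_Act:
  assumes "\<And>v. v < n \<Longrightarrow> \<sigma> r_x 0 v = xv (posof \<sigma>) (lamof \<sigma>) v"
  shows "E \<sigma> \<rho> (Act v) \<noteq> 0 \<longleftrightarrow> active (posof \<sigma>) (lamof \<sigma>) (dof \<sigma>) (\<rho> v)"
  using assms unfolding Act_def active_def dof_def by auto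

lemma run_target:
  assumes "\<And>v. v < n \<Longrightarrow> \<sigma> r_x 0 v = xv (posof \<sigma>) (lamof \<sigma>) v"
  shows "R c_target \<sigma> r_target 0 0 = int (target (posof \<sigma>) (lamof \<sigma>) (dof \<sigma>))"
proof -
  have "(E \<sigma> \<rho> (Act 2 * AllE 3 (ImpE (Act 3)
     (IfE (LtE (A1 r_dist (Var 3)) (A1 r_dist (Var 2))) 1
       (EqE (A1 r_dist (Var 3)) (A1 r_dist (Var 2)) * LeE (Var 3) (Var 2))))) \<noteq> 0)
    = topactive (posof \<sigma>) (lamof \<sigma>) (dof \<sigma>) (\<rho> 2)" for \<rho>
    using n_le_N ev_Act[OF assms] unfolding topactive_def
    by (auto simp: dof_def active_def)
  then show ?thesis using N_gt unfolding c_target_def target_def by (simp add: fun_eq_iff del: ev_arith(5))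
qed

lemma run_source:
  assumes t: "\<sigma> r_target 0 0 = int t" "t < n"
  shows "R c_source \<sigma> r_source 0 0 = int (source (posof \<sigma>) (lamof \<sigma>) (dof \<sigma>) t)"
    "0 < E \<sigma> \<rho> (ExE 2 Cand) \<longleftrightarrow> (\<exists>s. cand (posof \<sigma>) (lamof \<sigma>) (dof \<sigma>) t s)"
proof -
  have c: "(E \<sigma> \<rho> Cand \<noteq> 0) = cand (posof \<sigma>) (lamof \<sigma>) (dof \<sigma>) t (\<rho> 2)" for \<rho>
    using t unfolding cand_def Cand_def live_def lamof_def posof_def dof_def by auto
  show "R c_source \<sigma> r_source 0 0 = int (source (posof \<sigma>) (lamof \<sigma>) (dof \<sigma>) t)"
    using N_gt unfolding c_source_def source_def by (simp add: c)
  show "0 < E \<sigma> \<rho> (ExE 2 Cand) \<longleftrightarrow> (\<exists>s. cand (posof \<sigma>) (lamof \<sigma>) (dof \<sigma>) t s)"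
    using n_le_N by (auto simp: c) (auto simp: cand_def intro: less_le_trans)
qed

lemma run_wide:
  assumes t: "\<sigma> r_target 0 0 = int t" "t < n" and s: "\<sigma> r_source 0 0 = int s" "s < n"
  shows "R c_wide \<sigma> r_order 0 0 = int (wide (posof \<sigma>) (lamof \<sigma>) s t)"
proof -
  have c: "(E \<sigma> \<rho> (LtE 0 (A1 r_lam (Var 2)) * AllE 3 (ImpE (LtE 0 (A1 r_lam (Var 3))) (LeE (Wdt (Var 3)) (Wdt (Var 2))))) \<noteq> 0)
     = widest (posof \<sigma>) (lamof \<sigma>) s t (\<rho> 2)" if "\<rho> 2 < N" for \<rho>
    using t s that unfolding widest_def live_def lamof_def posof_def Wdt_def by auto
  have "first N (\<lambda>i. E \<sigma> (\<rho>(2 := i)) (LtE 0 (A1 r_lam (Var 2)) *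
      AllE 3 (ImpE (LtE 0 (A1 r_lam (Var 3))) (LeE (Wdt (Var 3)) (Wdt (Var 2))))) \<noteq> 0)
    = wide (posof \<sigma>) (lamof \<sigma>) s t" for \<rho>
    unfolding wide_def by (intro first_cong) (subst c, simp_all del: ev_arith ev_logic ev_Exi ev_All)
  then show ?thesis using N_gt unfolding c_wide_def by (simp del: ev_arith(5))
qed

lemma run_relabel:
  assumes t: "\<sigma> r_target 0 0 = int t" "t < n"
  shows "dof (R c_relabel \<sigma>) = (dof \<sigma>)(t := dof \<sigma> t + 1)"
  using t N_gt unfolding c_relabel_def dof_def by (auto simp: fun_eq_iff)

lemma run_move:
  assumes i: "\<sigma> r_order 0 0 = int i" "i < N" and s: "\<sigma> r_source 0 0 = int s" "s < n" and nx: "\<sigma> r_next 0 0 = int nx"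
    and j: "j < N"
  shows "posof (R c_move \<sigma>) j = (if nx \<le> j \<and> j < nx + n then mv (posof \<sigma> i) s (j - nx) else posof \<sigma> j)"
proof
  fix v
  have "nat (int j - int nx) = j - nx" by simp
  moreover have "int nx + int v = int j \<longleftrightarrow> v = j - nx" if "nx \<le> j" using that by auto
  ultimately show "posof (R c_move \<sigma>) j v =
     (if nx \<le> j \<and> j < nx + n then mv (posof \<sigma> i) s (j - nx) else posof \<sigma> j) v"
    using i s nx j N_gt unfolding c_move_def posof_def mv_def Fresh_def by auto
qed

text \<open>Gathers what the exchange code reads but never writes, so that it persists by
  \<open>run_frame\<close>.\<close>

definition exch_ctx :: "store \<Rightarrow> (nat \<Rightarrow> int) \<Rightarrow> nat \<Rightarrow> nat \<Rightarrow> nat \<Rightarrow> nat \<Rightarrow> bool" where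
  "exch_ctx \<sigma> P s t i nx \<longleftrightarrow> order P \<and> s < n \<and> t < n \<and> P s < P t \<and>
     \<sigma> r_target 0 0 = int t \<and> \<sigma> r_source 0 0 = int s \<and> \<sigma> r_order 0 0 = int i \<and> \<sigma> r_next 0 0 = int nx \<and>
     (\<forall>v<n. \<sigma> r_pos i v = P v) \<and> (\<forall>u<n. \<forall>v<n. \<sigma> r_bvec (nx + u) v - \<sigma> r_bvec i v = gap P s u v)"

lemma exch_ctx_run:
  assumes "exch_ctx \<sigma> P s t i nx" "writes c \<subseteq> {r_kap, r_place, r_elem, r_ksum, r_delta, r_scale, r_amount}"
  shows "exch_ctx (R c \<sigma>) P s t i nx"
proof -
  have "R c \<sigma> a = \<sigma> a" if "a \<in> {r_target, r_source, r_order, r_next, r_pos, r_bvec}" for a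
    using assms(2) that by (intro run_frame) auto
  then show ?thesis using assms(1) unfolding exch_ctx_def by simp
qed

lemma exch_inv_cong: "exch_inv P s t \<kappa> k \<Longrightarrow> (\<And>w. w < n \<Longrightarrow> \<kappa>' w = \<kappa> w) \<Longrightarrow> exch_inv P s t \<kappa>' k"
  unfolding exch_inv_def by simp

lemma ev_Gap:
  assumes "exch_ctx \<sigma> P s t i nx" "E \<sigma> \<rho> a = int u" "E \<sigma> \<rho> b = int v" "u < n" "v < n"
  shows "E \<sigma> \<rho> (Gap a b) = gap P s u v"
proof -
  have "nat (int nx + int u) = nx + u" by simp
  then show ?thesis using assms unfolding exch_ctx_def Gap_def by auto
qed

lemma run_exch_start:
  assumes ctx: "exch_ctx \<sigma> P s t i nx"
  shows "exch_inv P s t (R c_exch_start \<sigma> r_kap 0) (P t - 1)" "R c_exch_start \<sigma> r_place 0 0 = P t - 1"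
proof -
  have "order P" "s < n" "t < n" "P s < P t" using ctx unfolding exch_ctx_def by auto
  note st = exch_start[OF this]
  show "exch_inv P s t (R c_exch_start \<sigma> r_kap 0) (P t - 1)"
    by (rule exch_inv_cong[OF st]) (use ctx N_gt in \<open>auto simp: c_exch_start_def exch_ctx_def\<close>)
  show "R c_exch_start \<sigma> r_place 0 0 = P t - 1"
    using ctx N_gt by (auto simp: c_exch_start_def exch_ctx_def)
qed

text \<open>The maximum with \<open>P s\<close> lets the statement cover the idle rounds too, so it
  can be iterated \<open>N\<close> times.\<close>

lemma run_exch_step:
  assumes ctx: "exch_ctx \<sigma> P s t i nx" and inv: "exch_inv P s t (\<sigma> r_kap 0) p" and p: "\<sigma> r_place 0 0 = p" "P s \<le> p" "p < P t"
  defines "\<sigma>' \<equiv> R c_exch_step \<sigma>"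
  shows "exch_inv P s t (\<sigma>' r_kap 0) (max (P s) (p - 1)) \<and> \<sigma>' r_place 0 0 = max (P s) (p - 1)"
proof (cases "P s < p")
  case False
  then show ?thesis using ctx inv p N_gt unfolding \<sigma>'_def c_exch_step_def exch_ctx_def
    by (auto simp: skip_def max_def)
next
  case True
  have o: "order P" "s < n" "t < n" "P s < P t" using ctx unfolding exch_ctx_def by auto
  have "0 \<le> p" "p < int n" using True p order_range[OF o(1,2)] order_range[OF o(1,3)] by auto
  then obtain u where u: "u < n" "P u = p" using order_surj[OF o(1)] by blast
  define \<sigma>1 where "\<sigma>1 = R (Asg r_elem 0 1 (Mu 2 (LtE (Var 2) Dim * EqE (Arr r_pos (A0 r_order) (Var 2)) (A0 r_place)))) \<sigma>"
  have ctx1: "exch_ctx \<sigma>1 P s t i nx" unfolding \<sigma>1_def using ctx by (rule exch_ctx_run) simp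
  have fr: "\<sigma>1 r_kap = \<sigma> r_kap" "\<sigma>1 r_place = \<sigma> r_place" unfolding \<sigma>1_def by (auto simp: run_frame)
  have "first N (\<lambda>w. w < n \<and> P w = p) = u"
  proof (rule first_eqI)
    show "\<not> (w < n \<and> P w = p)" if "w < u" for w
      using that u orderD[OF o(1), of w u] by auto
  qed (use u n_le_N in auto)
  then have r_elem: "\<sigma>1 r_elem 0 0 = int u" using ctx p N_gt unfolding \<sigma>1_def exch_ctx_def by simp
  define \<sigma>2 where "\<sigma>2 = R (Asg r_kap 0 1 (IfE (Gap (A0 r_elem) (A0 r_elem))
              (IfE (EqE (Var 1) (A0 r_elem)) (0 - SumE 2 (A1 r_kap (Var 2) * Gap (Var 2) (A0 r_elem)))
                 (A1 r_kap (Var 1) * Gap (A0 r_elem) (A0 r_elem)))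
              (EqE (Var 1) (A0 r_elem)))) \<sigma>1"
  have s': "\<sigma>' = R (Asg r_place 0 1 (A0 r_place - 1)) \<sigma>2"
    using True ctx p unfolding \<sigma>'_def c_exch_step_def \<sigma>2_def \<sigma>1_def exch_ctx_def by simp
  have "\<sigma>2 r_place = \<sigma> r_place" unfolding \<sigma>2_def using fr by (simp add: run_frame)
  then have 1: "\<sigma>' r_place 0 0 = p - 1" unfolding s' using p N_gt by simp
  have g: "E \<sigma>1 \<rho> (Gap (A0 r_elem) (A0 r_elem)) = gap P s u u" for \<rho>
    by (rule ev_Gap[OF ctx1]) (use r_elem u in auto)
  have g2: "E \<sigma>1 (\<rho>(2 := w)) (Gap (Var 2) (A0 r_elem)) = gap P s w u" if "w < n" for \<rho> w
    by (rule ev_Gap[OF ctx1]) (use r_elem u that in auto)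
  have k: "\<sigma>' r_kap 0 w = (if gap P s u u = 0 then (\<lambda>w. if w = u then 1 else 0) else
      (\<lambda>w. if w = u then - (\<Sum>w<n. \<sigma> r_kap 0 w * gap P s w u) else \<sigma> r_kap 0 w * gap P s u u)) w" if "w < n" for w
    unfolding s' \<sigma>2_def using that n_le_N N_gt r_elem fr by (auto simp: g g2)
  have "exch_inv P s t (\<sigma>' r_kap 0) (p - 1)"
    by (rule exch_inv_cong[OF exch_step[OF o inv True p(3) u] k])
  then show ?thesis using 1 True by simp
qed

lemma run_exch_loop:
  assumes ctx: "exch_ctx \<sigma> P s t i nx" and inv: "exch_inv P s t (\<sigma> r_kap 0) (P t - 1)" and p: "\<sigma> r_place 0 0 = P t - 1"
  defines "\<sigma>' \<equiv> R (Rep c_exch_step) \<sigma>"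
  shows "exch_inv P s t (\<sigma>' r_kap 0) (P s)"
proof -
  have o: "order P" "s < n" "t < n" "P s < P t" using ctx unfolding exch_ctx_def by auto
  let ?f = "R c_exch_step"
  have w: "writes c_exch_step \<subseteq> {r_kap, r_place, r_elem, r_ksum, r_delta, r_scale, r_amount}" by (simp add: c_exch_step_def skip_def)
  have "exch_ctx ((?f ^^ m) \<sigma>) P s t i nx \<and>
    exch_inv P s t ((?f ^^ m) \<sigma> r_kap 0) (max (P s) (P t - 1 - int m)) \<and>
    (?f ^^ m) \<sigma> r_place 0 0 = max (P s) (P t - 1 - int m)" for m
  proof (induction m)
    case 0
    then show ?case using assms o(4) by simp
  next
    case (Suc m)
    then have "exch_ctx (?f ((?f ^^ m) \<sigma>)) P s t i nx"
      using exch_ctx_run[OF _ w] by blast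
    moreover have "max (P s) (max (P s) (P t - 1 - int m) - 1) = max (P s) (P t - 1 - int (Suc m))" by simp
    ultimately show ?case
      using run_exch_step[of "(?f ^^ m) \<sigma>" P s t i nx "max (P s) (P t - 1 - int m)"] Suc o(4) by simp
  qed
  from this[of N] have "exch_inv P s t (\<sigma>' r_kap 0) (max (P s) (P t - 1 - int N))" unfolding \<sigma>'_def by simp
  moreover have "max (P s) (P t - 1 - int N) = P s"
    using order_range[OF o(1,2)] order_range[OF o(1,3)] N_gt by simp
  ultimately show ?thesis by simp
qed

lemma run_weights:
  assumes ctx: "exch_ctx \<sigma> P s t i nx" and iN: "i < N"
  defines "\<kappa> \<equiv> \<sigma> r_kap 0" and "x \<equiv> \<sigma> r_x 0 t" and "\<sigma>' \<equiv> R c_weights \<sigma>"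
  defines "K \<equiv> \<Sum>w<n. \<kappa> w" and "\<delta> \<equiv> \<Sum>w<n. \<kappa> w * gap P s w t"
  shows "\<exists>q r. (q, r) = (if K * x + lamof \<sigma> i * \<delta> \<le> 0 then (K, lamof \<sigma> i) else (\<delta>, - x)) \<and>
     (\<forall>j<N. lamof \<sigma>' j = q * lamof \<sigma> j - (if j = i then r * K else 0) +
        (if nx \<le> j \<and> j < nx + n then r * \<kappa> (j - nx) else 0))"
    "\<sigma>' r_next 0 0 = int (nx + n)"
proof -
  define \<sigma>1 where "\<sigma>1 = R (Asg r_ksum 0 1 (SumE 2 (A1 r_kap (Var 2)))) \<sigma>"
  define \<sigma>2 where "\<sigma>2 = R (Asg r_delta 0 1 (SumE 2 (A1 r_kap (Var 2) * Gap (Var 2) (A0 r_target)))) \<sigma>1"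
  define \<sigma>3 where "\<sigma>3 = R (Asg r_scale 0 1 (IfE Full (A0 r_ksum) (A0 r_delta))) \<sigma>2"
  define \<sigma>4 where "\<sigma>4 = R (Asg r_amount 0 1 (IfE Full (A1 r_lam (A0 r_order)) (0 - A1 r_x (A0 r_target)))) \<sigma>3"
  define \<sigma>5 where "\<sigma>5 = R (Asg r_lam 0 1 (A0 r_scale * A1 r_lam (Var 1) - IfE (EqE (Var 1) (A0 r_order)) (A0 r_amount * A0 r_ksum) 0 +
              IfE (Fresh (Var 1)) (A0 r_amount * A1 r_kap (Var 1 - A0 r_next)) 0)) \<sigma>4"
  have s': "\<sigma>' = R (Asg r_next 0 1 (A0 r_next + Dim)) \<sigma>5"
    unfolding \<sigma>'_def c_weights_def \<sigma>5_def \<sigma>4_def \<sigma>3_def \<sigma>2_def \<sigma>1_def by simp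
  have ctx1: "exch_ctx \<sigma>1 P s t i nx" unfolding \<sigma>1_def using ctx by (rule exch_ctx_run) simp
  have ctx2: "exch_ctx \<sigma>2 P s t i nx" unfolding \<sigma>2_def using ctx1 by (rule exch_ctx_run) simp
  have ctx3: "exch_ctx \<sigma>3 P s t i nx" unfolding \<sigma>3_def using ctx2 by (rule exch_ctx_run) simp
  have ctx4: "exch_ctx \<sigma>4 P s t i nx" unfolding \<sigma>4_def using ctx3 by (rule exch_ctx_run) simp
  have tn: "t < n" using ctx unfolding exch_ctx_def by simp
  have fr: "\<sigma>4 r_lam = \<sigma> r_lam" "\<sigma>3 r_lam = \<sigma> r_lam" "\<sigma>2 r_lam = \<sigma> r_lam" "\<sigma>1 r_kap = \<sigma> r_kap" "\<sigma>2 r_kap = \<sigma> r_kap" "\<sigma>4 r_kap = \<sigma> r_kap"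
    "\<sigma>2 r_x = \<sigma> r_x" "\<sigma>3 r_x = \<sigma> r_x" "\<sigma>2 r_ksum = \<sigma>1 r_ksum" "\<sigma>3 r_ksum = \<sigma>1 r_ksum" "\<sigma>4 r_ksum = \<sigma>1 r_ksum" "\<sigma>3 r_delta = \<sigma>2 r_delta" "\<sigma>4 r_scale = \<sigma>3 r_scale"
    unfolding \<sigma>4_def \<sigma>3_def \<sigma>2_def \<sigma>1_def by (simp_all add: run_frame)
  have r_ksum: "\<sigma>1 r_ksum 0 0 = K" unfolding \<sigma>1_def K_def \<kappa>_def using N_gt n_le_N by simp
  have g: "E \<sigma>1 (\<rho>(2 := w)) (Gap (Var 2) (A0 r_target)) = gap P s w t" if "w < n" for \<rho> w
    by (rule ev_Gap[OF ctx1]) (use ctx1 that in \<open>auto simp: exch_ctx_def\<close>)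
  have r_delta: "\<sigma>2 r_delta 0 0 = \<delta>" unfolding \<sigma>2_def \<delta>_def \<kappa>_def using N_gt n_le_N fr by (simp add: g)
  have full: "E \<sigma>2 \<rho> Full = of_bool (K * x + lamof \<sigma> i * \<delta> \<le> 0)" "E \<sigma>3 \<rho> Full = of_bool (K * x + lamof \<sigma> i * \<delta> \<le> 0)" for \<rho>
    using ctx2 ctx3 r_ksum r_delta fr unfolding Full_def x_def lamof_def exch_ctx_def by simp_all
  have q: "\<sigma>3 r_scale 0 0 = (if K * x + lamof \<sigma> i * \<delta> \<le> 0 then K else \<delta>)"
    unfolding \<sigma>3_def using N_gt full r_ksum r_delta fr by simp
  have r: "\<sigma>4 r_amount 0 0 = (if K * x + lamof \<sigma> i * \<delta> \<le> 0 then lamof \<sigma> i else - x)"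
    unfolding \<sigma>4_def using N_gt full fr ctx3 by (simp add: lamof_def x_def exch_ctx_def)
  have nxd: "nat (int j - int nx) = j - nx" for j by simp
  have l: "lamof \<sigma>' j = \<sigma>3 r_scale 0 0 * lamof \<sigma> j - (if j = i then \<sigma>4 r_amount 0 0 * K else 0) +
        (if nx \<le> j \<and> j < nx + n then \<sigma>4 r_amount 0 0 * \<kappa> (j - nx) else 0)" if "j < N" for j
    unfolding s' \<sigma>5_def lamof_def \<kappa>_def using that N_gt fr ctx4 r_ksum by (auto simp: Fresh_def exch_ctx_def nxd)
  show "\<exists>q r. (q, r) = (if K * x + lamof \<sigma> i * \<delta> \<le> 0 then (K, lamof \<sigma> i) else (\<delta>, - x)) \<and>
     (\<forall>j<N. lamof \<sigma>' j = q * lamof \<sigma> j - (if j = i then r * K else 0) +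
        (if nx \<le> j \<and> j < nx + n then r * \<kappa> (j - nx) else 0))"
    using l unfolding q r by (intro exI[of _ "if K * x + lamof \<sigma> i * \<delta> \<le> 0 then K else \<delta>"]
      exI[of _ "if K * x + lamof \<sigma> i * \<delta> \<le> 0 then lamof \<sigma> i else - x"]) auto
  have "\<sigma>5 r_next 0 0 = int nx" using ctx4 unfolding \<sigma>5_def exch_ctx_def by simp
  then show "\<sigma>' r_next 0 0 = int (nx + n)" unfolding s' using N_gt by simp
qed

text \<open>Rows from \<open>nx\<close> on carry no weight, which makes them available to the next
  push.\<close>

definition coupled :: "store \<Rightarrow> nat \<Rightarrow> bool" where
  "coupled \<sigma> nx \<longleftrightarrow> masked \<sigma> \<and> \<sigma> r_next 0 0 = int nx \<and> valid (posof \<sigma>) (lamof \<sigma>) (dof \<sigma>) \<and>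
     (\<forall>j<N. nx \<le> j \<longrightarrow> lamof \<sigma> j = 0)"

text \<open>Reduction changes weights but no order, so the vectors computed during a push remain
  correct through all of its rounds.\<close>

definition sampled :: "store \<Rightarrow> bool" where
  "sampled \<sigma> \<longleftrightarrow> (\<forall>j<N. \<forall>v<n. \<sigma> r_bvec j v = bvec (posof \<sigma> j) v)"

lemma run_push:
  assumes c: "coupled \<sigma> nx" and x: "\<And>v. v < n \<Longrightarrow> \<sigma> r_x 0 v = xv (posof \<sigma>) (lamof \<sigma>) v" and nx: "nx + n \<le> N"
    and t: "\<sigma> r_target 0 0 = int t" "active (posof \<sigma>) (lamof \<sigma>) (dof \<sigma>) t"
    and s: "\<sigma> r_source 0 0 = int s" "cand (posof \<sigma>) (lamof \<sigma>) (dof \<sigma>) t s"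
  defines "\<sigma>' \<equiv> R c_push \<sigma>"
  shows "pushed (posof \<sigma>) (lamof \<sigma>) (dof \<sigma>) s t (wide (posof \<sigma>) (lamof \<sigma>) s t) (posof \<sigma>') (lamof \<sigma>')"
    "coupled \<sigma>' (nx + n)" "sampled \<sigma>'" "dof \<sigma>' = dof \<sigma>"
proof -
  let ?pos = "posof \<sigma>" and ?lam = "lamof \<sigma>" and ?d = "dof \<sigma>"
  let ?i = "wide ?pos ?lam s t" and ?P = "?pos (wide ?pos ?lam s t)"
  have v: "valid ?pos ?lam ?d" and r_next: "\<sigma> r_next 0 0 = int nx" and m: "masked \<sigma>" using c unfolding coupled_def by auto
  have free: "?lam j = 0" if "nx \<le> j" "j < N" for j using c that unfolding coupled_def by blast
  have tn: "t < n" "xv ?pos ?lam t < 0" and sn: "s < n" "?d t = ?d s + 1"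
    using t(2) s(2) unfolding active_def cand_def by auto
  have wi: "widest ?pos ?lam s t ?i" using wide_widest v unfolding valid_def by blast
  then have il: "?i \<in> live ?lam" unfolding widest_def by simp
  then have iN: "?i < N" "?i < nx" using free[of ?i] unfolding live_def by force+
  have pi: "order ?P" using il v unfolding valid_def by blast
  have st: "?P s < ?P t" using s(2) wi unfolding cand_def widest_def by force
  define \<sigma>1 where "\<sigma>1 = R c_wide \<sigma>"
  define \<sigma>2 where "\<sigma>2 = R c_move \<sigma>1"
  define \<sigma>3 where "\<sigma>3 = R c_bvec \<sigma>2"
  define \<sigma>4 where "\<sigma>4 = R c_exch_start \<sigma>3"
  define \<sigma>5 where "\<sigma>5 = R (Rep c_exch_step) \<sigma>4"
  have s': "\<sigma>' = R c_weights \<sigma>5" unfolding \<sigma>'_def c_push_def \<sigma>5_def \<sigma>4_def \<sigma>3_def \<sigma>2_def \<sigma>1_def by simp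
  note wd = c_wide_def c_move_def c_bvec_def c_exch_start_def c_exch_step_def skip_def c_weights_def
  have f1: "\<sigma>1 a = \<sigma> a" if "a \<noteq> r_order" for a unfolding \<sigma>1_def using that by (intro run_frame) (simp add: wd)
  have f2: "\<sigma>2 a = \<sigma>1 a" if "a \<noteq> r_pos" for a unfolding \<sigma>2_def using that by (intro run_frame) (simp add: wd)
  have f3: "\<sigma>3 a = \<sigma>2 a" if "a \<noteq> r_bvec" for a unfolding \<sigma>3_def using that by (intro run_frame) (simp add: wd)
  have f4: "\<sigma>4 a = \<sigma>3 a" if "a \<notin> {r_kap, r_place}" for a unfolding \<sigma>4_def using that by (intro run_frame) (simp add: wd)
  have f5: "\<sigma>5 a = \<sigma>4 a" if "a \<notin> {r_kap, r_place, r_elem}" for a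
    unfolding \<sigma>5_def using that by (intro run_frame) (simp add: wd)
  have f': "\<sigma>' a = \<sigma>5 a" if "a \<notin> {r_ksum, r_delta, r_scale, r_amount, r_lam, r_next}" for a
    unfolding s' using that by (intro run_frame) (simp add: wd)
  have i1: "\<sigma>1 r_order 0 0 = int ?i" unfolding \<sigma>1_def by (rule run_wide) (use t s tn sn in simp_all)
  have p1: "posof \<sigma>1 = ?pos" unfolding posof_def by (simp add: f1)
  have p2: "posof \<sigma>2 j = (if nx \<le> j \<and> j < nx + n then mv ?P s (j - nx) else ?pos j)" if "j < N" for j
  proof -
    have "\<sigma>1 r_source 0 0 = int s" "\<sigma>1 r_next 0 0 = int nx" using s(1) r_next by (simp_all add: f1)
    then show ?thesis
      using run_move[where \<sigma> = \<sigma>1 and i = ?i and s = s and nx = nx and j = j] i1 iN(1) sn(1) that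
      unfolding \<sigma>2_def[symmetric] p1 by blast
  qed
  have m2: "masked \<sigma>2" using m unfolding masked_def by (simp add: f1 f2)
  have p3: "posof \<sigma>3 = posof \<sigma>2" unfolding posof_def by (simp add: f3)
  have b3: "\<sigma>3 r_bvec j w = bvec (posof \<sigma>3 j) w" if "j < N" "w < n" for j w
    unfolding p3 unfolding \<sigma>3_def by (rule run_bvec[OF m2 that])
  have ctx3: "exch_ctx \<sigma>3 ?P s t ?i nx"
    unfolding exch_ctx_def
  proof (intro conjI allI impI pi sn(1) tn(1) st)
    have pe: "posof \<sigma>3 ?i = ?P" unfolding p3 using p2[OF iN(1)] iN(2) by simp
    show "\<sigma>3 r_pos ?i w = ?P w" if "w < n" for w using fun_cong[OF pe, of w] that unfolding posof_def by simp
    fix u w assume uw: "u < n" "w < n"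
    then have "nx + u < N" using nx by simp
    then have "posof \<sigma>3 (nx + u) = mv ?P s u" unfolding p3 using p2[of "nx + u"] uw by simp
    then show "\<sigma>3 r_bvec (nx + u) w - \<sigma>3 r_bvec ?i w = gap ?P s u w"
      using b3[OF \<open>nx + u < N\<close> uw(2)] b3[OF iN(1) uw(2)] pe unfolding gap_def by simp
  qed (use t s r_next i1 in \<open>simp_all add: f1 f2 f3\<close>)
  have ctx4: "exch_ctx \<sigma>4 ?P s t ?i nx"
    unfolding \<sigma>4_def by (rule exch_ctx_run[OF ctx3]) (simp add: wd)
  have ctx5: "exch_ctx \<sigma>5 ?P s t ?i nx"
    unfolding \<sigma>5_def by (rule exch_ctx_run[OF ctx4]) (simp add: wd)
  have inv5: "exch_inv ?P s t (\<sigma>5 r_kap 0) (?P s)"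
    unfolding \<sigma>5_def by (rule run_exch_loop[OF ctx4]) (use run_exch_start[OF ctx3] in \<open>simp_all add: \<sigma>4_def\<close>)
  have l5: "lamof \<sigma>5 = ?lam" unfolding lamof_def by (simp add: f1 f2 f3 f4 f5)
  have x5: "\<sigma>5 r_x 0 t = xv ?pos ?lam t" using x[OF tn(1)] by (simp add: f1 f2 f3 f4 f5)
  have p': "posof \<sigma>' = posof \<sigma>2" unfolding posof_def by (simp add: f' f5 f4 f3)
  obtain q r where qr: "(q, r) = (if (\<Sum>w<n. \<sigma>5 r_kap 0 w) * xv ?pos ?lam t + ?lam ?i * (\<Sum>w<n. \<sigma>5 r_kap 0 w * gap ?P s w t) \<le> 0
        then (\<Sum>w<n. \<sigma>5 r_kap 0 w, ?lam ?i) else (\<Sum>w<n. \<sigma>5 r_kap 0 w * gap ?P s w t, - xv ?pos ?lam t))"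
    and l': "\<And>j. j < N \<Longrightarrow> lamof \<sigma>' j = q * ?lam j - (if j = ?i then r * (\<Sum>w<n. \<sigma>5 r_kap 0 w) else 0) +
        (if nx \<le> j \<and> j < nx + n then r * \<sigma>5 r_kap 0 (j - nx) else 0)"
    using run_weights(1)[OF ctx5 iN(1)] unfolding s'[symmetric] l5 x5 by blast
  have pp: "posof \<sigma>' j = (if nx \<le> j \<and> j < nx + n then mv ?P s (j - nx) else ?pos j)" if "j < N" for j
    unfolding p' by (rule p2[OF that])
  note push = valid_push[where pos' = "posof \<sigma>'" and lam' = "lamof \<sigma>'",
      OF v free nx il sn(1) tn(1) st sn(2) tn(2) inv5 pp refl refl qr l']
  show "pushed ?pos ?lam ?d s t ?i (posof \<sigma>') (lamof \<sigma>')"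
    unfolding pushed_def using push by blast
  show d': "dof \<sigma>' = ?d" unfolding dof_def by (simp add: f' f5 f4 f3 f2 f1)
  show "coupled \<sigma>' (nx + n)"
    unfolding coupled_def
  proof (intro conjI allI impI)
    show "masked \<sigma>'" using m unfolding masked_def by (simp add: f' f5 f4 f3 f2 f1)
    show "\<sigma>' r_next 0 0 = int (nx + n)" using run_weights(2)[OF ctx5 iN(1)] unfolding s' .
    show "valid (posof \<sigma>') (lamof \<sigma>') (dof \<sigma>')" unfolding d' using push(1) by blast
    fix j assume "j < N" "nx + n \<le> j"
    then show "lamof \<sigma>' j = 0" using l'[of j] free[of j] iN by auto
  qed
  show "sampled \<sigma>'" unfolding sampled_def p' using b3 unfolding p3 by (simp add: f' f5 f4)
qed

definition alive :: "store \<Rightarrow> nat set" where "alive \<sigma> = {j. j < N \<and> \<sigma> r_alive 0 j \<noteq> 0}"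

lemma ev_Row:
  assumes "sampled \<sigma>" "\<sigma> r_col 0 0 = int r" "r \<le> n" "\<And>i. E \<sigma> (\<rho>(3 := i)) a = int j"
  shows "E \<sigma> \<rho> (Row a) = rowval (posof \<sigma>) (\<sigma> r_coef) j r"
  using assms unfolding Row_def rowval_def hvec_def sampled_def by (auto intro!: sum.cong)

lemma elim_inv_cong:
  assumes "elim_inv pos L C al r" "\<And>j i. j \<in> al \<Longrightarrow> i < N \<Longrightarrow> C' j i = C j i" "L \<subseteq> {..<N}"
  shows "elim_inv pos L C' al r"
proof -
  have "al \<subseteq> L" using assms(1) unfolding elim_inv_def by simp
  then have "rowval pos C' j r' = rowval pos C j r'" if "j \<in> al" for j r'
    using assms(2)[OF that] unfolding rowval_def by simp
  then show ?thesis using assms \<open>al \<subseteq> L\<close> unfolding elim_inv_def by (auto simp: subset_iff)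
qed

lemma run_elim:
  assumes b: "sampled \<sigma>" and r: "\<sigma> r_col 0 0 = int r" and inv: "elim_inv (posof \<sigma>) L (\<sigma> r_coef) (alive \<sigma>) r"
    and L: "L \<subseteq> {..<N}" and rn: "r \<le> n"
  defines "\<sigma>' \<equiv> R c_elim \<sigma>"
  shows "elim_inv (posof \<sigma>) L (\<sigma>' r_coef) (alive \<sigma>') (Suc r) \<and> \<sigma>' r_col 0 0 = int (Suc r)"
proof -
  let ?pos = "posof \<sigma>" and ?w = "\<lambda>j. rowval (posof \<sigma>) (\<sigma> r_coef) j r"
  have row: "E \<sigma> \<rho> (Row (Var 2)) = ?w (\<rho> 2)" for \<rho>
    by (rule ev_Row[OF b r rn]) simp
  have ex: "0 < E \<sigma> \<rho> (ExE 2 (A1 r_alive (Var 2) * Row (Var 2))) \<longleftrightarrow> (\<exists>j\<in>alive \<sigma>. ?w j \<noteq> 0)" for \<rho>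
    unfolding alive_def by (auto simp: row)
  have go: "(E \<sigma> (\<lambda>_. 0) (A0 r_col) < E \<sigma> (\<lambda>_. 0) (Dim + 1)) = True" using rn r by simp
  show ?thesis
  proof (cases "\<exists>j\<in>alive \<sigma>. ?w j \<noteq> 0")
    case False
    then have e: "(0 < E \<sigma> (\<lambda>_. 0) (ExE 2 (A1 r_alive (Var 2) * Row (Var 2)))) = False" using ex by blast
    have s': "\<sigma>' = R (Asg r_col 0 1 (A0 r_col + 1)) (R skip \<sigma>)"
      unfolding \<sigma>'_def c_elim_def run.simps(2,3) by (simp only: e go ev_arith(1) if_True if_False)
    have "\<sigma>' r_coef = \<sigma> r_coef" "\<sigma>' r_alive = \<sigma> r_alive" "\<sigma>' r_col 0 0 = int (Suc r)"
      unfolding s' using r N_gt by (simp_all add: run_frame skip_def)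
    moreover have "elim_inv ?pos L (\<sigma> r_coef) (alive \<sigma>) (Suc r)" by (rule elim_skip[OF inv]) (use False in blast)
    ultimately show ?thesis unfolding alive_def by simp
  next
    case True
    define \<sigma>1 where "\<sigma>1 = R (Asg r_pivot 0 1 (Mu 2 (A1 r_alive (Var 2) * Row (Var 2)))) \<sigma>"
    define \<sigma>2 where "\<sigma>2 = R (Asg r_coef 0 1 (IfE (A1 r_alive (Var 0) * NotE (EqE (Var 0) (A0 r_pivot)))
                 (Row (A0 r_pivot) * Arr r_coef (Var 0) (Var 1) - Row (Var 0) * Arr r_coef (A0 r_pivot) (Var 1))
                 (Arr r_coef (Var 0) (Var 1)))) \<sigma>1"
    define \<sigma>3 where "\<sigma>3 = R (Asg r_alive 0 1 (IfE (EqE (Var 1) (A0 r_pivot)) 0 (A1 r_alive (Var 1)))) \<sigma>2"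
    have e: "(0 < E \<sigma> (\<lambda>_. 0) (ExE 2 (A1 r_alive (Var 2) * Row (Var 2)))) = True" using ex True by blast
    have s': "\<sigma>' = R (Asg r_col 0 1 (A0 r_col + 1)) \<sigma>3"
      unfolding \<sigma>'_def c_elim_def run.simps(2,3) \<sigma>3_def \<sigma>2_def \<sigma>1_def
      by (simp only: e go ev_arith(1) if_True)
    define pv where "pv = first N (\<lambda>j. \<sigma> r_alive 0 j \<noteq> 0 \<and> ?w j \<noteq> 0)"
    have "pv < N" unfolding pv_def first_less_iff using True unfolding alive_def by auto
    moreover then have "\<sigma> r_alive 0 pv \<noteq> 0 \<and> ?w pv \<noteq> 0" unfolding pv_def by (rule first_holds)
    ultimately have pv: "pv < N" "pv \<in> alive \<sigma>" "?w pv \<noteq> 0" unfolding alive_def by auto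
    have f1: "\<sigma>1 a = \<sigma> a" if "a \<noteq> r_pivot" for a unfolding \<sigma>1_def using that by (intro run_frame) simp
    have f2: "\<sigma>2 a = \<sigma>1 a" if "a \<noteq> r_coef" for a unfolding \<sigma>2_def using that by (intro run_frame) simp
    have f3: "\<sigma>3 a = \<sigma>2 a" if "a \<noteq> r_alive" for a unfolding \<sigma>3_def using that by (intro run_frame) simp
    have f': "\<sigma>' a = \<sigma>3 a" if "a \<noteq> r_col" for a unfolding s' using that by (intro run_frame) simp
    have pv1: "\<sigma>1 r_pivot 0 0 = int pv" unfolding \<sigma>1_def pv_def using N_gt by (simp add: row)
    have pos1: "posof \<sigma>1 = ?pos" unfolding posof_def by (simp add: f1)
    have b1: "sampled \<sigma>1" using b pos1 unfolding sampled_def by (simp add: f1)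

    have rowpv: "E \<sigma>1 \<rho> (Row (A0 r_pivot)) = ?w pv" for \<rho>
      using ev_Row[OF b1 _ rn, of \<rho> "A0 r_pivot" pv] pv1 r by (simp add: f1 pos1)
    have row0: "E \<sigma>1 \<rho> (Row (Var 0)) = ?w (\<rho> 0)" for \<rho>
      using ev_Row[OF b1 _ rn, of \<rho> "Var 0" "\<rho> 0"] r by (simp add: f1 pos1)
    have r_coef: "\<sigma>' r_coef j i = ?w pv * \<sigma> r_coef j i - ?w j * \<sigma> r_coef pv i" if "j \<in> alive \<sigma> - {pv}" "i < N" for j i
      unfolding f'[of r_coef, simplified] f3[of r_coef, simplified] unfolding \<sigma>2_def
      using that pv1 f1[of r_coef] f1[of r_alive] by (simp add: rowpv row0 alive_def)
    have al': "alive \<sigma>' = alive \<sigma> - {pv}"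
      unfolding alive_def using f'[of r_alive] f1[of r_alive] f2[of r_alive] f2[of r_pivot] pv1 by (auto simp: \<sigma>3_def)
    have "L \<subseteq> {..<N}" "finite L" using L finite_subset by auto
    have rr: "\<sigma>' r_col 0 0 = int (Suc r)" unfolding s' using N_gt r by (simp add: f3 f2 f1)
    have "elim_inv ?pos L (\<sigma>' r_coef) (alive \<sigma> - {pv}) (Suc r)"
      by (rule elim_step[OF inv \<open>finite L\<close> L pv(2,3) r_coef])
    then show ?thesis unfolding al' using rr by blast
  qed
qed

lemma run_elim_idle:
  assumes "\<sigma> r_col 0 0 = int (Suc n)"
  shows "R c_elim \<sigma> = R skip \<sigma>"
proof -
  have "(E \<sigma> (\<lambda>_. 0) (A0 r_col) < E \<sigma> (\<lambda>_. 0) (Dim + 1)) = False" using assms by simp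
  then show ?thesis unfolding c_elim_def run.simps(2,3) by (simp only: if_False)
qed

lemma run_skip: "a \<noteq> r_elem \<Longrightarrow> R skip \<sigma> a = \<sigma> a"
  by (rule run_frame) (simp add: skip_def)

lemma run_elim_loop:
  assumes b: "sampled \<sigma>" and r: "\<sigma> r_col 0 0 = 0" and inv: "elim_inv (posof \<sigma>) L (\<sigma> r_coef) (alive \<sigma>) 0"
    and L: "L \<subseteq> {..<N}"
  defines "\<sigma>' \<equiv> R (Rep c_elim) \<sigma>"
  shows "elim_inv (posof \<sigma>) L (\<sigma>' r_coef) (alive \<sigma>') (Suc n)"
proof -
  let ?f = "R c_elim"
  have fr: "?f \<tau> a = \<tau> a" if "a \<in> {r_pos, r_bvec}" for \<tau> a
    using that by (intro run_frame) (auto simp: c_elim_def skip_def)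
  have "(sampled ((?f ^^ m) \<sigma>) \<and> posof ((?f ^^ m) \<sigma>) = posof \<sigma>) \<and>
    (?f ^^ m) \<sigma> r_col 0 0 = int (min m (Suc n)) \<and>
    elim_inv (posof \<sigma>) L ((?f ^^ m) \<sigma> r_coef) (alive ((?f ^^ m) \<sigma>)) (min m (Suc n))" for m
  proof (induction m)
    case 0
    then show ?case using b r inv by simp
  next
    case (Suc m)
    let ?\<tau> = "(?f ^^ m) \<sigma>"
    have p: "posof (?f ?\<tau>) = posof ?\<tau>" unfolding posof_def by (simp add: fr)
    then have s: "sampled (?f ?\<tau>)" using Suc unfolding sampled_def by (simp add: fr)
    show ?case
    proof (cases "m \<le> n")
      case True
      then have "elim_inv (posof ?\<tau>) L (?f ?\<tau> r_coef) (alive (?f ?\<tau>)) (Suc m) \<and> ?f ?\<tau> r_col 0 0 = int (Suc m)"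
        using Suc by (intro run_elim[OF _ _ _ L]) auto
      then show ?thesis using True p s Suc by simp
    next
      case False
      then have "?f ?\<tau> = R skip ?\<tau>" using Suc by (intro run_elim_idle) simp
      then have "?f ?\<tau> r_coef = ?\<tau> r_coef" "?f ?\<tau> r_alive = ?\<tau> r_alive" "?f ?\<tau> r_col = ?\<tau> r_col" by (simp_all add: run_skip)
      then show ?thesis using False p s Suc unfolding alive_def by simp
    qed
  qed
  from this[of N] show ?thesis using N_gt unfolding \<sigma>'_def by simp
qed

text \<open>If no row survives the elimination, at most one row was lost per coordinate, so at most
  \<open>n + 1\<close> orders are in use; otherwise the dependence in a surviving row removes an
  order.\<close>

lemma run_reduce:
  assumes c: "coupled \<sigma> nx" and b: "sampled \<sigma>"
  defines "\<sigma>' \<equiv> R c_reduce \<sigma>"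
  shows "coupled \<sigma>' nx \<and> sampled \<sigma>' \<and> posof \<sigma>' = posof \<sigma> \<and> dof \<sigma>' = dof \<sigma> \<and>
    live (lamof \<sigma>') \<subseteq> live (lamof \<sigma>) \<and>
    (\<exists>h>0. \<forall>v<n. xv (posof \<sigma>) (lamof \<sigma>') v = h * xv (posof \<sigma>) (lamof \<sigma>) v) \<and>
    (card (live (lamof \<sigma>)) \<le> n + 1 \<or> card (live (lamof \<sigma>')) < card (live (lamof \<sigma>)))"
proof -
  let ?pos = "posof \<sigma>" and ?lam = "lamof \<sigma>" and ?L = "live (lamof \<sigma>)"
  have LN: "?L \<subseteq> {..<N}" unfolding live_def by auto
  define \<sigma>1 where "\<sigma>1 = R (Asg r_coef 0 1 (EqE (Var 1) (Var 0))) \<sigma>"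
  define \<sigma>2 where "\<sigma>2 = R (Asg r_alive 0 1 (LtE 0 (A1 r_lam (Var 1)))) \<sigma>1"
  define \<sigma>3 where "\<sigma>3 = R (Asg r_col 0 1 0) \<sigma>2"
  define \<sigma>4 where "\<sigma>4 = R (Rep c_elim) \<sigma>3"
  define \<sigma>5 where "\<sigma>5 = R (Asg r_row 0 1 (Mu 2 (A1 r_alive (Var 2)))) \<sigma>4"
  define \<sigma>6 where "\<sigma>6 = R (Asg r_min 0 1 (Mu 2 (LtE 0 (Arr r_coef (A0 r_row) (Var 2)) * AllE 3 (ImpE (LtE 0 (Arr r_coef (A0 r_row) (Var 3)))
                 (LeE (A1 r_lam (Var 2) * Arr r_coef (A0 r_row) (Var 3)) (A1 r_lam (Var 3) * Arr r_coef (A0 r_row) (Var 2))))))) \<sigma>5"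
  have f1: "\<sigma>1 a = \<sigma> a" if "a \<noteq> r_coef" for a unfolding \<sigma>1_def using that by (intro run_frame) simp
  have f2: "\<sigma>2 a = \<sigma>1 a" if "a \<noteq> r_alive" for a unfolding \<sigma>2_def using that by (intro run_frame) simp
  have f3: "\<sigma>3 a = \<sigma>2 a" if "a \<noteq> r_col" for a unfolding \<sigma>3_def using that by (intro run_frame) simp
  have f4: "\<sigma>4 a = \<sigma>3 a" if "a \<notin> {r_coef, r_alive, r_col, r_pivot, r_elem}" for a
    unfolding \<sigma>4_def using that by (intro run_frame) (simp add: c_elim_def skip_def)
  have p3: "posof \<sigma>3 = ?pos" unfolding posof_def by (simp add: f1 f2 f3)
  have b3: "sampled \<sigma>3" using b unfolding sampled_def p3 by (simp add: f1 f2 f3)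
  have a3: "alive \<sigma>3 = ?L" unfolding alive_def live_def lamof_def f3[of r_alive, simplified] \<sigma>2_def by (auto simp: f1)
  have i3: "elim_inv ?pos ?L (\<sigma>3 r_coef) ?L 0"
    by (rule elim_inv_cong[OF elim_start _ LN]) (use LN in \<open>auto simp: f3 f2 \<sigma>1_def\<close>)
  have i4: "elim_inv ?pos ?L (\<sigma>4 r_coef) (alive \<sigma>4) (Suc n)"
    using run_elim_loop[OF b3 _ _ LN] i3 N_gt unfolding \<sigma>4_def[symmetric] p3 a3 by (simp add: \<sigma>3_def)
  have m4: "masked \<sigma>4" using c unfolding coupled_def masked_def by (simp add: f1 f2 f3 f4)
  have ex: "0 < E \<sigma>4 \<rho> (ExE 2 (A1 r_alive (Var 2))) \<longleftrightarrow> alive \<sigma>4 \<noteq> {}" for \<rho> unfolding alive_def by auto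
  show ?thesis
  proof (cases "alive \<sigma>4 = {}")
    case True
    then have ex': "(0 < E \<sigma>4 (\<lambda>_. 0) (ExE 2 (A1 r_alive (Var 2)))) = False" using ex by blast
    have s': "\<sigma>' = R skip \<sigma>4"
      using ex' unfolding \<sigma>'_def c_reduce_def run.simps(2,3) \<sigma>4_def \<sigma>3_def \<sigma>2_def \<sigma>1_def
      by (simp only: ev_arith(1) if_False)
    have f': "\<sigma>' a = \<sigma> a" if "a \<notin> {r_coef, r_alive, r_col, r_pivot, r_elem}" for a
      unfolding s' using that by (simp add: run_skip f4 f3 f2 f1)
    have e: "posof \<sigma>' = ?pos" "lamof \<sigma>' = ?lam" "dof \<sigma>' = dof \<sigma>"
      unfolding posof_def lamof_def dof_def by (simp_all add: f')
    have "coupled \<sigma>' nx" using c unfolding coupled_def e masked_def by (simp add: f')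
    moreover have "sampled \<sigma>'" using b unfolding sampled_def e by (simp add: f')
    moreover have "card ?L \<le> n + 1" using i4 True unfolding elim_inv_def by simp
    moreover have "\<exists>h>0. \<forall>v<n. xv ?pos ?lam v = h * xv ?pos ?lam v" by (intro exI[of _ 1]) simp
    ultimately show ?thesis unfolding e by blast
  next
    case False
    then have ex': "(0 < E \<sigma>4 (\<lambda>_. 0) (ExE 2 (A1 r_alive (Var 2)))) = True" using ex by blast
    have s': "\<sigma>' = R (Asg r_lam 0 1 (Arr r_coef (A0 r_row) (A0 r_min) * A1 r_lam (Var 1) - A1 r_lam (A0 r_min) * Arr r_coef (A0 r_row) (Var 1))) \<sigma>6"
      using ex' unfolding \<sigma>'_def c_reduce_def run.simps(2,3) \<sigma>6_def \<sigma>5_def \<sigma>4_def \<sigma>3_def \<sigma>2_def \<sigma>1_def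
      by (simp only: ev_arith(1) if_True)
    define jj where "jj = first N (\<lambda>j. \<sigma>4 r_alive 0 j \<noteq> 0)"
    have "jj < N" unfolding jj_def first_less_iff using False unfolding alive_def by auto
    then have jj: "jj \<in> alive \<sigma>4" using first_holds[of N "\<lambda>j. \<sigma>4 r_alive 0 j \<noteq> 0"] unfolding jj_def alive_def by simp
    let ?c = "\<sigma>4 r_coef jj"
    note en = elim_end[OF i4 jj LN]
    have f5: "\<sigma>5 a = \<sigma>4 a" if "a \<noteq> r_row" for a unfolding \<sigma>5_def using that by (intro run_frame) simp
    have f6: "\<sigma>6 a = \<sigma>5 a" if "a \<noteq> r_min" for a unfolding \<sigma>6_def using that by (intro run_frame) simp
    have f: "\<sigma>' a = \<sigma>6 a" if "a \<noteq> r_lam" for a unfolding s' using that by (intro run_frame) simp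
    have j5: "\<sigma>5 r_row 0 0 = int jj" unfolding \<sigma>5_def jj_def using N_gt by simp
    let ?K = "\<lambda>k. 0 < ?c k \<and> (\<forall>j<N. 0 < ?c j \<longrightarrow> ?lam k * ?c j \<le> ?lam j * ?c k)"
    have l4: "\<sigma>5 r_lam 0 = ?lam" unfolding lamof_def by (simp add: f1 f2 f3 f4 f5)
    have nn: "0 \<le> ?lam j" if "j < N" for j using c that unfolding coupled_def valid_def by blast
    define kk where "kk = first N ?K"
    have k6: "\<sigma>6 r_min 0 0 = int kk" unfolding \<sigma>6_def kk_def using N_gt j5 l4 f5[of r_coef]
      by (simp, intro first_cong, auto)
    have "\<exists>k<N. ?K k"
    proof -
      let ?S = "{k. k < N \<and> 0 < ?c k}"
      \<comment> \<open>Rationals serve only to show that a least ratio exists; the program compares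
        cross products.\<close>
      let ?q = "\<lambda>k. of_int (?lam k) / of_int (?c k) :: rat"
      have S: "finite ?S" "?S \<noteq> {}" using en(4) by auto
      then obtain k where k: "k \<in> ?S" "?q k = Min (?q ` ?S)"
        using Min_in[of "?q ` ?S"] by (auto simp: image_iff)
      have "?lam k * ?c j \<le> ?lam j * ?c k" if "j \<in> ?S" for j
      proof -
        have "?q k \<le> ?q j" unfolding k(2) using S that by (intro Min_le) auto
        then have "(of_int (?lam k * ?c j) :: rat) \<le> of_int (?lam j * ?c k)"
          using that k(1) by (simp add: divide_simps mult.commute split: if_splits)
        then show ?thesis by (simp only: of_int_le_iff)
      qed
      then show ?thesis using k(1) by auto
    qed
    then have kN: "kk < N" unfolding kk_def first_less_iff .
    then have K: "?K kk" unfolding kk_def by (rule first_holds)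
    have l': "lamof \<sigma>' j = ?c kk * ?lam j - ?lam kk * ?c j" if "j < N" for j
      unfolding s' lamof_def[of "R _ _"] using that j5 k6 l4 f6[of r_row] f6[of r_coef] f6[of r_lam] f5[of r_coef] N_gt
      by (simp add: fun_eq_iff)
    have v: "valid ?pos ?lam (dof \<sigma>)" using c unfolding coupled_def by blast
    have sup: "0 < ?lam j" if "j < N" "?c j \<noteq> 0" for j using en(3)[OF that] unfolding live_def by simp
    note red = valid_reduce[where lam' = "lamof \<sigma>'" and c = ?c and k = kk, OF v sup en(1,2) kN K[THEN conjunct1] _ l']
    have red': "valid ?pos (lamof \<sigma>') (dof \<sigma>)" "\<forall>v<n. xv ?pos (lamof \<sigma>') v = ?c kk * xv ?pos ?lam v"
      "live (lamof \<sigma>') \<subseteq> ?L - {kk}"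
      using red K by blast+
    have e: "posof \<sigma>' = ?pos" "dof \<sigma>' = dof \<sigma>"
      unfolding posof_def dof_def by (simp_all add: f f6 f5 f4 f3 f2 f1)
    have "coupled \<sigma>' nx"
      unfolding coupled_def e
    proof (intro conjI allI impI)
      show "masked \<sigma>'" using m4 unfolding masked_def by (simp add: f f6 f5)
      show "\<sigma>' r_next 0 0 = int nx" using c unfolding coupled_def by (simp add: f f6 f5 f4 f3 f2 f1)
      fix j assume j: "j < N" "nx \<le> j"
      then have "?lam j = 0" using c unfolding coupled_def by blast
      then show "lamof \<sigma>' j = 0" using l'[OF j(1)] sup[OF j(1)] by force
    qed (rule red'(1))
    moreover have "sampled \<sigma>'" using b unfolding sampled_def e by (simp add: f f6 f5 f4 f3 f2 f1)
    moreover have "card (live (lamof \<sigma>')) < card ?L"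
    proof (rule psubset_card_mono)
      have "kk \<in> ?L" using en(3)[OF kN] K by force
      then show "live (lamof \<sigma>') \<subset> ?L" using red'(3) by blast
    qed simp
    ultimately show ?thesis using red' K e by blast
  qed
qed

text \<open>Each round drops an order as long as more than \<open>n + 1\<close> are in use, and
  there are at most \<open>N\<close> to begin with.\<close>

lemma run_reduce_loop:
  assumes c: "coupled \<sigma> nx" and b: "sampled \<sigma>"
  defines "\<sigma>' \<equiv> R (Rep c_reduce) \<sigma>"
  shows "coupled \<sigma>' nx \<and> posof \<sigma>' = posof \<sigma> \<and> dof \<sigma>' = dof \<sigma> \<and>
    live (lamof \<sigma>') \<subseteq> live (lamof \<sigma>) \<and>
    (\<exists>h>0. \<forall>v<n. xv (posof \<sigma>) (lamof \<sigma>') v = h * xv (posof \<sigma>) (lamof \<sigma>) v) \<and>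
    card (live (lamof \<sigma>')) \<le> n + 1"
proof -
  let ?f = "R c_reduce"
  have "coupled ((?f ^^ m) \<sigma>) nx \<and> sampled ((?f ^^ m) \<sigma>) \<and> posof ((?f ^^ m) \<sigma>) = posof \<sigma> \<and>
    dof ((?f ^^ m) \<sigma>) = dof \<sigma> \<and> live (lamof ((?f ^^ m) \<sigma>)) \<subseteq> live (lamof \<sigma>) \<and>
    (\<exists>h>0. \<forall>v<n. xv (posof \<sigma>) (lamof ((?f ^^ m) \<sigma>)) v = h * xv (posof \<sigma>) (lamof \<sigma>) v) \<and>
    card (live (lamof ((?f ^^ m) \<sigma>))) \<le> max (n + 1) (N - m)" for m
  proof (induction m)
    case 0
    have "card (live (lamof \<sigma>)) \<le> card {..<N}" by (rule card_mono) (auto simp: live_def)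
    then have "card (live (lamof \<sigma>)) \<le> N" by simp
    then show ?case using c b by (auto intro: exI[of _ 1])
  next
    case (Suc m)
    let ?\<tau> = "(?f ^^ m) \<sigma>"
    obtain h where h: "0 < h" "\<forall>v<n. xv (posof \<sigma>) (lamof ?\<tau>) v = h * xv (posof \<sigma>) (lamof \<sigma>) v"
      using Suc by blast
    have r: "coupled (?f ?\<tau>) nx \<and> sampled (?f ?\<tau>) \<and> posof (?f ?\<tau>) = posof ?\<tau> \<and> dof (?f ?\<tau>) = dof ?\<tau> \<and>
      live (lamof (?f ?\<tau>)) \<subseteq> live (lamof ?\<tau>) \<and>
      (\<exists>h>0. \<forall>v<n. xv (posof ?\<tau>) (lamof (?f ?\<tau>)) v = h * xv (posof ?\<tau>) (lamof ?\<tau>) v) \<and>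
      (card (live (lamof ?\<tau>)) \<le> n + 1 \<or> card (live (lamof (?f ?\<tau>))) < card (live (lamof ?\<tau>)))"
      using Suc by (intro run_reduce) auto
    then obtain h' where h': "0 < h'" "\<forall>v<n. xv (posof \<sigma>) (lamof (?f ?\<tau>)) v = h' * xv (posof \<sigma>) (lamof ?\<tau>) v"
      using Suc by auto
    have "\<forall>v<n. xv (posof \<sigma>) (lamof (?f ?\<tau>)) v = (h' * h) * xv (posof \<sigma>) (lamof \<sigma>) v"
      using h h' by simp
    then have hh: "\<exists>h>0. \<forall>v<n. xv (posof \<sigma>) (lamof (?f ?\<tau>)) v = h * xv (posof \<sigma>) (lamof \<sigma>) v"
      using h(1) h'(1) mult_pos_pos by blast
    have "card (live (lamof (?f ?\<tau>))) \<le> card (live (lamof ?\<tau>))"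
      using r by (intro card_mono) auto
    then have "card (live (lamof (?f ?\<tau>))) \<le> max (n + 1) (N - Suc m)" using r Suc by auto
    then show ?case using r Suc hh by auto
  qed
  from this[of N] show ?thesis unfolding \<sigma>'_def by simp
qed

text \<open>Reduction multiplies \<open>x\<close> by a positive factor, and \<open>pushed\<close>
  depends only on the signs of the new \<open>x\<close>.\<close>

lemma pushed_reduce:
  assumes "pushed pos lam d s t i pos' lam'" "valid pos' lam'' d" "live lam'' \<subseteq> live lam'"
    "0 < h" "\<forall>v<n. xv pos' lam'' v = h * xv pos' lam' v" "t < n"
  shows "pushed pos lam d s t i pos' lam''"
proof -
  have "xv pos' lam'' v < 0 \<longleftrightarrow> xv pos' lam' v < 0" "xv pos' lam'' v \<le> 0 \<longleftrightarrow> xv pos' lam' v \<le> 0"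
    "xv pos' lam'' v = 0 \<longleftrightarrow> xv pos' lam' v = 0" if "v < n" for v
    using assms(4,5) that by (auto simp: mult_less_0_iff mult_le_0_iff)
  then show ?thesis using assms unfolding pushed_def by auto
qed

text \<open>The potential pays for the steps done, so \<open>m\<close> cannot exceed
  \<open>(n + 2) ^ 6\<close> while something is active, and the rows used are bounded in terms of
  \<open>m\<close>. Once nothing is active the state is final and neither bound is kept.\<close>

definition progress :: "nat \<Rightarrow> store \<Rightarrow> bool" where
  "progress m \<sigma> \<longleftrightarrow> (\<exists>nx. coupled \<sigma> nx \<and> card (live (lamof \<sigma>)) \<le> n + 1 \<and>
     ((\<forall>v. \<not> active (posof \<sigma>) (lamof \<sigma>) (dof \<sigma>) v) \<or>
      pot (posof \<sigma>) (lamof \<sigma>) (dof \<sigma>) + m \<le> (n + 2) ^ 6 \<and> nx \<le> 1 + n * m))"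

lemma run_step:
  assumes "progress m \<sigma>"
  shows "progress (Suc m) (R c_step \<sigma>)"
proof -
  let ?pos = "posof \<sigma>" and ?lam = "lamof \<sigma>" and ?d = "dof \<sigma>"
  obtain nx where c: "coupled \<sigma> nx" and L: "card (live ?lam) \<le> n + 1" and
    P: "(\<forall>v. \<not> active ?pos ?lam ?d v) \<or> pot ?pos ?lam ?d + m \<le> (n + 2) ^ 6 \<and> nx \<le> 1 + n * m"
    using assms unfolding progress_def by blast
  define \<sigma>1 where "\<sigma>1 = R c_bvec \<sigma>"
  define \<sigma>2 where "\<sigma>2 = R c_x \<sigma>1"
  have f1: "\<sigma>1 a = \<sigma> a" if "a \<noteq> r_bvec" for a unfolding \<sigma>1_def using that by (intro run_frame) (simp add: c_bvec_def)
  have f2: "\<sigma>2 a = \<sigma>1 a" if "a \<noteq> r_x" for a unfolding \<sigma>2_def using that by (intro run_frame) (simp add: c_x_def)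
  have m: "masked \<sigma>" and v: "valid ?pos ?lam ?d" using c unfolding coupled_def by auto
  have e1: "posof \<sigma>1 = ?pos" "lamof \<sigma>1 = ?lam" unfolding posof_def lamof_def by (simp_all add: f1)
  have e2: "posof \<sigma>2 = ?pos" "lamof \<sigma>2 = ?lam" "dof \<sigma>2 = ?d"
    unfolding posof_def lamof_def dof_def by (simp_all add: f1 f2)
  have x2: "\<sigma>2 r_x 0 w = xv (posof \<sigma>2) (lamof \<sigma>2) w" if "w < n" for w
    unfolding e2 unfolding \<sigma>2_def e1[symmetric]
  proof (rule run_x[OF _ that])
    show "\<sigma>1 r_bvec j w = bvec (posof \<sigma>1 j) w" if "j < N" "w < n" for j w
      unfolding e1 unfolding \<sigma>1_def by (rule run_bvec[OF m that])
  qed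
  have c2: "coupled \<sigma>2 nx" using c unfolding coupled_def e2 masked_def by (simp add: f1 f2)
  have ex: "(0 < E \<sigma>2 \<rho> (ExE 2 (Act 2))) \<longleftrightarrow> (\<exists>v. active ?pos ?lam ?d v)" for \<rho>
    using n_le_N by (auto simp: ev_Act[OF x2] e2) (auto simp: active_def intro: less_le_trans)
  show ?thesis
  proof (cases "\<exists>v. active ?pos ?lam ?d v")
    case False
    then have "(0 < E \<sigma>2 (\<lambda>_. 0) (ExE 2 (Act 2))) = False" using ex by blast
    then have s': "R c_step \<sigma> = R skip \<sigma>2"
      unfolding c_step_def run.simps(2,3) \<sigma>1_def[symmetric] \<sigma>2_def[symmetric] by (simp only: ev_arith(1) if_False)
    have e: "posof (R c_step \<sigma>) = ?pos" "lamof (R c_step \<sigma>) = ?lam" "dof (R c_step \<sigma>) = ?d"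
      unfolding s' e2[symmetric] posof_def lamof_def dof_def by (simp_all add: run_skip)
    have "coupled (R c_step \<sigma>) nx"
      using c2 unfolding coupled_def e e2 masked_def unfolding s' by (simp add: run_skip)
    then show ?thesis unfolding progress_def e using L False by blast
  next
    case True
    then obtain v0 where v0: "active ?pos ?lam ?d v0" by blast
    from True have ex': "(0 < E \<sigma>2 (\<lambda>_. 0) (ExE 2 (Act 2))) = True" using ex by blast
    define t where "t = target ?pos ?lam ?d"
    have tact: "active ?pos ?lam ?d t" using target_topactive[OF v0] unfolding t_def topactive_def by blast
    then have tn: "t < n" unfolding active_def by simp
    define \<sigma>3 where "\<sigma>3 = R c_target \<sigma>2"
    have f3: "\<sigma>3 a = \<sigma>2 a" if "a \<noteq> r_target" for a unfolding \<sigma>3_def using that by (intro run_frame) (simp add: c_target_def)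
    have t3: "\<sigma>3 r_target 0 0 = int t" unfolding \<sigma>3_def t_def using run_target[OF x2] unfolding e2 .
    have e3: "posof \<sigma>3 = ?pos" "lamof \<sigma>3 = ?lam" "dof \<sigma>3 = ?d"
      unfolding e2[symmetric] posof_def lamof_def dof_def by (simp_all add: f3)
    have c3: "coupled \<sigma>3 nx" using c2 unfolding coupled_def e2 e3 masked_def by (simp add: f3)
    note src = run_source[where \<sigma> = \<sigma>3 and t = t, OF t3 tn, unfolded e3]
    have P': "pot ?pos ?lam ?d + m \<le> (n + 2) ^ 6" "nx \<le> 1 + n * m" using P v0 by auto
    show ?thesis
    proof (cases "\<exists>s. cand ?pos ?lam ?d t s")
      case False
      then have "(0 < E \<sigma>3 (\<lambda>_. 0) (ExE 2 Cand)) = False" using src(2) by blast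
      then have s': "R c_step \<sigma> = R c_relabel \<sigma>3"
        unfolding c_step_def run.simps(2,3) \<sigma>1_def[symmetric] \<sigma>2_def[symmetric]
        using ex' by (simp only: ev_arith(1) if_False if_True \<sigma>3_def[symmetric])
      have f': "R c_step \<sigma> a = \<sigma>3 a" if "a \<noteq> r_dist" for a
        unfolding s' using that by (intro run_frame) (simp add: c_relabel_def)
      have e: "posof (R c_step \<sigma>) = ?pos" "lamof (R c_step \<sigma>) = ?lam"
        unfolding e3[symmetric] posof_def lamof_def by (simp_all add: f')
      have d': "dof (R c_step \<sigma>) = ?d(t := ?d t + 1)"
        unfolding s' using run_relabel[where \<sigma> = \<sigma>3 and t = t, OF t3 tn] unfolding e3 .
      have "valid ?pos ?lam (?d(t := ?d t + 1))" using valid_relabel[OF v tact] False by blast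
      then have "coupled (R c_step \<sigma>) nx"
        using c3 unfolding coupled_def e e3 d' masked_def by (simp add: f')
      moreover have "pot ?pos ?lam (dof (R c_step \<sigma>)) < pot ?pos ?lam ?d"
        if "active ?pos ?lam (dof (R c_step \<sigma>)) w" for w
        by (rule pot_relabel[OF v v0 _ t_def d' that L]) (use False in blast)
      ultimately show ?thesis
        unfolding progress_def e using L P' by (intro exI[of _ nx]) force
    next
      case True
      then obtain s0 where s0: "cand ?pos ?lam ?d t s0" by blast
      define s where "s = source ?pos ?lam ?d t"
      have sc: "cand ?pos ?lam ?d t s" unfolding s_def by (rule cand_source[OF s0])
      define \<sigma>4 where "\<sigma>4 = R c_source \<sigma>3"
      define \<sigma>5 where "\<sigma>5 = R c_push \<sigma>4"
      let ?\<sigma>' = "R (Rep c_reduce) \<sigma>5"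
      have "(0 < E \<sigma>3 (\<lambda>_. 0) (ExE 2 Cand)) = True" using src(2) True by blast
      then have s': "R c_step \<sigma> = ?\<sigma>'"
        unfolding c_step_def run.simps(2,3) \<sigma>1_def[symmetric] \<sigma>2_def[symmetric]
        using ex' by (simp only: ev_arith(1) if_True \<sigma>3_def[symmetric] \<sigma>4_def[symmetric] \<sigma>5_def[symmetric])
      have f4: "\<sigma>4 a = \<sigma>3 a" if "a \<noteq> r_source" for a unfolding \<sigma>4_def using that by (intro run_frame) (simp add: c_source_def)
      have s4: "\<sigma>4 r_source 0 0 = int s" unfolding \<sigma>4_def s_def using src(1) .
      have e4: "posof \<sigma>4 = ?pos" "lamof \<sigma>4 = ?lam" "dof \<sigma>4 = ?d"
        unfolding e3[symmetric] posof_def lamof_def dof_def by (simp_all add: f4)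
      have c4: "coupled \<sigma>4 nx" using c3 unfolding coupled_def e3 e4 masked_def by (simp add: f4)
      \<comment> \<open>The potential bounds \<open>m\<close>, so there is room for the
        \<open>n\<close> rows of one more push.\<close>
      have "n * m \<le> n * (n + 2) ^ 6" using P' by (intro mult_left_mono) auto
      moreover have "(n + 1) * (n + 2) ^ 6 = n * (n + 2) ^ 6 + (n + 2) ^ 6" by (simp add: algebra_simps)
      ultimately have "nx + n \<le> N" using P'(2) N_large by linarith
      moreover have "\<sigma>4 r_x 0 w = xv (posof \<sigma>4) (lamof \<sigma>4) w" if "w < n" for w
        using x2[OF that] unfolding e2 e4 by (simp add: f3 f4)
      ultimately have p: "pushed ?pos ?lam ?d s t (wide ?pos ?lam s t) (posof \<sigma>5) (lamof \<sigma>5)"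
        "coupled \<sigma>5 (nx + n)" "sampled \<sigma>5" "dof \<sigma>5 = ?d"
        using run_push[OF c4, of t s] t3 s4 tact sc f4[of r_target] unfolding e4 \<sigma>5_def[symmetric] by auto
      obtain h where r: "coupled ?\<sigma>' (nx + n)" "posof ?\<sigma>' = posof \<sigma>5" "dof ?\<sigma>' = ?d"
        "live (lamof ?\<sigma>') \<subseteq> live (lamof \<sigma>5)" "0 < h"
        "\<forall>v<n. xv (posof \<sigma>5) (lamof ?\<sigma>') v = h * xv (posof \<sigma>5) (lamof \<sigma>5) v" "card (live (lamof ?\<sigma>')) \<le> n + 1"
        using run_reduce_loop[OF p(2,3)] unfolding p(4) by blast
      have "valid (posof \<sigma>5) (lamof ?\<sigma>') ?d" using r(1) unfolding coupled_def r(2,3) by blast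
      then have p': "pushed ?pos ?lam ?d s t (wide ?pos ?lam s t) (posof \<sigma>5) (lamof ?\<sigma>')"
        by (rule pushed_reduce[OF p(1) _ r(4,5,6) tn])
      have "pot (posof \<sigma>5) (lamof ?\<sigma>') ?d < pot ?pos ?lam ?d"
        if "active (posof \<sigma>5) (lamof ?\<sigma>') ?d w" for w
        by (rule pot_push[OF v v0 t_def s_def s0 refl p' that r(7)])
      moreover have "nx + n \<le> 1 + n * Suc m" using P'(2) by simp
      ultimately show ?thesis
        unfolding progress_def s' using r(1,7) P'(1) unfolding r(2,3) by (intro exI[of _ "nx + n"]) force
    qed
  qed
qed

lemma run_init:
  assumes "masked \<sigma>"
  shows "progress 0 (R c_init \<sigma>)"
proof -
  let ?\<sigma> = "R c_init \<sigma>"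
  have N0: "0 < N" "1 < N" using N_gt by auto
  have m: "masked ?\<sigma>" using assms by (rule masked_run) (auto simp: c_init_def)
  have r_next: "?\<sigma> r_next 0 0 = int 1" using N0 by (simp add: c_init_def)
  have d: "dof ?\<sigma> = (\<lambda>_. 0)" using N_gt by (auto simp: dof_def c_init_def fun_eq_iff)
  have l: "lamof ?\<sigma> j = of_bool (j = 0)" if "j < N" for j using that N0 by (simp add: lamof_def c_init_def)
  have L: "live (lamof ?\<sigma>) = {0}" unfolding live_def using l N0 by (auto split: if_splits simp: of_bool_def)
  have "posof ?\<sigma> 0 v = int v" if "v < n" for v using that N_gt unfolding posof_def by (simp add: c_init_def)
  then have "order (posof ?\<sigma> 0)" unfolding order_def inj_on_def by simp
  then have v: "valid (posof ?\<sigma>) (lamof ?\<sigma>) (dof ?\<sigma>)" unfolding valid_def L d using l by auto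
  have "coupled ?\<sigma> 1" unfolding coupled_def using m r_next v l by simp
  moreover have "card (live (lamof ?\<sigma>)) \<le> n + 1" unfolding L by simp
  ultimately show ?thesis unfolding progress_def using pot_bound[OF v] by (intro exI[of _ 1]) force
qed

text \<open>Since \<open>N\<close> exceeds \<open>(n + 2) ^ 6\<close>, the bound on the potential
  fails after \<open>N\<close> rounds, so nothing is active. Then some level set is optimal, hence
  also the best one.\<close>

theorem run_sfm:
  assumes m: "masked \<sigma>"
  shows "\<exists>j\<le>n. R c_sfm \<sigma> r_level 0 0 = int j \<and>
    (\<forall>W\<subseteq>{..<n}. G {v. v < n \<and> int j < R c_sfm \<sigma> r_dist 0 v} \<le> G W)"
proof -
  let ?f = "R c_step" and ?\<sigma>0 = "R c_init \<sigma>"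
  have "progress k ((?f ^^ k) ?\<sigma>0)" for k
    by (induction k) (use run_init[OF m] run_step in auto)
  from this[of N] have p: "progress N (R (Rep c_step) ?\<sigma>0)" by simp
  define \<sigma>1 where "\<sigma>1 = R (Rep c_step) ?\<sigma>0"
  obtain nx where c: "coupled \<sigma>1 nx" and P: "(\<forall>v. \<not> active (posof \<sigma>1) (lamof \<sigma>1) (dof \<sigma>1) v) \<or>
      pot (posof \<sigma>1) (lamof \<sigma>1) (dof \<sigma>1) + N \<le> (n + 2) ^ 6"
    using p unfolding \<sigma>1_def[symmetric] progress_def by blast
  have "(n + 2) ^ 6 \<le> (n + 1) * (n + 2) ^ 6" by simp
  then have "(n + 2) ^ 6 < N" using N_large by linarith
  then have na: "\<not> active (posof \<sigma>1) (lamof \<sigma>1) (dof \<sigma>1) v" for v using P by auto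
  have v: "valid (posof \<sigma>1) (lamof \<sigma>1) (dof \<sigma>1)" and m1: "masked \<sigma>1" using c unfolding coupled_def by auto
  let ?U = "\<lambda>j. {v. v < n \<and> int j < \<sigma>1 r_dist 0 v}"
  have U: "{v. v < n \<and> int j < dof \<sigma>1 v} = ?U j" for j unfolding dof_def by auto
  obtain j0 where j0: "j0 \<le> n" "\<forall>W\<subseteq>{..<n}. G (?U j0) \<le> G W"
    using level_minimiser[OF v na] unfolding U by blast
  have lev: "E \<sigma>1 \<rho> (Lev (Var w)) = G (?U (\<rho> w))" if "w \<noteq> 3" for \<rho> w
    unfolding Lev_def ev_Orcm[OF m1] using that by simp
  define j where "j = first N (\<lambda>j. j \<le> n \<and> (\<forall>i<N. i \<le> n \<longrightarrow> G (?U j) \<le> G (?U i)))"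
  have s': "R c_sfm \<sigma> = R c_best \<sigma>1" unfolding c_sfm_def \<sigma>1_def by simp
  have "R c_best \<sigma>1 r_level 0 0 = int j"
    unfolding c_best_def j_def using N_gt by (simp add: lev, intro first_cong) auto
  moreover have "j \<le> n \<and> (\<forall>i<N. i \<le> n \<longrightarrow> G (?U j) \<le> G (?U i))"
    unfolding j_def
  proof (rule first_satisfies[of _ j0])
    have "?U i \<subseteq> {..<n}" for i by auto
    then show "j0 \<le> n \<and> (\<forall>i<N. i \<le> n \<longrightarrow> G (?U j0) \<le> G (?U i))" using j0 by blast
    show "j0 < N" using j0 N_gt by simp
  qed
  moreover then have "G (?U j) \<le> G (?U j0)" using j0 N_gt by simp
  moreover have "R c_best \<sigma>1 r_dist = \<sigma>1 r_dist" by (rule run_frame) (simp add: c_best_def)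
  ultimately show ?thesis unfolding s' using j0(2) by (intro exI[of _ j]) (auto intro: order_trans)
qed

end

section \<open>The k-th smallest value\<close>

text \<open>The sets of value \<open>\<mu>\<close> are closed under union and intersection, so the
  choices made for single elements can be combined. Sizes at most 1, rather than exactly 1, cover
  \<open>X0 = {}\<close> and \<open>X0 = V\<close>.\<close>

lemma separating_pair:
  fixes f :: "'b set \<Rightarrow> int"
  assumes V: "finite V" and I: "X0 \<in> I"
    and Isub: "\<And>X. X \<in> I \<Longrightarrow> X \<subseteq> V"
    and closed: "\<And>X Y. X \<in> I \<Longrightarrow> Y \<in> I \<Longrightarrow> X \<union> Y \<in> I \<and> X \<inter> Y \<in> I"
    and sub: "\<And>X Y. X \<in> I \<Longrightarrow> Y \<in> I \<Longrightarrow> f (X \<union> Y) + f (X \<inter> Y) \<le> f X + f Y"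
    and min: "\<And>X. X \<in> I \<Longrightarrow> \<mu> \<le> f X" and X0: "f X0 \<noteq> \<mu>"
  shows "\<exists>A B. A \<subseteq> X0 \<and> B \<subseteq> V - X0 \<and> card A \<le> 1 \<and> card B \<le> 1 \<and>
    (\<forall>X\<in>I. A \<subseteq> X \<longrightarrow> X \<inter> B = {} \<longrightarrow> f X \<noteq> \<mu>)"
proof (rule ccontr)
  assume "\<not> ?thesis"
  then have all: "\<exists>X\<in>I. A \<subseteq> X \<and> X \<inter> B = {} \<and> f X = \<mu>"
    if "A \<subseteq> X0" "B \<subseteq> V - X0" "card A \<le> 1" "card B \<le> 1" for A B
    using that by blast
  have lat: "X \<union> Y \<in> I \<and> X \<inter> Y \<in> I \<and> f (X \<union> Y) = \<mu> \<and> f (X \<inter> Y) = \<mu>"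
    if "X \<in> I" "Y \<in> I" "f X = \<mu>" "f Y = \<mu>" for X Y
    using closed[OF that(1,2)] sub[OF that(1,2)] min[of "X \<union> Y"] min[of "X \<inter> Y"] that by auto
  have fin: "finite (V - X0)" "finite X0" using V Isub[OF I] finite_subset by auto
  have avoid: "\<exists>X\<in>I. A \<subseteq> X \<and> X \<inter> B = {} \<and> f X = \<mu>" if A: "A \<subseteq> X0" "card A \<le> 1" and B: "B \<subseteq> V - X0" for A B
    using finite_subset[OF B fin(1)] B
  proof (induction B rule: finite_induct)
    case empty
    then show ?case using all[of A "{}"] A by simp
  next
    case (insert b B)
    then obtain X Y where "X \<in> I" "A \<subseteq> X" "X \<inter> B = {}" "f X = \<mu>" "Y \<in> I" "A \<subseteq> Y" "Y \<inter> {b} = {}" "f Y = \<mu>"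
      using all[of A "{b}"] A by auto
    then show ?case using lat[of X Y] by (intro bexI[of _ "X \<inter> Y"]) auto
  qed
  have "\<exists>X\<in>I. A \<subseteq> X \<and> X \<inter> (V - X0) = {} \<and> f X = \<mu>" if A: "A \<subseteq> X0" for A
    using finite_subset[OF A fin(2)] A
  proof (induction A rule: finite_induct)
    case empty
    then show ?case using avoid[of "{}" "V - X0"] by simp
  next
    case (insert a A)
    then obtain X Y where "X \<in> I" "A \<subseteq> X" "X \<inter> (V - X0) = {}" "f X = \<mu>"
      "Y \<in> I" "{a} \<subseteq> Y" "Y \<inter> (V - X0) = {}" "f Y = \<mu>"
      using avoid[of "{a}" "V - X0"] by auto
    then show ?case using lat[of X Y] by (intro bexI[of _ "X \<union> Y"]) auto
  qed
  then obtain X where "X \<in> I" "X0 \<subseteq> X" "X \<inter> (V - X0) = {}" "f X = \<mu>" by blast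
  then have "X = X0" using Isub by blast
  then show False using X0 \<open>f X = \<mu>\<close> by simp
qed

text \<open>Induction on a bound for the number of values below \<open>f X0\<close> still attained
  in the interval. A separation makes the smallest of them disappear, and \<open>X0\<close> stays in
  the interval because \<open>A\<close> lies inside it and \<open>B\<close> outside.\<close>

lemma isolating_interval:
  fixes f :: "'b set \<Rightarrow> int"
  assumes V: "finite V" and X0: "X0 \<subseteq> V" and S: "S \<subseteq> X0" "T \<subseteq> V - X0"
    and sub: "\<And>X Y. X \<subseteq> V \<Longrightarrow> Y \<subseteq> V \<Longrightarrow> f (X \<union> Y) + f (X \<inter> Y) \<le> f X + f Y"
    and r: "card {y. (\<exists>X. S \<subseteq> X \<and> X \<subseteq> V - T \<and> y = f X) \<and> y < f X0} \<le> r"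
  shows "\<exists>S' T'. S' \<subseteq> X0 \<and> T' \<subseteq> V - X0 \<and> card S' \<le> card S + r \<and> card T' \<le> card T + r \<and>
    (\<forall>X. S' \<subseteq> X \<longrightarrow> X \<subseteq> V - T' \<longrightarrow> f X0 \<le> f X)"
  using S r
proof (induction r arbitrary: S T)
  case (0 S T)
  let ?Y = "{y. (\<exists>X. S \<subseteq> X \<and> X \<subseteq> V - T \<and> y = f X) \<and> y < f X0}"
  have "finite ?Y" by (rule finite_subset[of _ "f ` Pow V"]) (use V in auto)
  then have Y: "?Y = {}" using 0 by simp
  have "f X0 \<le> f X" if "S \<subseteq> X" "X \<subseteq> V - T" for X
  proof (rule ccontr)
    assume "\<not> f X0 \<le> f X"
    then have "f X \<in> ?Y" using that by auto
    then show False using Y by blast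
  qed
  then show ?case using 0 by auto
next
  case (Suc r S T)
  let ?I = "{X. S \<subseteq> X \<and> X \<subseteq> V - T}"
  let ?Y = "{y. (\<exists>X. S \<subseteq> X \<and> X \<subseteq> V - T \<and> y = f X) \<and> y < f X0}"
  have finY: "finite ?Y" by (rule finite_subset[of _ "f ` Pow V"]) (use V in auto)
  show ?case
  proof (cases "?Y = {}")
    case True
    have "f X0 \<le> f X" if "S \<subseteq> X" "X \<subseteq> V - T" for X
    proof (rule ccontr)
      assume "\<not> f X0 \<le> f X"
      then have "f X \<in> ?Y" using that by auto
      then show False using True by blast
    qed
    then show ?thesis using Suc.prems(1,2) by (intro exI[of _ S] exI[of _ T]) simp
  next
    case False
    define \<mu> where "\<mu> = Min ?Y"
    have \<mu>: "\<mu> \<in> ?Y" unfolding \<mu>_def using finY False by (rule Min_in)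
    have min: "\<mu> \<le> f X" if "X \<in> ?I" for X
    proof (cases "f X < f X0")
      case True
      then have "f X \<in> ?Y" using that by blast
      then show ?thesis unfolding \<mu>_def using finY by (intro Min_le)
    qed (use \<mu> in auto)
    have "\<exists>A B. A \<subseteq> X0 \<and> B \<subseteq> V - X0 \<and> card A \<le> 1 \<and> card B \<le> 1 \<and>
      (\<forall>X\<in>?I. A \<subseteq> X \<longrightarrow> X \<inter> B = {} \<longrightarrow> f X \<noteq> \<mu>)"
    proof (rule separating_pair[OF V])
      show "X0 \<in> ?I" using Suc.prems X0 by auto
      show "f (X \<union> Y) + f (X \<inter> Y) \<le> f X + f Y" if "X \<in> ?I" "Y \<in> ?I" for X Y
        using that by (intro sub) auto
      show "f X0 \<noteq> \<mu>" using \<mu> by auto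
    qed (use min in auto)
    then obtain A B where AB: "A \<subseteq> X0" "B \<subseteq> V - X0" "card A \<le> 1" "card B \<le> 1"
      "\<forall>X\<in>?I. A \<subseteq> X \<longrightarrow> X \<inter> B = {} \<longrightarrow> f X \<noteq> \<mu>" by (elim exE conjE)
    let ?Y' = "{y. (\<exists>X. S \<union> A \<subseteq> X \<and> X \<subseteq> V - (T \<union> B) \<and> y = f X) \<and> y < f X0}"
    have "?Y' \<subseteq> ?Y - {\<mu>}"
    proof
      fix y assume "y \<in> ?Y'"
      then obtain X where X: "S \<union> A \<subseteq> X" "X \<subseteq> V - (T \<union> B)" "y = f X" "y < f X0" by blast
      then have "X \<in> ?I" "A \<subseteq> X" "X \<inter> B = {}" by auto
      then have "y \<noteq> \<mu>" using AB(5) X(3) by blast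
      then show "y \<in> ?Y - {\<mu>}" using X \<open>X \<in> ?I\<close> by blast
    qed
    then have "card ?Y' \<le> card (?Y - {\<mu>})" using finY by (intro card_mono) auto
    also have "\<dots> \<le> r" using Suc.prems(3) \<mu> finY by (simp add: card_Diff_singleton)
    finally have r': "card ?Y' \<le> r" .
    have "\<exists>S' T'. S' \<subseteq> X0 \<and> T' \<subseteq> V - X0 \<and> card S' \<le> card (S \<union> A) + r \<and> card T' \<le> card (T \<union> B) + r \<and>
      (\<forall>X. S' \<subseteq> X \<longrightarrow> X \<subseteq> V - T' \<longrightarrow> f X0 \<le> f X)"
      by (rule Suc.IH) (use Suc.prems AB r' in auto)
    then obtain S' T' where ST: "S' \<subseteq> X0" "T' \<subseteq> V - X0" "card S' \<le> card (S \<union> A) + r" "card T' \<le> card (T \<union> B) + r"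
      "\<forall>X. S' \<subseteq> X \<longrightarrow> X \<subseteq> V - T' \<longrightarrow> f X0 \<le> f X" by (elim exE conjE)
    have "card (S \<union> A) + r \<le> card S + Suc r" "card (T \<union> B) + r \<le> card T + Suc r"
      using card_Un_le[of S A] card_Un_le[of T B] AB(3,4) by auto
    then have "card S' \<le> card S + Suc r" "card T' \<le> card T + Suc r" using ST(3,4) by linarith+
    then show ?thesis using ST(1,2,5) by (intro exI[of _ S'] exI[of _ T'] conjI)
  qed
qed

text \<open>A number \<open>m\<close> encodes the pair \<open>(S, T)\<close> by \<open>2 * l\<close> digits in base \<open>n + 1\<close>, where the digit \<open>n\<close> stands
  for no element.\<close>

definition digit :: "nat \<Rightarrow> nat \<Rightarrow> nat \<Rightarrow> nat" where "digit b m i = m div b ^ i mod b"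

text \<open>Horner's scheme: the induction puts a new lowest digit in front.\<close>

lemma digits_exist:
  assumes "\<And>i. i < l \<Longrightarrow> g i < b"
  shows "\<exists>m < b ^ l. \<forall>i<l. digit b m i = g i"
  using assms
proof (induction l arbitrary: g)
  case (Suc l)
  have "\<exists>m<b ^ l. \<forall>i<l. digit b m i = g (Suc i)" by (rule Suc.IH) (use Suc.prems in auto)
  then obtain m where m: "m < b ^ l" "\<forall>i<l. digit b m i = g (Suc i)" by blast
  have g0: "g 0 < b" using Suc.prems by simp
  have "g 0 + b * m < b * Suc m" using g0 by simp
  also have "\<dots> \<le> b * b ^ l" using m by (intro mult_left_mono) auto
  finally have "g 0 + b * m < b ^ Suc l" by simp
  moreover have "digit b (g 0 + b * m) i = g i" if "i < Suc l" for i
  proof (cases i)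
    case 0
    then show ?thesis using g0 unfolding digit_def by simp
  next
    case (Suc j)
    have "(g 0 + b * m) div b = m" using g0 by simp
    then have "(g 0 + b * m) div b ^ Suc j = m div b ^ j" by (simp add: div_mult2_eq)
    then show ?thesis using m(2) that Suc unfolding digit_def by simp
  qed
  ultimately show ?case by blast
qed simp

lemma enumerate_padded:
  assumes "S \<subseteq> {..<n::nat}" "card S \<le> l"
  shows "\<exists>g. (\<forall>i<l. g i < n + 1) \<and> {v. v < n \<and> (\<exists>i<l. v = g i)} = S"
proof -
  have fin: "finite S" using assms finite_subset by blast
  define xs where "xs = sorted_list_of_set S"
  have xs: "set xs = S" "length xs \<le> l" unfolding xs_def using fin assms(2) by auto
  define g where "g i = (if i < length xs then xs ! i else n)" for i
  have 1: "\<exists>i<l. v = g i" if v: "v \<in> S" for v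
  proof -
    obtain i where "i < length xs" "v = xs ! i" using v xs(1) by (auto simp: in_set_conv_nth)
    then show ?thesis using xs(2) unfolding g_def by (intro exI[of _ i]) auto
  qed
  have 2: "g i \<in> S \<or> g i = n" for i using xs(1) nth_mem[of i xs] unfolding g_def by auto
  have "{v. v < n \<and> (\<exists>i<l. v = g i)} = S"
  proof (intro set_eqI iffI)
    show "v \<in> S" if "v \<in> {v. v < n \<and> (\<exists>i<l. v = g i)}" for v using that 2 by auto
    show "v \<in> {v. v < n \<and> (\<exists>i<l. v = g i)}" if "v \<in> S" for v using 1[OF that] that assms(1) by auto
  qed
  moreover have "g i < n + 1" for i
  proof -
    have "g i \<in> {..<n} \<or> g i = n" using 2[of i] assms(1) by blast
    then show ?thesis by auto
  qed
  then have "\<forall>i<l. g i < n + 1" by blast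
  ultimately show ?thesis by (intro exI[of _ g] conjI)
qed

text \<open>Translates a position in the sorted list into a number of smaller values, which is what
  the program can count.\<close>

lemma sorted_list_rank:
  fixes Z :: "int set"
  assumes "finite Z" "i < card Z"
  shows "sorted_list_of_set Z ! i \<in> Z" "card {y \<in> Z. y < sorted_list_of_set Z ! i} = i"
proof -
  let ?xs = "sorted_list_of_set Z"
  have l: "length ?xs = card Z" "set ?xs = Z" "distinct ?xs" and s: "sorted_wrt (<) ?xs" using assms(1) by auto
  show "?xs ! i \<in> Z" using l assms(2) nth_mem by metis
  have lt: "?xs ! j < ?xs ! i \<longleftrightarrow> j < i" if "j < card Z" for j
    using sorted_wrt_nth_less[OF s, of j i] sorted_wrt_nth_less[OF s, of i j] that assms(2) l
    by (metis less_asym less_irrefl linorder_neqE_nat)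
  have "{y \<in> Z. y < ?xs ! i} = (\<lambda>j. ?xs ! j) ` {..<i}"
  proof -
    have "Z = (\<lambda>j. ?xs ! j) ` {..<card Z}" using l(1,2) by (metis nth_image take_all_iff order_refl atLeast0LessThan)
    then have Z: "y \<in> Z \<longleftrightarrow> (\<exists>j<card Z. y = ?xs ! j)" for y by blast
    show ?thesis
    proof (intro set_eqI iffI)
      fix y assume "y \<in> {y \<in> Z. y < ?xs ! i}"
      then obtain j where "j < card Z" "y = ?xs ! j" "y < ?xs ! i" using Z by auto
      then show "y \<in> (\<lambda>j. ?xs ! j) ` {..<i}" using lt[of j] by auto
    next
      fix y assume "y \<in> (\<lambda>j. ?xs ! j) ` {..<i}"
      then obtain j where "j < i" "y = ?xs ! j" by auto
      moreover then have "j < card Z" using assms(2) by simp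
      ultimately show "y \<in> {y \<in> Z. y < ?xs ! i}" using lt[of j] Z[of y] by blast
    qed
  qed
  moreover have "inj_on (\<lambda>j. ?xs ! j) {..<i}"
    using l assms(2) by (auto simp: inj_on_def nth_eq_iff_index_eq)
  ultimately show "card {y \<in> Z. y < ?xs ! i} = i" by (simp add: card_image)
qed

lemma rank_unique:
  fixes Z :: "int set"
  assumes "finite Z" "a \<in> Z" "b \<in> Z" "card {y \<in> Z. y < a} = card {y \<in> Z. y < b}"
  shows "a = b"
proof -
  have "card {y \<in> Z. y < a} < card {y \<in> Z. y < b}" if "a < b" "a \<in> Z" for a b
    by (rule psubset_card_mono) (use assms(1) that in auto)
  from this[of a b] this[of b a] show ?thesis using assms by (cases a b rule: linorder_cases) auto
qed

text \<open>Expressions can only count indices, so distinct values are counted by the indices where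
  a value occurs first.\<close>

lemma card_first_occurrences:
  "card {p. p < N \<and> P (g p) \<and> \<not> (\<exists>q<p. g q = g p)} = card {y \<in> g ` {..<N}. P y}" for N :: nat
proof (rule bij_betw_same_card[of g])
  show "bij_betw g {p. p < N \<and> P (g p) \<and> \<not> (\<exists>q<p. g q = g p)} {y \<in> g ` {..<N}. P y}"
    unfolding bij_betw_def
  proof (intro conjI set_eqI iffI)
    show "inj_on g {p. p < N \<and> P (g p) \<and> \<not> (\<exists>q<p. g q = g p)}"
      unfolding inj_on_def by (auto, metis linorder_neqE_nat)
    fix y assume "y \<in> {y \<in> g ` {..<N}. P y}"
    then obtain p where p: "p < N" "g p = y" "P y" by auto
    define p0 where "p0 = (LEAST p. g p = y)"
    have "g p0 = y" unfolding p0_def using p(2) by (rule LeastI)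
    moreover have "p0 \<le> p" unfolding p0_def using p(2) by (rule Least_le)
    moreover have "g q \<noteq> y" if "q < p0" for q using not_less_Least that unfolding p0_def by blast
    ultimately have "p0 \<in> {p. p < N \<and> P (g p) \<and> \<not> (\<exists>q<p. g q = g p)}" using p by auto
    then show "y \<in> g ` {p. p < N \<and> P (g p) \<and> \<not> (\<exists>q<p. g q = g p)}" using \<open>g p0 = y\<close> by blast
  qed auto
qed

section \<open>The program for the k-th smallest value\<close>

abbreviation r_out :: nat where "r_out \<equiv> 30"
abbreviation r_choice :: nat where "r_choice \<equiv> 31"

primrec Bpow :: "nat \<Rightarrow> ex" where
  "Bpow 0 = 1"
| "Bpow (Suc i) = (Dim + 1) * Bpow i"

text \<open>A quotient without division: with \<open>m\<close> the index and
  \<open>b = n + 1\<close>, it counts the \<open>w\<close> such that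
  \<open>(w + 1) * b ^ i \<le> m\<close>. The bound \<open>N\<close> of the sum is no restriction,
  as \<open>m < N\<close>.\<close>

definition Quo :: "nat \<Rightarrow> ex" where "Quo i = Summ 2 (LeE ((Var 2 + 1) * Bpow i) (A0 r_index))"

definition Dig :: "nat \<Rightarrow> ex" where "Dig i = Quo i - (Dim + 1) * Quo (Suc i)"

primrec Hit :: "nat \<Rightarrow> nat \<Rightarrow> ex" where
  "Hit off 0 = 0"
| "Hit off (Suc l) = IfE (EqE (Var 1) (Dig (off + l))) 1 (Hit off l)"

definition c_store :: pr where
  "c_store = Then (Asg r_sets 0 1 (IfE (EqE (Var 0) (A0 r_index))
        (IfE (A1 r_exc (Var 1)) 0 (IfE (A1 r_inc (Var 1)) 1 (LtE (A0 r_level) (A1 r_dist (Var 1)))))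
        (Arr r_sets (Var 0) (Var 1))))
     (Asg r_vals 0 1 (IfE (EqE (Var 1) (A0 r_index)) (Orc 2 (Arr r_sets (A0 r_index) (Var 2))) (A1 r_vals (Var 1))))"

definition c_round :: "nat \<Rightarrow> pr" where
  "c_round l = Then (Asg r_inc 0 1 (Hit 0 l)) (Then (Asg r_exc 0 1 (Hit l l)) (Then c_sfm (Then c_store
     (Asg r_index 0 1 (A0 r_index + 1)))))"

definition c_select :: "nat \<Rightarrow> pr" where
  "c_select l = Then (Asg r_choice 0 1 (Mu 2 (EqE (Lit (int l))
       (Summ 3 (LtE (A1 r_vals (Var 3)) (A1 r_vals (Var 2)) *
          NotE (ExE 4 (LtE (Var 4) (Var 3) * EqE (A1 r_vals (Var 4)) (A1 r_vals (Var 3)))))))))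
     (Asg r_out 0 1 (Arr r_sets (A0 r_choice) (Var 1)))"

definition c_kth :: "nat \<Rightarrow> pr" where
  "c_kth l = Then (Asg r_index 0 1 0) (Then (Rep (c_round l)) (c_select l))"

lemma sum_of_bool: "(\<Sum>i<N. of_bool (P i)) = int (card {i. i < N \<and> P i})" for N :: nat
  by (simp add: of_bool_def sum.If_cases Collect_conj_eq lessThan_def)

lemma ev_Quo:
  assumes "\<sigma> r_index 0 0 = int m" "m < N"
  shows "ev n N F \<sigma> \<rho> (Quo i) = int (m div (n + 1) ^ i)"
proof -
  let ?b = "(n + 1) ^ i"
  have b: "ev n N F \<sigma> \<rho> (Bpow i) = int ((n + 1) ^ i)" for \<rho> by (induction i) (auto simp: algebra_simps)
  have "(int w + 1) * int ?b \<le> int m \<longleftrightarrow> w < m div ?b" for w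
  proof -
    have "(int w + 1) * int ?b \<le> int m \<longleftrightarrow> Suc w * ?b \<le> m"
      by (metis of_nat_Suc of_nat_le_iff of_nat_mult add.commute)
    also have "\<dots> \<longleftrightarrow> Suc w \<le> m div ?b" by (simp add: less_eq_div_iff_mult_less_eq)
    finally show ?thesis by (simp add: Suc_le_eq)
  qed
  then have "ev n N F \<sigma> \<rho> (Quo i) = int (card {w. w < N \<and> w < m div ?b})"
    using assms(1) unfolding Quo_def by (simp add: b sum_of_bool del: of_nat_power)
  moreover have "m div ?b < N" using assms(2) le_less_trans[OF div_le_dividend] by blast
  then have "{w. w < N \<and> w < m div ?b} = {..<m div ?b}" by auto
  ultimately show ?thesis by simp
qed

lemma ev_Dig:
  assumes "\<sigma> r_index 0 0 = int m" "m < N"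
  shows "ev n N F \<sigma> \<rho> (Dig i) = int (digit (n + 1) m i)"
proof -
  have "m div (n + 1) ^ Suc i = m div (n + 1) ^ i div (n + 1)" by (simp only: power_Suc2 div_mult2_eq)
  then have "int (digit (n + 1) m i) = int (m div (n + 1) ^ i) - int ((n + 1) * (m div (n + 1) ^ Suc i))"
    unfolding digit_def by (simp only: minus_mult_div_eq_mod[symmetric] of_nat_diff times_div_less_eq_dividend)
  then show ?thesis unfolding Dig_def
    by (simp only: ev_arith ev.simps(2) ev_Quo[where \<sigma> = \<sigma>, OF assms]) (simp only: of_nat_mult of_nat_add of_nat_1)
qed

lemma ev_Hit:
  assumes "\<sigma> r_index 0 0 = int m" "m < N"
  shows "ev n N F \<sigma> \<rho> (Hit off l) \<noteq> 0 \<longleftrightarrow> (\<exists>i<l. \<rho> 1 = digit (n + 1) m (off + i))"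
  by (induction l) (auto simp: ev_Dig[where \<sigma> = \<sigma>, OF assms] less_Suc_eq)

lemma writes_sfm: "writes c_sfm \<subseteq> {2..27} - {24, 25, 26}"
  by (simp add: c_defs)

text \<open>\<open>idx\<close> lets the loop try every code of a pair. Rounds with larger codes are
  harmless, since each of them records a genuine value of \<open>F\<close>.\<close>

locale kth_search =
  fixes n N l :: nat and F :: "nat set \<Rightarrow> int"
  assumes sub: "X \<subseteq> {..<n} \<Longrightarrow> Y \<subseteq> {..<n} \<Longrightarrow> F (X \<union> Y) + F (X \<inter> Y) \<le> F X + F Y"
    and large: "(n + 1) * (n + 2) ^ 6 + n + 2 \<le> N" and idx: "(n + 1) ^ (2 * l) \<le> N"
begin

definition inc :: "nat \<Rightarrow> nat set" where "inc m = {v. v < n \<and> (\<exists>i<l. v = digit (n + 1) m i)}"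
definition exc :: "nat \<Rightarrow> nat set" where "exc m = {v. v < n \<and> (\<exists>i<l. v = digit (n + 1) m (l + i))}"

definition found :: "store \<Rightarrow> nat \<Rightarrow> nat set" where "found \<sigma> m = {v. v < n \<and> \<sigma> r_sets m v \<noteq> 0}"

text \<open>For some codes the two sets overlap; then \<open>exc\<close> prevails, and the recorded
  value still belongs to an actual set.\<close>

definition logged :: "store \<Rightarrow> nat \<Rightarrow> bool" where
  "logged \<sigma> m \<longleftrightarrow> \<sigma> r_vals 0 m = F (found \<sigma> m) \<and> inc m - exc m \<subseteq> found \<sigma> m \<and> found \<sigma> m \<inter> exc m = {} \<and>
     (\<forall>W\<subseteq>{..<n}. F (found \<sigma> m) \<le> F ((W \<union> inc m) - exc m))"

lemma run_round:
  assumes m: "\<sigma> r_index 0 0 = int m" "m < N" and old: "\<And>p. p < m \<Longrightarrow> logged \<sigma> p"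
  defines "\<sigma>' \<equiv> run n N F (c_round l) \<sigma>"
  shows "\<sigma>' r_index 0 0 = int (Suc m) \<and> (\<forall>p<Suc m. logged \<sigma>' p)"
proof -
  let ?R = "run n N F" and ?G = "\<lambda>X. F ((X \<union> inc m) - exc m)"
  have inN: "inc m \<subseteq> {..<n}" unfolding inc_def by auto
  have nN: "n < N" "0 < N" using large by auto
  define \<sigma>1 where "\<sigma>1 = ?R (Asg r_inc 0 1 (Hit 0 l)) \<sigma>"
  define \<sigma>2 where "\<sigma>2 = ?R (Asg r_exc 0 1 (Hit l l)) \<sigma>1"
  define \<sigma>3 where "\<sigma>3 = ?R c_sfm \<sigma>2"
  define \<sigma>4 where "\<sigma>4 = ?R (Asg r_sets 0 1 (IfE (EqE (Var 0) (A0 r_index))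
        (IfE (A1 r_exc (Var 1)) 0 (IfE (A1 r_inc (Var 1)) 1 (LtE (A0 r_level) (A1 r_dist (Var 1)))))
        (Arr r_sets (Var 0) (Var 1)))) \<sigma>3"
  define \<sigma>5 where "\<sigma>5 = ?R (Asg r_vals 0 1 (IfE (EqE (Var 1) (A0 r_index)) (Orc 2 (Arr r_sets (A0 r_index) (Var 2))) (A1 r_vals (Var 1)))) \<sigma>4"
  have s': "\<sigma>' = ?R (Asg r_index 0 1 (A0 r_index + 1)) \<sigma>5"
    unfolding \<sigma>'_def c_round_def c_store_def \<sigma>5_def \<sigma>4_def \<sigma>3_def \<sigma>2_def \<sigma>1_def by simp
  have f1: "\<sigma>1 a = \<sigma> a" if "a \<noteq> r_inc" for a unfolding \<sigma>1_def using that by (intro run_frame) simp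
  have f2: "\<sigma>2 a = \<sigma>1 a" if "a \<noteq> r_exc" for a unfolding \<sigma>2_def using that by (intro run_frame) simp
  have f3: "\<sigma>3 a = \<sigma>2 a" if "a \<notin> {2..27} - {24, 25, 26}" for a
    unfolding \<sigma>3_def using that writes_sfm by (intro run_frame) blast
  have f4: "\<sigma>4 a = \<sigma>3 a" if "a \<noteq> r_sets" for a unfolding \<sigma>4_def using that by (intro run_frame) simp
  have f5: "\<sigma>5 a = \<sigma>4 a" if "a \<noteq> r_vals" for a unfolding \<sigma>5_def using that by (intro run_frame) simp
  have f': "\<sigma>' a = \<sigma>5 a" if "a \<noteq> r_index" for a unfolding s' using that by (intro run_frame) simp
  have r_inc: "\<sigma>2 r_inc 0 v \<noteq> 0 \<longleftrightarrow> v \<in> inc m" if "v < n" for v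
    unfolding f2[of r_inc, simplified] \<sigma>1_def inc_def
    using that nN ev_Hit[where \<sigma> = \<sigma> and off = 0, OF m] by simp
  have m1: "\<sigma>1 r_index 0 0 = int m" using m(1) by (simp add: f1)
  have r_exc: "\<sigma>2 r_exc 0 v \<noteq> 0 \<longleftrightarrow> v \<in> exc m" if "v < n" for v
    unfolding \<sigma>2_def exc_def
    using that nN ev_Hit[where \<sigma> = \<sigma>1 and off = l, OF m1 m(2)] by simp
  interpret S: sfm n N ?G F
  proof
    show "n \<le> N" using nN by simp
    fix X Y assume XY: "X \<subseteq> {..<n}" "Y \<subseteq> {..<n}"
    have "(X \<union> Y \<union> inc m) - exc m = ((X \<union> inc m) - exc m) \<union> ((Y \<union> inc m) - exc m)"
      "(X \<inter> Y \<union> inc m) - exc m = ((X \<union> inc m) - exc m) \<inter> ((Y \<union> inc m) - exc m)" by auto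
    moreover have "F (((X \<union> inc m) - exc m) \<union> ((Y \<union> inc m) - exc m)) +
        F (((X \<union> inc m) - exc m) \<inter> ((Y \<union> inc m) - exc m)) \<le> ?G X + ?G Y"
      using XY inN by (intro sub) blast+
    ultimately show "?G (X \<union> Y) + ?G (X \<inter> Y) \<le> ?G X + ?G Y" by (simp only:)
  qed (rule large)
  have "S.masked \<sigma>2"
    unfolding S.masked_def
  proof (intro allI impI arg_cong[where f = F])
    fix X :: "nat set" assume "X \<subseteq> {..<n}"
    then show "{i. i < n \<and> \<sigma>2 r_exc 0 i = 0 \<and> (\<sigma>2 r_inc 0 i \<noteq> 0 \<or> i \<in> X)} = (X \<union> inc m) - exc m"
      using r_inc r_exc inN by (auto simp: subset_iff)
  qed
  then obtain j where j: "\<sigma>3 r_level 0 0 = int j" "\<forall>W\<subseteq>{..<n}. ?G {v. v < n \<and> int j < \<sigma>3 r_dist 0 v} \<le> ?G W"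
    using S.run_sfm unfolding \<sigma>3_def by blast
  have mM3: "\<sigma>3 r_index 0 0 = int m" using m1 by (simp add: f3 f2)
  have re: "\<sigma>' r_sets = \<sigma>4 r_sets" by (simp add: f' f5)
  have f_new: "found \<sigma>' m = ({v. v < n \<and> int j < \<sigma>3 r_dist 0 v} \<union> inc m) - exc m"
  proof -
    have "\<sigma>4 r_sets m v \<noteq> 0 \<longleftrightarrow> v \<notin> exc m \<and> (v \<in> inc m \<or> int j < \<sigma>3 r_dist 0 v)" if "v < n" for v
      using that nN m(2) mM3 j(1) r_inc[OF that] r_exc[OF that] f3[of r_inc] f3[of r_exc] unfolding \<sigma>4_def by auto
    then show ?thesis unfolding found_def re using inN by (auto simp: subset_iff)
  qed
  have f_old: "found \<sigma>' p = found \<sigma> p" if "p < m" for p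
  proof -
    have "p < N" "p \<noteq> m" using that m(2) by auto
    then have "\<sigma>4 r_sets p v = \<sigma> r_sets p v" for v
      unfolding \<sigma>4_def using mM3 f3[of r_sets] f2[of r_sets] f1[of r_sets] nN by simp
    then show ?thesis unfolding found_def re by simp
  qed
  have mM4: "\<sigma>4 r_index 0 0 = int m" using mM3 by (simp add: f4)
  have v_new: "\<sigma>' r_vals 0 m = F (found \<sigma>' m)"
    unfolding f'[of r_vals, simplified] \<sigma>5_def found_def re using nN m(2) mM4 by simp
  have v_old: "\<sigma>' r_vals 0 p = \<sigma> r_vals 0 p" if "p < m" for p
    unfolding f'[of r_vals, simplified] \<sigma>5_def using that nN m(2) mM4 f4[of r_vals] f3[of r_vals] f2[of r_vals] f1[of r_vals] by simp
  have "logged \<sigma>' m"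
    unfolding logged_def using v_new j(2) unfolding f_new by auto
  moreover have "logged \<sigma>' p" if "p < m" for p
    using old[OF that] unfolding logged_def f_old[OF that] v_old[OF that] .
  moreover have "\<sigma>' r_index 0 0 = int (Suc m)" unfolding s' using nN mM4 by (simp add: f5)
  ultimately show ?thesis by (auto simp: less_Suc_eq)
qed

text \<open>Let \<open>m\<close> encode the pair that isolates \<open>X0\<close>. No set of that
  interval has a value below \<open>F X0\<close>, and \<open>X0\<close> itself competes in the
  minimisation, since adding \<open>S\<close> and removing \<open>T\<close> leave it
  unchanged.\<close>

lemma logged_covers:
  assumes log: "\<And>m. m < N \<Longrightarrow> logged \<sigma> m" and X0: "X0 \<subseteq> {..<n}"
    and r: "card {y \<in> F ` Pow {..<n}. y < F X0} \<le> l"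
  shows "\<exists>m<N. \<sigma> r_vals 0 m = F X0"
proof -
  have "{y. (\<exists>X. {} \<subseteq> X \<and> X \<subseteq> {..<n} - {} \<and> y = F X) \<and> y < F X0} = {y \<in> F ` Pow {..<n}. y < F X0}" by auto
  then obtain S T where S: "S \<subseteq> X0" "T \<subseteq> {..<n} - X0" "card S \<le> l" "card T \<le> l"
    and opt: "\<And>X. S \<subseteq> X \<Longrightarrow> X \<subseteq> {..<n} - T \<Longrightarrow> F X0 \<le> F X"
    using isolating_interval[of "{..<n}" X0 "{}" "{}" F l] X0 sub r by auto
  obtain g where g: "\<forall>i<l. g i < n + 1" "{v. v < n \<and> (\<exists>i<l. v = g i)} = S"
    using enumerate_padded[of S n l] S(1,3) X0 by blast
  obtain h where h: "\<forall>i<l. h i < n + 1" "{v. v < n \<and> (\<exists>i<l. v = h i)} = T"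
    using enumerate_padded[of T n l] S(2,4) by blast
  have "\<exists>m < (n + 1) ^ (2 * l). \<forall>i<2 * l. digit (n + 1) m i = (if i < l then g i else h (i - l))"
    by (rule digits_exist) (use g h in auto)
  then obtain m where m: "m < (n + 1) ^ (2 * l)"
    "\<And>i. i < 2 * l \<Longrightarrow> digit (n + 1) m i = (if i < l then g i else h (i - l))" by blast
  have "digit (n + 1) m i = g i" "digit (n + 1) m (l + i) = h i" if "i < l" for i
    using m(2)[of i] m(2)[of "l + i"] that by auto
  then have inc: "inc m = S" and exc: "exc m = T"
    unfolding inc_def exc_def g(2)[symmetric] h(2)[symmetric] by auto
  have mN: "m < N" using m(1) idx by simp
  have "found \<sigma> m \<subseteq> {..<n}" unfolding found_def by auto
  moreover have "S - T = S" using S by auto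
  ultimately have "F X0 \<le> F (found \<sigma> m)"
    using log[OF mN] unfolding logged_def inc exc by (intro opt) auto
  moreover have "(X0 \<union> S) - T = X0" using S by auto
  then have "F (found \<sigma> m) \<le> F X0"
    using log[OF mN] X0 unfolding logged_def inc exc by metis
  ultimately show ?thesis using log[OF mN] mN unfolding logged_def by auto
qed

text \<open>All recorded values are values of \<open>F\<close>, and those up to the sought one are
  all recorded, so rank \<open>l\<close> among the recorded values identifies it.\<close>

theorem run_kth:
  assumes k: "l < card (F ` Pow {..<n})"
  shows "F {v. v < n \<and> run n N F (c_kth l) \<sigma>0 r_out 0 v \<noteq> 0} = sorted_list_of_set (F ` Pow {..<n}) ! l"
proof -
  let ?R = "run n N F" and ?Z = "F ` Pow {..<n}"
  have nN: "n < N" "0 < N" using large by auto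
  define \<sigma>1 where "\<sigma>1 = ?R (Asg r_index 0 1 0) \<sigma>0"
  have "m \<le> N \<Longrightarrow> (?R (c_round l) ^^ m) \<sigma>1 r_index 0 0 = int m \<and> (\<forall>p<m. logged ((?R (c_round l) ^^ m) \<sigma>1) p)" for m
  proof (induction m)
    case 0
    then show ?case using nN unfolding \<sigma>1_def by simp
  next
    case (Suc m)
    then show ?case using run_round[of "(?R (c_round l) ^^ m) \<sigma>1" m] by simp
  qed
  from this[of N] have log: "logged (?R (Rep (c_round l)) \<sigma>1) m" if "m < N" for m using that by simp
  define \<sigma>2 where "\<sigma>2 = ?R (Rep (c_round l)) \<sigma>1"
  note log = log[folded \<sigma>2_def]
  let ?g = "\<lambda>m. \<sigma>2 r_vals 0 m" and ?Y = "(\<lambda>m. \<sigma>2 r_vals 0 m) ` {..<N}"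
  have finZ: "finite ?Z" by simp
  have YZ: "?Y \<subseteq> ?Z"
  proof
    fix y assume "y \<in> ?Y"
    then obtain m where m: "m < N" "y = ?g m" by auto
    then have "y = F (found \<sigma>2 m)" "found \<sigma>2 m \<in> Pow {..<n}" using log unfolding logged_def found_def by auto
    then show "y \<in> ?Z" by blast
  qed
  let ?z = "sorted_list_of_set ?Z ! l"
  have z: "?z \<in> ?Z" "card {y \<in> ?Z. y < ?z} = l" using sorted_list_rank[OF finZ k] by auto
  \<comment> \<open>A value up to \<open>?z\<close> has at most \<open>l\<close> smaller ones, so a
    set attaining it is isolated by one of the intervals tried.\<close>
  have low: "y \<in> ?Y" if y: "y \<in> ?Z" "y \<le> ?z" for y
  proof -
    obtain X0 where X0: "X0 \<subseteq> {..<n}" "y = F X0" using y(1) by auto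
    have "card {x \<in> ?Z. x < F X0} \<le> card {x \<in> ?Z. x < ?z}" using y X0 finZ by (intro card_mono) auto
    then obtain m where "m < N" "?g m = F X0" using logged_covers[OF log X0(1)] z(2) by auto
    then show ?thesis using X0(2) by (intro image_eqI[of _ _ m]) auto
  qed
  have "{y \<in> ?Y. y < ?z} = {y \<in> ?Z. y < ?z}" using YZ low by fastforce
  then have zY: "card {y \<in> ?Y. y < ?z} = l" "?z \<in> ?Y" using z low by auto
  define io where "io = first N (\<lambda>i. l = card {y \<in> ?Y. y < ?g i})"
  define \<sigma>3 where "\<sigma>3 = ?R (Asg r_choice 0 1 (Mu 2 (EqE (Lit (int l))
       (Summ 3 (LtE (A1 r_vals (Var 3)) (A1 r_vals (Var 2)) *
          NotE (ExE 4 (LtE (Var 4) (Var 3) * EqE (A1 r_vals (Var 4)) (A1 r_vals (Var 3))))))))) \<sigma>2"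
  have count: "card ({..<N} \<inter> {p. ?g p < x} \<inter> {p. \<forall>q<p. ?g q \<noteq> ?g p}) = card {y \<in> ?Y. y < x}" for x
  proof -
    have "{..<N} \<inter> {p. ?g p < x} \<inter> {p. \<forall>q<p. ?g q \<noteq> ?g p} = {p. p < N \<and> ?g p < x \<and> \<not> (\<exists>q<p. ?g q = ?g p)}"
      by auto
    then show ?thesis using card_first_occurrences[of N "\<lambda>y. y < x" ?g] by simp
  qed
  have "ev n N F \<sigma>2 \<rho> (EqE (Lit (int l)) (Summ 3 (LtE (A1 r_vals (Var 3)) (A1 r_vals (Var 2)) *
          NotE (ExE 4 (LtE (Var 4) (Var 3) * EqE (A1 r_vals (Var 4)) (A1 r_vals (Var 3)))))))
     = of_bool (l = card {y \<in> ?Y. y < ?g (\<rho> 2)})" for \<rho>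
    using count[of "?g (\<rho> 2)"] by simp
  then have i3: "\<sigma>3 r_choice 0 0 = int io" unfolding \<sigma>3_def io_def using nN by (simp del: ev_logic)
  have ex: "\<exists>i<N. l = card {y \<in> ?Y. y < ?g i}" using zY by auto
  then have ioN: "io < N" unfolding io_def first_less_iff .
  then have io: "l = card {y \<in> ?Y. y < ?g io}" unfolding io_def by (rule first_holds)
  have "?g io = ?z" by (rule rank_unique[of ?Y]) (use zY io ioN in auto)
  moreover have "?R (c_kth l) \<sigma>0 r_out 0 v = \<sigma>2 r_sets io v" if "v < n" for v
  proof -
    have "?R (c_kth l) \<sigma>0 = ?R (Asg r_out 0 1 (Arr r_sets (A0 r_choice) (Var 1))) \<sigma>3"
      unfolding c_kth_def c_select_def \<sigma>3_def \<sigma>2_def \<sigma>1_def run.simps(2) ..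
    moreover have "\<sigma>3 r_sets = \<sigma>2 r_sets" unfolding \<sigma>3_def by (rule run_frame) simp
    ultimately show ?thesis using that nN i3 by simp
  qed
  then have "{v. v < n \<and> ?R (c_kth l) \<sigma>0 r_out 0 v \<noteq> 0} = found \<sigma>2 io" unfolding found_def by auto
  ultimately show ?thesis using log[OF ioN] unfolding logged_def by simp
qed

end

text \<open>In the exponent, 8 provides for the steps and rows of the minimisation and
  \<open>2 * l\<close> for the codes of the pairs.\<close>

lemma psize_large:
  "(n + 1) * (n + 2) ^ 6 + n + 2 \<le> psize (8 + 2 * l) n" "(n + 1) ^ (2 * l) \<le> psize (8 + 2 * l) n"
proof -
  have p: "psize (8 + 2 * l) n = (n + 2) ^ 8 * (n + 2) ^ (2 * l)" by (simp add: psize_def power_add)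
  have "n + 2 \<le> (n + 2) ^ 6" using power_increasing[of 1 6 "n + 2"] by simp
  then have "(n + 1) * (n + 2) ^ 6 + n + 2 \<le> (n + 2) * (n + 2) ^ 6" by (simp add: algebra_simps)
  also have "\<dots> \<le> (n + 2)\<^sup>2 * (n + 2) ^ 6" by (intro mult_right_mono) (auto simp: power2_eq_square)
  also have "\<dots> = (n + 2) ^ 8 * 1" by (simp flip: power_add)
  also have "\<dots> \<le> (n + 2) ^ 8 * (n + 2) ^ (2 * l)" by (intro mult_left_mono) auto
  finally show "(n + 1) * (n + 2) ^ 6 + n + 2 \<le> psize (8 + 2 * l) n" unfolding p .
  have "(n + 1) ^ (2 * l) \<le> (n + 2) ^ (2 * l)" by (rule power_mono) auto
  also have "\<dots> \<le> (n + 2) ^ 8 * (n + 2) ^ (2 * l)" by simp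
  finally show "(n + 1) ^ (2 * l) \<le> psize (8 + 2 * l) n" unfolding p .
qed

theorem corollary4p3:
  fixes k :: nat
  assumes "k \<ge> 1"
  shows "\<exists>(c :: com) (p :: nat poly).
    \<forall>(V :: 'a set) (e :: nat \<Rightarrow> 'a) (f :: 'a set \<Rightarrow> int).
      finite V \<longrightarrow> bij_betw e {..<card V} V \<longrightarrow> submodular_on V f \<longrightarrow>
      (\<exists>T X. computes_set c V e f T X \<and> T \<le> poly p (card V) \<and>
        (k \<le> card (f ` Pow V) \<longrightarrow> X \<subseteq> V \<and> f X = kth_smallest_value V f k))"
proof -
  \<comment> \<open>The number of values below the sought one, which bounds the sizes of both
    \<open>S\<close> and \<open>T\<close>.\<close>
  define l where "l = k - 1"
  obtain c p where cp: "\<And>n F. \<exists>T t. exec n F c (input_mem n) T t \<and> T \<le> poly p n \<and>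
     stored_set n t 1 = {i. i < n \<and> run n (psize (8 + 2 * l) n) F (c_kth l) (\<lambda>_ _ _. 0) r_out 0 i \<noteq> 0}"
    using program_exists[of "8 + 2 * l" "c_kth l" r_out] by blast
  show ?thesis
  proof (rule exI[of _ c], rule exI[of _ p], intro allI impI)
    fix V :: "'a set" and e :: "nat \<Rightarrow> 'a" and f :: "'a set \<Rightarrow> int"
    assume V: "finite V" and e: "bij_betw e {..<card V} V" and f: "submodular_on V f"
    let ?n = "card V" and ?F = "\<lambda>A. f (e ` A)"
    have inj: "inj_on e {..<?n}" and im: "e ` {..<?n} = V" using e unfolding bij_betw_def by auto
    \<comment> \<open>Transport along the enumeration keeps the set of values, hence also their
      ranks.\<close>
    have Z: "?F ` Pow {..<?n} = f ` Pow V"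
    proof -
      have "(`) e ` Pow {..<?n} = Pow V" using image_Pow_surj[OF im] .
      moreover have "?F ` Pow {..<?n} = f ` ((`) e ` Pow {..<?n})" by (rule image_image[symmetric])
      ultimately show ?thesis by simp
    qed
    interpret kth_search ?n "psize (8 + 2 * l) ?n" l ?F
    proof
      fix X Y assume XY: "X \<subseteq> {..<?n}" "Y \<subseteq> {..<?n}"
      then have "e ` X \<subseteq> V" "e ` Y \<subseteq> V" using im by auto
      then have "f (e ` X \<union> e ` Y) + f (e ` X \<inter> e ` Y) \<le> f (e ` X) + f (e ` Y)"
        using f unfolding submodular_on_def by blast
      then show "f (e ` (X \<union> Y)) + f (e ` (X \<inter> Y)) \<le> f (e ` X) + f (e ` Y)"
        using inj_on_image_Int[OF inj XY] by (simp add: image_Un)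
    qed (rule psize_large)+
    obtain T t where t: "exec ?n ?F c (input_mem ?n) T t" "T \<le> poly p ?n"
      "stored_set ?n t 1 = {i. i < ?n \<and> run ?n (psize (8 + 2 * l) ?n) ?F (c_kth l) (\<lambda>_ _ _. 0) r_out 0 i \<noteq> 0}"
      using cp by blast
    have "e ` stored_set ?n t 1 \<subseteq> V" using im unfolding stored_set_def by auto
    moreover have "f (e ` stored_set ?n t 1) = kth_smallest_value V f k" if "k \<le> card (f ` Pow V)"
      unfolding kth_smallest_value_def t(3) l_def[symmetric] Z[symmetric]
      by (rule run_kth) (use that assms in \<open>simp add: Z l_def\<close>)
    ultimately show "\<exists>T X. computes_set c V e f T X \<and> T \<le> poly p (card V) \<and>
        (k \<le> card (f ` Pow V) \<longrightarrow> X \<subseteq> V \<and> f X = kth_smallest_value V f k)"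
      using t(1,2) unfolding computes_set_def by blast
  qed
qed

end
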